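(* Let $K=\bigoplus_{\mathbb{Z}}\mathbb{Z}/2\mathbb{Z}$ with $\mathbb{Z}$ acting by translation of indices, so that $(\mathbb{Z}/2\mathbb{Z})\wr\mathbb{Z}=K\rtimes\mathbb{Z}$ is the lamplighter group. There is an isomorphism $$\operatorname{Comm}\bigl((\mathbb{Z}/2\mathbb{Z})\wr\mathbb{Z}\bigr)\;\cong\;\bigl(\operatorname{VDer}(\mathbb{Z},K)\rtimes\operatorname{Comm}_\infty(K)\bigr)\rtimes(\mathbb{Z}/2\mathbb{Z}).$$
   Context: A partial automorphism of a group $\Gamma$ is an isomorphism between two finite-index subgroups of $\Gamma$; two are equivalent if they agree on some finite-index subgroup. A commensuration is an equivalence class of partial automorphisms, and the abstract commensurator $\operatorname{Comm}(\Gamma)$ is the group of commensurations under composition. Let $e_i$ denote the generator of the $i$-th factor of $K=\bigoplus_{\mathbb{Z}}\mathbb{Z}/2\mathbb{Z}$, and let $t$ be the generator of $\mathbb{Z}$, so $t^m e_i t^{-m}=e_{i+m}$ in $\Gamma=K\rtimes\mathbb{Z}$. For a group $G$ and a $G$-module $A$, a derivation $\tau:G\to A$ is a map with $\tau(g_1g_2)=\tau(g_1)+g_1\cdot\tau(g_2)$; these form an abelian group $\operatorname{Der}(G,A)$. Define $\operatorname{VDer}(G,A):=\varinjlim_{[G:H]<\infty}\operatorname{Der}(H,A)$, the direct limit over finite-index subgroups $H\le G$ under restriction; that is, derivations from finite-index subgroups of $G$ to $A$, two being identified if they agree on a finite-index subgroup. For $m\ge1$, $\operatorname{Comm}(K)^{m\mathbb{Z}}$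 is the group of $m\mathbb{Z}$-equivariant commensurations of $K$, i.e. those represented by an $m\mathbb{Z}$-equivariant isomorphism $H_1\to H_2$ between $m\mathbb{Z}$-invariant finite-index subgroups of $K$. There are inclusions $\operatorname{Comm}(K)^{m\mathbb{Z}}\to\operatorname{Comm}(K)^{n\mathbb{Z}}$ whenever $m\mid n$, and $\operatorname{Comm}_\infty(K):=\varinjlim_m\operatorname{Comm}(K)^{m\mathbb{Z}}$. Actions: $\operatorname{Comm}_\infty(K)$ acts on $\operatorname{VDer}(\mathbb{Z},K)$ by postcomposition (after restricting a virtual derivation to a finite-index subgroup on which the composition is defined). The factor $\mathbb{Z}/2\mathbb{Z}$ acts as conjugation by the automorphism of $\Gamma$ given by $t\mapsto t^{-1}$, $e_i\mapsto e_{-i}$: writing $\sigma:K\to K$ for $e_i\mapsto e_{-i}$, it sends $\tau\in\operatorname{VDer}(\mathbb{Z},K)$ to $n\mapsto\sigma(\tau(-n))$ and $\beta\in\operatorname{Comm}_\infty(K)$ to $\sigma\beta\sigma^{-1}$. *)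

theory Defs
  imports "HOL-Algebra.Product_Groups"
begin

section \<open>Semidirect products and direct limits\<close>

definition semidirect ::
  "('n, 'a) monoid_scheme \<Rightarrow> ('h, 'b) monoid_scheme \<Rightarrow> ('h \<Rightarrow> 'n \<Rightarrow> 'n) \<Rightarrow> ('n \<times> 'h) monoid"
  where "semidirect N H \<phi> =
    \<lparr>carrier = carrier N \<times> carrier H,
     monoid.mult = (\<lambda>(n, h) (n', h'). (n \<otimes>\<^bsub>N\<^esub> \<phi> h n', h \<otimes>\<^bsub>H\<^esub> h')),
     one = (\<one>\<^bsub>N\<^esub>, \<one>\<^bsub>H\<^esub>)\<rparr>"

text \<open>
  The direct limit of the groups \<open>G i\<close>, \<open>i \<in> I\<close>, along transition homomorphisms
  \<open>\<rho> i j : G i \<rightarrow> G j\<close> for \<open>leq i j\<close>. The preorder \<open>leq\<close> is meant to be directed on \<open>I\<close>.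
  Elements are equivalence classes of pairs \<open>(i, x)\<close> with \<open>x \<in> G i\<close>. Here and below, an
  operation on classes is the union of the classes obtained from all admissible choices of
  representatives; when the operation is well defined, all these classes coincide.
\<close>

definition dirlim_rel ::
  "'i set \<Rightarrow> ('i \<Rightarrow> 'i \<Rightarrow> bool) \<Rightarrow> ('i \<Rightarrow> ('a, 'b) monoid_scheme) \<Rightarrow> ('i \<Rightarrow> 'i \<Rightarrow> 'a \<Rightarrow> 'a)
    \<Rightarrow> (('i \<times> 'a) \<times> ('i \<times> 'a)) set"
  where "dirlim_rel I leq G \<rho> =
    {((i, x), (j, y)). i \<in> I \<and> j \<in> I \<and> x \<in> carrier (G i) \<and> y \<in> carrier (G j) \<and>
       (\<exists>k\<in>I. leq i k \<and> leq j k \<and> \<rho> i k x = \<rho> j k y)}"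

definition dirlim ::
  "'i set \<Rightarrow> ('i \<Rightarrow> 'i \<Rightarrow> bool) \<Rightarrow> ('i \<Rightarrow> ('a, 'b) monoid_scheme) \<Rightarrow> ('i \<Rightarrow> 'i \<Rightarrow> 'a \<Rightarrow> 'a)
    \<Rightarrow> ('i \<times> 'a) set monoid"
  where "dirlim I leq G \<rho> =
    \<lparr>carrier = (SIGMA i:I. carrier (G i)) // dirlim_rel I leq G \<rho>,
     monoid.mult = (\<lambda>C D. \<Union>{dirlim_rel I leq G \<rho> `` {(k, \<rho> i k x \<otimes>\<^bsub>G k\<^esub> \<rho> j k y)} | i x j y k.
                        (i, x) \<in> C \<and> (j, y) \<in> D \<and> k \<in> I \<and> leq i k \<and> leq j k}),
     one = (\<Union>i\<in>I. dirlim_rel I leq G \<rho> `` {(i, \<one>\<^bsub>G i\<^esub>)})\<rparr>"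


section \<open>The abstract commensurator\<close>

definition fin_index_subgroup :: "'a set \<Rightarrow> ('a, 'b) monoid_scheme \<Rightarrow> bool"
  where "fin_index_subgroup H G \<longleftrightarrow> subgroup H G \<and> finite (rcosets\<^bsub>G\<^esub> H)"

text \<open>
  A partial automorphism \<open>H\<^sub>1 \<rightarrow> H\<^sub>2\<close> is encoded as the pair \<open>(H\<^sub>1, f)\<close>, where \<open>f\<close> is
  \<open>undefined\<close> outside \<open>H\<^sub>1\<close>; its target \<open>H\<^sub>2\<close> is \<open>f ` H\<^sub>1\<close>.
\<close>

type_synonym 'a partial_aut = "'a set \<times> ('a \<Rightarrow> 'a)"
type_synonym 'a comm_class = "'a partial_aut set"

definition partial_auts :: "('a, 'b) monoid_scheme \<Rightarrow> 'a partial_aut set"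
  where "partial_auts G =
    {(H\<^sub>1, f). f \<in> extensional H\<^sub>1 \<and> fin_index_subgroup H\<^sub>1 G \<and>
       (\<exists>H\<^sub>2. fin_index_subgroup H\<^sub>2 G \<and> f \<in> iso (G\<lparr>carrier := H\<^sub>1\<rparr>) (G\<lparr>carrier := H\<^sub>2\<rparr>))}"

definition comm_rel ::
  "('a, 'b) monoid_scheme \<Rightarrow> ('a partial_aut \<times> 'a partial_aut) set"
  where "comm_rel G =
    {((H, f), (H', f')). (H, f) \<in> partial_auts G \<and> (H', f') \<in> partial_auts G \<and>
       (\<exists>L. fin_index_subgroup L G \<and> L \<subseteq> H \<inter> H' \<and> (\<forall>x\<in>L. f x = f' x))}"

definition pcomp :: "'a partial_aut \<Rightarrow> 'a partial_aut \<Rightarrow> 'a partial_aut"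
  where "pcomp = (\<lambda>(H, f) (H', f').
    let D = {x \<in> H'. f' x \<in> H} in (D, \<lambda>x\<in>D. f (f' x)))"

definition Comm :: "('a, 'b) monoid_scheme \<Rightarrow> 'a comm_class monoid"
  where "Comm G =
    \<lparr>carrier = partial_auts G // comm_rel G,
     monoid.mult = (\<lambda>c d. \<Union>p\<in>c. \<Union>q\<in>d. comm_rel G `` {pcomp p q}),
     one = comm_rel G `` {(carrier G, \<lambda>x\<in>carrier G. x)}\<rparr>"


section \<open>Virtual derivations\<close>

text \<open>The module \<open>A\<close> is written multiplicatively, with \<open>G\<close> acting through \<open>\<phi>\<close>.\<close>

definition Der ::
  "('g, 'b) monoid_scheme \<Rightarrow> ('a, 'c) monoid_scheme \<Rightarrow> ('g \<Rightarrow> 'a \<Rightarrow> 'a) \<Rightarrow> ('g \<Rightarrow> 'a) monoid"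
  where "Der G A \<phi> =
    \<lparr>carrier = {\<tau> \<in> carrier G \<rightarrow>\<^sub>E carrier A.
        \<forall>g\<in>carrier G. \<forall>h\<in>carrier G. \<tau> (g \<otimes>\<^bsub>G\<^esub> h) = \<tau> g \<otimes>\<^bsub>A\<^esub> \<phi> g (\<tau> h)},
     monoid.mult = (\<lambda>\<tau> \<tau>'. \<lambda>g\<in>carrier G. \<tau> g \<otimes>\<^bsub>A\<^esub> \<tau>' g),
     one = (\<lambda>g\<in>carrier G. \<one>\<^bsub>A\<^esub>)\<rparr>"

definition VDer_rel ::
  "('g, 'b) monoid_scheme \<Rightarrow> ('a, 'c) monoid_scheme \<Rightarrow> ('g \<Rightarrow> 'a \<Rightarrow> 'a)
    \<Rightarrow> (('g set \<times> ('g \<Rightarrow> 'a)) \<times> ('g set \<times> ('g \<Rightarrow> 'a))) set"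
  where "VDer_rel G A \<phi> =
    dirlim_rel {H. fin_index_subgroup H G} (\<lambda>H L. L \<subseteq> H)
      (\<lambda>H. Der (G\<lparr>carrier := H\<rparr>) A \<phi>) (\<lambda>H L \<tau>. restrict \<tau> L)"

definition VDer ::
  "('g, 'b) monoid_scheme \<Rightarrow> ('a, 'c) monoid_scheme \<Rightarrow> ('g \<Rightarrow> 'a \<Rightarrow> 'a)
    \<Rightarrow> ('g set \<times> ('g \<Rightarrow> 'a)) set monoid"
  where "VDer G A \<phi> =
    dirlim {H. fin_index_subgroup H G} (\<lambda>H L. L \<subseteq> H)
      (\<lambda>H. Der (G\<lparr>carrier := H\<rparr>) A \<phi>) (\<lambda>H L \<tau>. restrict \<tau> L)"


section \<open>The lamplighter group\<close>

type_synonym lamp = "int \<Rightarrow> int"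

definition lampK :: "lamp monoid"
  where "lampK = sum_group UNIV (\<lambda>_::int. integer_mod_group 2)"

text \<open>
  The generator \<open>e\<^sub>i\<close> of the \<open>i\<close>-th factor is \<open>\<lambda>j. if j = i then 1 else 0\<close>, and \<open>shiftK n\<close> is the
  action of \<open>t^n\<close>.
\<close>

definition shiftK :: "int \<Rightarrow> lamp \<Rightarrow> lamp"
  where "shiftK n x = (\<lambda>i. x (i - n))"

lemma shiftK_generator:
  "shiftK n (\<lambda>j. if j = i then 1 else 0) = (\<lambda>j. if j = i + n then 1 else 0)"
  by (auto simp: shiftK_def fun_eq_iff)

definition lamplighter :: "(lamp \<times> int) monoid"
  where "lamplighter = semidirect lampK integer_group shiftK"


section \<open>Equivariant commensurations of the base group\<close>

type_synonym lamp_comm_inf = "(nat \<times> lamp comm_class) set"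
type_synonym lamp_vder = "(int set \<times> (int \<Rightarrow> lamp)) set"

definition multiples :: "nat \<Rightarrow> int set"
  where "multiples m = {n. int m dvd n}"

definition equivariant :: "nat \<Rightarrow> lamp partial_aut \<Rightarrow> bool"
  where "equivariant m = (\<lambda>(H, f). \<forall>n\<in>multiples m.
    shiftK n ` H = H \<and> shiftK n ` (f ` H) = f ` H \<and> (\<forall>x\<in>H. f (shiftK n x) = shiftK n (f x)))"

definition CommK_equiv :: "nat \<Rightarrow> lamp comm_class monoid"
  where "CommK_equiv m =
    (Comm lampK)\<lparr>carrier := {c \<in> carrier (Comm lampK). \<exists>p\<in>c. equivariant m p}\<rparr>"

definition Comm_inf :: "lamp_comm_inf monoid"
  where "Comm_inf = dirlim {m. 1 \<le> m} (dvd) CommK_equiv (\<lambda>m n c. c)"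


section \<open>The actions\<close>

text \<open>
  Postcomposition. A representative \<open>(H, f)\<close> of a commensuration that is equivariant under
  \<open>m\<int>\<close> is composed with \<open>\<tau>\<close> on those finite-index subgroups \<open>L\<close> of \<open>m\<int>\<close> inside the domain
  of \<open>\<tau>\<close> for which \<open>\<tau> ` L \<subseteq> H\<close>; the containment in \<open>m\<int>\<close> makes \<open>f \<circ> \<tau>\<close> a derivation on \<open>L\<close>.
\<close>

definition Comm_inf_act :: "lamp_comm_inf \<Rightarrow> lamp_vder \<Rightarrow> lamp_vder"
  where "Comm_inf_act B T =
    \<Union>{VDer_rel integer_group lampK shiftK `` {(L, \<lambda>n\<in>L. f (\<tau> n))} | m c H f M \<tau> L.
        (m, c) \<in> B \<and> (H, f) \<in> c \<and> equivariant m (H, f) \<and> (M, \<tau>) \<in> T \<and>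
        fin_index_subgroup L integer_group \<and> L \<subseteq> M \<inter> multiples m \<and> \<tau> ` L \<subseteq> H}"

definition flipK :: "lamp \<Rightarrow> lamp"
  where "flipK x = (\<lambda>i. x (- i))"

lemma flipK_generator:
  "flipK (\<lambda>j. if j = i then 1 else 0) = (\<lambda>j. if j = - i then 1 else 0)"
  by (auto simp: flipK_def fun_eq_iff)

definition flip_comm :: "lamp comm_class"
  where "flip_comm = comm_rel lampK `` {(carrier lampK, restrict flipK (carrier lampK))}"

text \<open>
  In the next two definitions the map on representatives is an equivalence-preserving
  bijection, so the image of a class is a class. The domain \<open>M\<close> of a virtual derivation is a
  subgroup of \<open>\<int>\<close>, hence stable under negation.
\<close>

definition flip_VDer :: "lamp_vder \<Rightarrow> lamp_vder"
  where "flip_VDer T = (\<lambda>(M, \<tau>). (M, \<lambda>n\<in>M. flipK (\<tau> (- n)))) ` T"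

definition flip_Comm_inf :: "lamp_comm_inf \<Rightarrow> lamp_comm_inf"
  where "flip_Comm_inf B =
    (\<lambda>(m, c). (m, flip_comm \<otimes>\<^bsub>Comm lampK\<^esub> c \<otimes>\<^bsub>Comm lampK\<^esub> inv\<^bsub>Comm lampK\<^esub> flip_comm)) ` B"

definition flip_act :: "int \<Rightarrow> lamp_vder \<times> lamp_comm_inf \<Rightarrow> lamp_vder \<times> lamp_comm_inf"
  where "flip_act s = (\<lambda>(T, B). if s = 0 then (T, B) else (flip_VDer T, flip_Comm_inf B))"

end

theory Submission
  imports Defs
begin

text \<open>
  A finite-index subgroup of \<open>\<Gamma> = K \<rtimes> \<int>\<close> contains a subgroup \<open>A \<rtimes> m\<int>\<close> with \<open>A\<close> of finite index
  in \<open>K\<close>, and a partial automorphism \<open>F\<close> preserves \<open>K\<close>, its torsion. On \<open>A\<close> it restricts to some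
  \<open>f\<close> with \<open>f t\<^sup>m = t\<^sup>q f\<close>, where \<open>F t\<^sup>m \<in> K t\<^sup>q\<close>. Counting supports shows that such a
  virtual embedding of \<open>K\<close> requires \<open>m \<le> \<bar>q\<bar>\<close>; with the same bound for the inverse, \<open>q = \<plusminus>m\<close>.
  Up to the flip, therefore, \<open>F (x, n) = (f x + \<tau> n, n)\<close> with \<open>f\<close> an \<open>m\<int>\<close>-equivariant
  commensuration and \<open>\<tau>\<close> a derivation on \<open>m\<int>\<close>. Composition of these normal forms is the
  semidirect product law, because a derivation maps a small enough \<open>k\<int>\<close> into any given
  invariant finite-index subgroup of \<open>K\<close>.
\<close>

section \<open>Finite-index subgroups\<close>

text \<open>Both groups are described by the same data: a level \<open>m\<close>, a derivation
  \<open>\<tau>\<close> on mZ, an mZ-equivariant partial automorphism \<open>p\<close> of K and a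
  sign \<open>s\<close>. Every element on either side comes from such data, two data give the same
  element on one side iff they do on the other, and a single datum represents the product on both
  sides; together this is the isomorphism. All objects are germs, so most of the work lies in
  finding a level deep enough for whatever is to be composed or compared. Invariance is the
  obstacle: A x mZ is a subgroup only if A is mZ-invariant, whereas a subgroup on which two
  commensurations agree need not be. The bound m \<le> |q| counts elements: the 2^(mN) elements
  supported in a window of length mN inject into those supported in a window of length N|q| plus a
  constant. The argument cuts elements of K into blocks of length m, and the blocks of an element of
  a finite-index subgroup may leave that subgroup; hence the detour through an embedding of all of
  K.\<close>

lemma fin_index_subgroupD: "fin_index_subgroup H G \<Longrightarrow> subgroup H G"
  by (simp add: fin_index_subgroup_def)

text \<open>Since \<open>g\<close> and \<open>s\<close> lie in one right coset iff
  \<open>g \<otimes> inv s \<in> H\<close>, the set \<open>S\<close> is a finite set meeting every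
  coset. In this form finite index passes to larger subgroups, towers and products by giving
  representatives.\<close>

lemma (in group) fin_index_subgroup_iff_cover:
  "fin_index_subgroup H G \<longleftrightarrow> subgroup H G \<and>
    (\<exists>S. finite S \<and> S \<subseteq> carrier G \<and> (\<forall>g\<in>carrier G. \<exists>s\<in>S. g \<otimes> inv s \<in> H))"
proof (intro iffI conjI)
  assume H: "fin_index_subgroup H G"
  then show sub: "subgroup H G" by (rule fin_index_subgroupD)
  interpret H: subgroup H G by (rule sub)
  define S where "S = (\<lambda>C. SOME x. x \<in> C) ` (rcosets H)"
  have some: "(SOME x. x \<in> C) \<in> C" if "C \<in> rcosets H" for C
  proof -
    from that obtain g where "g \<in> carrier G" "C = H #> g" by (auto simp: RCOSETS_def)
    then have "g \<in> C" using rcos_self sub by blast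
    then show ?thesis by (rule someI)
  qed
  have "finite S" using H by (simp add: S_def fin_index_subgroup_def)
  moreover have "S \<subseteq> carrier G"
    using some H.rcosets_carrier[OF group_axioms] by (force simp: S_def)
  moreover have "\<exists>s\<in>S. g \<otimes> inv s \<in> H" if g: "g \<in> carrier G" for g
  proof -
    define s where "s = (SOME x. x \<in> H #> g)"
    have C: "H #> g \<in> rcosets H" using g by (auto simp: RCOSETS_def)
    have s: "s \<in> H #> g" using some[OF C] by (simp add: s_def)
    then obtain h where h: "h \<in> H" "s = h \<otimes> g" by (auto simp: r_coset_def)
    have "g \<otimes> inv s = inv h"
      using h g by (simp add: inv_mult_group m_assoc[symmetric])
    moreover have "s \<in> S" using C by (auto simp: S_def s_def)
    ultimately show ?thesis using h by (metis H.m_inv_closed)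
  qed
  ultimately show "\<exists>S. finite S \<and> S \<subseteq> carrier G \<and> (\<forall>g\<in>carrier G. \<exists>s\<in>S. g \<otimes> inv s \<in> H)"
    by blast
next
  assume "subgroup H G \<and>
    (\<exists>S. finite S \<and> S \<subseteq> carrier G \<and> (\<forall>g\<in>carrier G. \<exists>s\<in>S. g \<otimes> inv s \<in> H))"
  then obtain S where sub: "subgroup H G" and S: "finite S" "S \<subseteq> carrier G"
    "\<And>g. g \<in> carrier G \<Longrightarrow> \<exists>s\<in>S. g \<otimes> inv s \<in> H" by blast
  interpret H: subgroup H G by (rule sub)
  have "rcosets H \<subseteq> (\<lambda>s. H #> s) ` S"
  proof
    fix C assume "C \<in> rcosets H"
    then obtain g where g: "g \<in> carrier G" "C = H #> g" by (auto simp: RCOSETS_def)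
    obtain s where s: "s \<in> S" "g \<otimes> inv s \<in> H" using S(3) g by blast
    then have "g \<in> H #> s" using H.rcos_module_rev[OF group_axioms] S g by blast
    then have "H #> s = H #> g" using repr_independence s S sub by blast
    then show "C \<in> (\<lambda>s. H #> s) ` S" using s g by blast
  qed
  then show "fin_index_subgroup H G"
    using sub S(1) unfolding fin_index_subgroup_def by (meson finite_imageI finite_subset)
qed

lemma (in group) fin_index_carrier: "fin_index_subgroup (carrier G) G"
  unfolding fin_index_subgroup_iff_cover
  by (intro conjI exI[of _ "{\<one>}"]) (auto simp: subgroup_self)

lemma (in group) fin_index_superset:
  assumes "fin_index_subgroup L G" "L \<subseteq> H" "subgroup H G"
  shows "fin_index_subgroup H G"
  using assms unfolding fin_index_subgroup_iff_cover by (meson subsetD)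

text \<open>Every coset of the preimage is itself the preimage of a coset of \<open>H'\<close>, so
  the index cannot grow.\<close>

lemma (in group_hom) fin_index_vimage:
  assumes "fin_index_subgroup H' H"
  shows "fin_index_subgroup {x \<in> carrier G. h x \<in> H'} G"
proof -
  have hom_diff: "h (x \<otimes> inv y) = h x \<otimes>\<^bsub>H\<^esub> inv\<^bsub>H\<^esub> h y \<and> x \<otimes> inv y \<in> carrier G"
    if "x \<in> carrier G" "y \<in> carrier G" for x y
    using that by simp
  interpret H': subgroup H' H using assms by (rule fin_index_subgroupD)
  let ?P = "{x \<in> carrier G. h x \<in> H'}"
  have sub: "subgroup ?P G" by (rule subgroup.intro) auto
  then interpret P: subgroup ?P G .
  have "rcosets\<^bsub>G\<^esub> ?P \<subseteq> (\<lambda>C. {x \<in> carrier G. h x \<in> C}) ` (rcosets\<^bsub>H\<^esub> H')"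
  proof
    fix C assume "C \<in> rcosets\<^bsub>G\<^esub> ?P"
    then obtain g where g: "g \<in> carrier G" "C = ?P #>\<^bsub>G\<^esub> g"
      unfolding RCOSETS_def by blast
    have "x \<in> C \<longleftrightarrow> h x \<in> H' #>\<^bsub>H\<^esub> h g" if "x \<in> carrier G" for x
    proof -
      have "x \<in> C \<longleftrightarrow> x \<otimes> inv g \<in> ?P"
        unfolding g(2) by (rule P.rcos_module[OF G.group_axioms g(1) that])
      also have "\<dots> \<longleftrightarrow> h x \<otimes>\<^bsub>H\<^esub> inv\<^bsub>H\<^esub> h g \<in> H'"
        using hom_diff[OF that g(1)] by (simp only: mem_Collect_eq simp_thms)
      also have "\<dots> \<longleftrightarrow> h x \<in> H' #>\<^bsub>H\<^esub> h g"
        by (rule H'.rcos_module[OF H.group_axioms, symmetric]) (intro hom_closed g(1) that)+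
      finally show ?thesis .
    qed
    moreover have "C \<subseteq> carrier G" unfolding g(2) by (rule G.r_coset_subset_G[OF P.subset g(1)])
    ultimately have "C = {x \<in> carrier G. h x \<in> H' #>\<^bsub>H\<^esub> h g}" by blast
    then show "C \<in> (\<lambda>C. {x \<in> carrier G. h x \<in> C}) ` (rcosets\<^bsub>H\<^esub> H')"
      using hom_closed[OF g(1)] unfolding RCOSETS_def by blast
  qed
  then show ?thesis
    using assms sub unfolding fin_index_subgroup_def by (meson finite_subset finite_imageI)
qed

lemma (in group) fin_index_trans:
  assumes L: "fin_index_subgroup L (G\<lparr>carrier := H\<rparr>)" and H: "fin_index_subgroup H G"
  shows "fin_index_subgroup L G"
proof -
  have diff: "g \<otimes> inv (r \<otimes> s) = g \<otimes> inv s \<otimes> inv r"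
    if "g \<in> carrier G" "r \<in> carrier G" "s \<in> carrier G" for g r s
    using that by (simp add: inv_mult_group m_assoc)
  interpret H: subgroup H G using H by (rule fin_index_subgroupD)
  interpret GH: group "G\<lparr>carrier := H\<rparr>" by (rule H.subgroup_is_group[OF group_axioms])
  obtain S where S: "finite S" "S \<subseteq> carrier G" "\<And>g. g \<in> carrier G \<Longrightarrow> \<exists>s\<in>S. g \<otimes> inv s \<in> H"
    using H unfolding fin_index_subgroup_iff_cover by blast
  obtain R where R: "finite R" "R \<subseteq> H"
    "\<And>g. g \<in> H \<Longrightarrow> \<exists>r\<in>R. g \<otimes> inv\<^bsub>G\<lparr>carrier := H\<rparr>\<^esub> r \<in> L"
    using L unfolding GH.fin_index_subgroup_iff_cover by auto
  have sub: "subgroup L G"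
    using incl_subgroup[OF H.subgroup_axioms fin_index_subgroupD[OF L]] .
  \<comment> \<open>Representatives of a tower are the products of representatives; \<open>r\<close>
    stands on the left because right cosets are used.\<close>
  show ?thesis unfolding fin_index_subgroup_iff_cover
  proof (intro conjI exI[of _ "(\<lambda>(r, s). r \<otimes> s) ` (R \<times> S)"] ballI sub)
    show "finite ((\<lambda>(r, s). r \<otimes> s) ` (R \<times> S))" using R(1) S(1) by simp
    show "(\<lambda>(r, s). r \<otimes> s) ` (R \<times> S) \<subseteq> carrier G"
    proof (rule image_subsetI)
      fix p assume "p \<in> R \<times> S"
      then have "fst p \<in> carrier G" "snd p \<in> carrier G" using R(2) S(2) H.subset by auto
      then show "(case p of (r, s) \<Rightarrow> r \<otimes> s) \<in> carrier G" by (simp add: case_prod_unfold)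
    qed
    fix g assume g: "g \<in> carrier G"
    then obtain s where s: "s \<in> S" "g \<otimes> inv s \<in> H" using S by blast
    then obtain r where r: "r \<in> R" "g \<otimes> inv s \<otimes> inv\<^bsub>G\<lparr>carrier := H\<rparr>\<^esub> r \<in> L" using R by blast
    have c: "s \<in> carrier G" "r \<in> carrier G" "r \<in> H" using r(1) s(1) S(2) R(2) by auto
    have "g \<otimes> inv (r \<otimes> s) \<in> L"
      using r(2) unfolding diff[OF g c(2,1)] m_inv_consistent[OF H.subgroup_axioms c(3)] .
    then show "\<exists>t\<in>(\<lambda>(r, s). r \<otimes> s) ` (R \<times> S). g \<otimes> inv t \<in> L"
      using imageI[OF SigmaI[OF r(1) s(1)], of "\<lambda>(r, s). r \<otimes> s"] by (metis case_prod_conv)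
  qed
qed

lemma (in group) fin_index_restrict:
  assumes L: "fin_index_subgroup L G" and H: "subgroup H G" and "L \<subseteq> H"
  shows "fin_index_subgroup L (G\<lparr>carrier := H\<rparr>)"
proof -
  interpret H: subgroup H G by (rule H)
  interpret group_hom "G\<lparr>carrier := H\<rparr>" G "\<lambda>x. x"
    by (intro group_hom.intro group_hom_axioms.intro H.subgroup_is_group group_axioms)
      (auto simp: hom_def)
  have "{x \<in> H. x \<in> L} = L" using \<open>L \<subseteq> H\<close> by auto
  then show ?thesis using fin_index_vimage[OF L] by simp
qed

text \<open>Partial automorphisms, and derivations seen as sections of the projection to Z, are
  homomorphisms on a finite-index subgroup only. The preimage has finite index there, hence in the
  whole group.\<close>

lemma (in group) fin_index_hom_vimage:
  assumes H: "fin_index_subgroup H G" and L: "fin_index_subgroup L G'" and G': "group G'"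
    and f: "f \<in> hom (G\<lparr>carrier := H\<rparr>) G'"
  shows "fin_index_subgroup {x \<in> H. f x \<in> L} G"
proof -
  interpret H: subgroup H G using H by (rule fin_index_subgroupD)
  interpret h: group_hom "G\<lparr>carrier := H\<rparr>" G' f
    by (intro group_hom.intro group_hom_axioms.intro H.subgroup_is_group group_axioms G' f)
  show ?thesis using fin_index_trans[OF _ H] h.fin_index_vimage[OF L] by simp
qed

lemma (in group) fin_index_Int:
  assumes "fin_index_subgroup H G" "fin_index_subgroup L G"
  shows "fin_index_subgroup (H \<inter> L) G"
proof -
  have "(\<lambda>x. x) \<in> hom (G\<lparr>carrier := H\<rparr>) G"
    using subgroup.subset[OF fin_index_subgroupD[OF assms(1)]] by (auto simp: hom_def)
  from fin_index_hom_vimage[OF assms group_axioms this] show ?thesis by (simp add: Int_def)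
qed

text \<open>Serves to replace an arbitrary subgroup of agreement by the largest one, which inherits
  every invariance that the two maps have.\<close>

lemma (in group) subgroup_equalizer:
  assumes "subgroup H G" "group G'" "f \<in> hom (G\<lparr>carrier := H\<rparr>) G'" "g \<in> hom (G\<lparr>carrier := H\<rparr>) G'"
  shows "subgroup {x \<in> H. f x = g x} G"
proof -
  interpret H: subgroup H G by fact
  interpret G': group G' by fact
  have GH: "group (G\<lparr>carrier := H\<rparr>)" by (rule H.subgroup_is_group[OF group_axioms])
  interpret f: group_hom "G\<lparr>carrier := H\<rparr>" G' f
    using assms GH by (intro group_hom.intro group_hom_axioms.intro)
  interpret g: group_hom "G\<lparr>carrier := H\<rparr>" G' g
    using assms GH by (intro group_hom.intro group_hom_axioms.intro)
  show ?thesis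
  proof (rule subgroup.intro)
    show "x \<otimes> y \<in> {x \<in> H. f x = g x}" if "x \<in> {x \<in> H. f x = g x}" "y \<in> {x \<in> H. f x = g x}" for x y
      using that f.hom_mult[of x y] g.hom_mult[of x y] by simp
    show "\<one> \<in> {x \<in> H. f x = g x}" using f.hom_one g.hom_one by simp
    show "inv x \<in> {x \<in> H. f x = g x}" if "x \<in> {x \<in> H. f x = g x}" for x
      using that f.hom_inv[of x] g.hom_inv[of x] m_inv_consistent[OF H.subgroup_axioms, of x]
      by simp
  qed auto
qed

section \<open>The commensurator monoid\<close>

text \<open>The target can only be the image, so the existential quantifier over targets
  disappears.\<close>

lemma (in group) partial_auts_iff:
  "(H, f) \<in> partial_auts G \<longleftrightarrow> f \<in> extensional H \<and> fin_index_subgroup H G \<and>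
    f \<in> hom (G\<lparr>carrier := H\<rparr>) G \<and> inj_on f H \<and> fin_index_subgroup (f ` H) G"
proof
  assume "(H, f) \<in> partial_auts G"
  then obtain H2 where *: "f \<in> extensional H" "fin_index_subgroup H G" "fin_index_subgroup H2 G"
    "f \<in> iso (G\<lparr>carrier := H\<rparr>) (G\<lparr>carrier := H2\<rparr>)"
    by (auto simp: partial_auts_def)
  then have "f ` H = H2" "inj_on f H" by (auto simp: iso_iff)
  moreover have "f \<in> hom (G\<lparr>carrier := H\<rparr>) G"
    using * subgroup.subset[OF fin_index_subgroupD[OF *(3)]] by (auto simp: iso_def hom_def)
  ultimately show "f \<in> extensional H \<and> fin_index_subgroup H G \<and>
    f \<in> hom (G\<lparr>carrier := H\<rparr>) G \<and> inj_on f H \<and> fin_index_subgroup (f ` H) G" using * by simp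
next
  assume *: "f \<in> extensional H \<and> fin_index_subgroup H G \<and>
    f \<in> hom (G\<lparr>carrier := H\<rparr>) G \<and> inj_on f H \<and> fin_index_subgroup (f ` H) G"
  then have "f \<in> iso (G\<lparr>carrier := H\<rparr>) (G\<lparr>carrier := f ` H\<rparr>)"
    by (auto simp: iso_iff hom_def)
  with * show "(H, f) \<in> partial_auts G" by (auto simp: partial_auts_def)
qed

lemma (in group) partial_auts_hom:
  assumes "(H, f) \<in> partial_auts G"
  shows "group_hom (G\<lparr>carrier := H\<rparr>) G f"
  using assms
  by (intro group_hom.intro group_hom_axioms.intro subgroup.subgroup_is_group group_axioms)
    (auto simp: partial_auts_iff fin_index_subgroup_def)

text \<open>The image of \<open>L\<close> is the preimage of \<open>L\<close> under the inverse
  isomorphism.\<close>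

lemma (in group) partial_auts_image:
  assumes f: "(H, f) \<in> partial_auts G" and L: "fin_index_subgroup L G" "L \<subseteq> H"
  shows "fin_index_subgroup (f ` L) G"
proof -
  have "\<exists>H2. fin_index_subgroup H2 G \<and> f \<in> iso (G\<lparr>carrier := H\<rparr>) (G\<lparr>carrier := H2\<rparr>)"
    and H: "subgroup H G"
    using f by (auto simp: partial_auts_def fin_index_subgroup_def)
  then obtain H2 where H2: "fin_index_subgroup H2 G"
    and f': "f \<in> iso (G\<lparr>carrier := H\<rparr>) (G\<lparr>carrier := H2\<rparr>)" by blast
  have im: "f ` H = H2" and inj: "inj_on f H" using f' by (auto simp: iso_iff)
  have GH: "group (G\<lparr>carrier := H\<rparr>)" using subgroup.subgroup_is_group[OF H group_axioms] .
  let ?g = "inv_into H f"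
  have "?g \<in> iso (G\<lparr>carrier := H2\<rparr>) (G\<lparr>carrier := H\<rparr>)"
    using group.iso_set_sym[OF GH f'] by simp
  then have g: "?g \<in> hom (G\<lparr>carrier := H2\<rparr>) (G\<lparr>carrier := H\<rparr>)" by (simp add: iso_def)
  have "{x \<in> H2. ?g x \<in> L} = f ` L"
    using im inj L(2) by (auto simp: inv_into_f_f subset_iff image_iff) 
  then show ?thesis
    using fin_index_hom_vimage[OF H2 fin_index_restrict[OF L(1) H L(2)] GH g] by simp
qed

lemma (in group) pcomp_closed:
  assumes p: "p \<in> partial_auts G" and q: "q \<in> partial_auts G"
  shows "pcomp p q \<in> partial_auts G"
proof -
  obtain H f where p': "p = (H, f)" by force
  obtain H' f' where q': "q = (H', f')" by force
  have f: "(H, f) \<in> partial_auts G" and f': "(H', f') \<in> partial_auts G" using p q p' q' by auto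
  define D where "D = {x \<in> H'. f' x \<in> H}"
  have D: "fin_index_subgroup D G" unfolding D_def
    using f f' by (intro fin_index_hom_vimage group_axioms) (auto simp: partial_auts_iff)
  have "f ` (f' ` D) = (\<lambda>x. f (f' x)) ` D" by auto
  moreover have "fin_index_subgroup (f' ` D) G"
    by (rule partial_auts_image[OF f' D]) (auto simp: D_def)
  moreover have "f' ` D \<subseteq> H" by (auto simp: D_def)
  ultimately have "fin_index_subgroup ((\<lambda>x. f (f' x)) ` D) G"
    using partial_auts_image[OF f] by metis
  moreover have "x \<otimes> y \<in> D" if "x \<in> D" "y \<in> D" for x y
    using that D by (simp add: fin_index_subgroup_def subgroup.m_closed)
  moreover have "inj_on (\<lambda>x. f (f' x)) D"
    using f f' by (auto simp: partial_auts_iff D_def inj_on_def)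
  ultimately have "(D, \<lambda>x\<in>D. f (f' x)) \<in> partial_auts G"
    using D f f' unfolding partial_auts_iff hom_def by (auto simp: D_def inj_on_def)
  then show ?thesis by (simp add: pcomp_def p' q' D_def Let_def)
qed

lemma pcomp_Pair:
  "pcomp (H, f) (H', f') = ({x \<in> H'. f' x \<in> H}, \<lambda>x\<in>{x \<in> H'. f' x \<in> H}. f (f' x))"
  by (simp add: pcomp_def Let_def)

text \<open>An equality of representatives and not only of classes: a composite lives on its maximal
  domain and is \<open>undefined\<close> elsewhere.\<close>

lemma pcomp_assoc: "pcomp (pcomp p q) r = pcomp p (pcomp q r)"
  by (auto simp: pcomp_def Let_def fun_eq_iff split: prod.splits)

lemma comm_relI:
  assumes "(H, f) \<in> partial_auts G" "(H', f') \<in> partial_auts G"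
    and "fin_index_subgroup L G" "L \<subseteq> H" "L \<subseteq> H'" "\<And>x. x \<in> L \<Longrightarrow> f x = f' x"
  shows "((H, f), (H', f')) \<in> comm_rel G"
  using assms by (auto simp: comm_rel_def)

lemma comm_relE:
  assumes "((H, f), (H', f')) \<in> comm_rel G"
  obtains L where "(H, f) \<in> partial_auts G" "(H', f') \<in> partial_auts G"
    "fin_index_subgroup L G" "L \<subseteq> H" "L \<subseteq> H'" "\<forall>x\<in>L. f x = f' x"
  using assms by (auto simp: comm_rel_def)

lemma (in group) equiv_comm_rel: "equiv (partial_auts G) (comm_rel G)"
proof (rule equivI)
  show "refl_on (partial_auts G) (comm_rel G)"
  proof (rule refl_onI)
    fix p assume "p \<in> partial_auts G"
    then show "(p, p) \<in> comm_rel G"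
      by (cases p) (auto simp: comm_rel_def partial_auts_iff)
  qed
  show "sym (comm_rel G)"
    by (rule symI) (unfold comm_rel_def, clarsimp, metis)
  show "trans (comm_rel G)"
  proof (rule transI)
    fix p q r assume "(p, q) \<in> comm_rel G" "(q, r) \<in> comm_rel G"
    moreover obtain H f H' f' Q g where "p = (H, f)" "r = (H', f')" "q = (Q, g)"
      by (metis surj_pair)
    ultimately obtain L L' where
      *: "p = (H, f)" "r = (H', f')" "p \<in> partial_auts G" "r \<in> partial_auts G"
      "fin_index_subgroup L G" "fin_index_subgroup L' G"
      "L \<subseteq> H" "L' \<subseteq> H'" "\<And>x. x \<in> L \<Longrightarrow> f x = g x" "\<And>x. x \<in> L' \<Longrightarrow> g x = f' x"
      unfolding comm_rel_def by blast
    then show "(p, r) \<in> comm_rel G"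
      by (auto simp: comm_rel_def intro!: exI[of _ "L \<inter> L'"] fin_index_Int)
  qed
  show "comm_rel G \<subseteq> partial_auts G \<times> partial_auts G" by (auto simp: comm_rel_def)
qed

text \<open>The composites agree wherever the inner maps agree and take values in the subgroup on
  which the outer maps agree.\<close>

lemma (in group) comm_rel_pcomp:
  assumes "(p, p') \<in> comm_rel G" "(q, q') \<in> comm_rel G"
  shows "(pcomp p q, pcomp p' q') \<in> comm_rel G"
proof -
  obtain P f P' f' Q g Q' g' where eq: "p = (P, f)" "p' = (P', f')" "q = (Q, g)" "q' = (Q', g')"
    by (metis surj_pair)
  obtain L where
    p: "p = (P, f)" "p' = (P', f')" "p \<in> partial_auts G" "p' \<in> partial_auts G"
    "fin_index_subgroup L G" "L \<subseteq> P \<inter> P'" "\<And>x. x \<in> L \<Longrightarrow> f x = f' x"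
    using assms(1) eq unfolding comm_rel_def by blast
  obtain M where
    q: "q = (Q, g)" "q' = (Q', g')" "q \<in> partial_auts G" "q' \<in> partial_auts G"
    "fin_index_subgroup M G" "M \<subseteq> Q \<inter> Q'" "\<And>x. x \<in> M \<Longrightarrow> g x = g' x"
    using assms(2) eq unfolding comm_rel_def by blast
  have "g \<in> hom (G\<lparr>carrier := M\<rparr>) G"
    using q subgroup.m_closed[OF fin_index_subgroupD[OF q(5)]]
    by (auto simp: partial_auts_iff hom_def subset_iff)
  then have N: "fin_index_subgroup {x \<in> M. g x \<in> L} G"
    using fin_index_hom_vimage p q group_axioms by blast
  have "pcomp p q \<in> partial_auts G" "pcomp p' q' \<in> partial_auts G"
    using pcomp_closed p q by auto
  moreover have "{x \<in> M. g x \<in> L} \<subseteq> {x \<in> Q. g x \<in> P} \<inter> {x \<in> Q'. g' x \<in> P'}"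
    using p(6) q(6,7) by auto
  moreover have "\<forall>x\<in>{x \<in> M. g x \<in> L}. (\<lambda>x\<in>{x \<in> Q. g x \<in> P}. f (g x)) x
      = (\<lambda>x\<in>{x \<in> Q'. g' x \<in> P'}. f' (g' x)) x"
    using p(6,7) q(6,7) by force
  ultimately show ?thesis
    using comm_relI[OF _ _ N] unfolding p(1,2) q(1,2) pcomp_def Let_def by simp
qed

abbreviation cclass :: "('a, 'b) monoid_scheme \<Rightarrow> 'a partial_aut \<Rightarrow> 'a comm_class"
  where "cclass G p \<equiv> comm_rel G `` {p}"

lemma carrier_Comm: "carrier (Comm G) = partial_auts G // comm_rel G"
  by (simp add: Comm_def)

lemma (in group) cclass_eq_iff:
  "p \<in> partial_auts G \<Longrightarrow> q \<in> partial_auts G \<Longrightarrow> cclass G p = cclass G q \<longleftrightarrow> (p, q) \<in> comm_rel G"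
  using eq_equiv_class_iff[OF equiv_comm_rel] by metis

lemma cclass_in_Comm: "p \<in> partial_auts G \<Longrightarrow> cclass G p \<in> carrier (Comm G)"
  by (auto simp: carrier_Comm quotientI)

lemma (in group) Comm_mult_class:
  assumes "p \<in> partial_auts G" "q \<in> partial_auts G"
  shows "cclass G p \<otimes>\<^bsub>Comm G\<^esub> cclass G q = cclass G (pcomp p q)"
proof -
  have "cclass G (pcomp p' q') = cclass G (pcomp p q)"
    if "p' \<in> cclass G p" "q' \<in> cclass G q" for p' q'
    using that comm_rel_pcomp[of p p' q q'] equiv_class_eq[OF equiv_comm_rel] by simp
  then have "(\<Union>p'\<in>cclass G p. \<Union>q'\<in>cclass G q. cclass G (pcomp p' q'))
      = (\<Union>p'\<in>cclass G p. \<Union>q'\<in>cclass G q. cclass G (pcomp p q))"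
    by (intro SUP_cong refl)
  moreover have "cclass G p \<noteq> {}" "cclass G q \<noteq> {}"
    using assms equiv_class_self[OF equiv_comm_rel] by blast+
  ultimately have "(\<Union>p'\<in>cclass G p. \<Union>q'\<in>cclass G q. cclass G (pcomp p' q')) = cclass G (pcomp p q)"
    by (simp only: UN_constant if_False)
  then show ?thesis by (simp add: Comm_def)
qed

lemma (in group) id_partial_auts: "(carrier G, \<lambda>x\<in>carrier G. x) \<in> partial_auts G"
  by (auto simp: partial_auts_iff fin_index_carrier hom_def inj_on_def)

lemma (in group) pcomp_id:
  assumes "p \<in> partial_auts G"
  shows "pcomp (carrier G, \<lambda>x\<in>carrier G. x) p = p" "pcomp p (carrier G, \<lambda>x\<in>carrier G. x) = p"
proof -
  obtain H f where p: "p = (H, f)" by force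
  have f: "f \<in> extensional H" "\<And>x. x \<in> H \<Longrightarrow> x \<in> carrier G" "\<And>x. x \<in> H \<Longrightarrow> f x \<in> carrier G"
    using assms subgroup.subset[of H G] by (auto simp: p partial_auts_iff hom_def fin_index_subgroup_def)
  then have *: "{x \<in> H. f x \<in> carrier G} = H" "{x \<in> carrier G. restrict (\<lambda>x. x) (carrier G) x \<in> H} = H"
    by auto
  show "pcomp (carrier G, \<lambda>x\<in>carrier G. x) p = p" "pcomp p (carrier G, \<lambda>x\<in>carrier G. x) = p"
    unfolding p pcomp_Pair * using f by (auto simp: fun_eq_iff extensional_def)
qed

text \<open>The only elements of a commensurator that are inverted below are the flips, which are
  involutions; associativity and the unit are what the calculations rest on.\<close>

lemma (in group) Comm_monoid: "monoid (Comm G)"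
proof (rule monoidI)
  have one: "\<one>\<^bsub>Comm G\<^esub> = cclass G (carrier G, \<lambda>x\<in>carrier G. x)" by (simp add: Comm_def)
  show "\<one>\<^bsub>Comm G\<^esub> \<in> carrier (Comm G)"
    unfolding one by (rule cclass_in_Comm[OF id_partial_auts])
  fix x assume "x \<in> carrier (Comm G)"
  then obtain p where p: "p \<in> partial_auts G" "x = cclass G p"
    by (auto simp: carrier_Comm quotient_def)
  show "\<one>\<^bsub>Comm G\<^esub> \<otimes>\<^bsub>Comm G\<^esub> x = x" "x \<otimes>\<^bsub>Comm G\<^esub> \<one>\<^bsub>Comm G\<^esub> = x"
    unfolding one p(2) using p(1) by (simp_all add: Comm_mult_class id_partial_auts pcomp_id)
  fix y assume "y \<in> carrier (Comm G)"
  then obtain q where q: "q \<in> partial_auts G" "y = cclass G q"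
    by (auto simp: carrier_Comm quotient_def)
  show "x \<otimes>\<^bsub>Comm G\<^esub> y \<in> carrier (Comm G)"
    unfolding p(2) q(2) using p(1) q(1) by (simp add: Comm_mult_class pcomp_closed cclass_in_Comm)
  fix z assume "z \<in> carrier (Comm G)"
  then obtain r where r: "r \<in> partial_auts G" "z = cclass G r"
    by (auto simp: carrier_Comm quotient_def)
  show "x \<otimes>\<^bsub>Comm G\<^esub> y \<otimes>\<^bsub>Comm G\<^esub> z = x \<otimes>\<^bsub>Comm G\<^esub> (y \<otimes>\<^bsub>Comm G\<^esub> z)"
    unfolding p(2) q(2) r(2) using p(1) q(1) r(1) by (simp add: Comm_mult_class pcomp_closed pcomp_assoc)
qed

section \<open>The base group and the lamplighter group\<close>

lemma carrier_lampK: "x \<in> carrier lampK \<longleftrightarrow> (\<forall>i. x i = 0 \<or> x i = 1) \<and> finite {i. x i \<noteq> 0}"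
proof -
  have "(y \<ge> 0 \<and> y < 2) \<longleftrightarrow> y = 0 \<or> y = 1" for y :: int by auto
  then show ?thesis
    by (simp add: lampK_def carrier_sum_group carrier_integer_mod_group PiE_iff)
qed

lemma mult_lampK: "x \<otimes>\<^bsub>lampK\<^esub> y = (\<lambda>i. (x i + y i) mod 2)"
  by (simp add: lampK_def restrict_UNIV)

lemma one_lampK: "\<one>\<^bsub>lampK\<^esub> = (\<lambda>i. 0)"
  by (simp add: lampK_def restrict_UNIV)

lemma group_lampK: "group lampK"
  by (simp add: lampK_def)

interpretation K: comm_group lampK
  by (rule group.group_comm_groupI[OF group_lampK]) (simp add: mult_lampK add.commute)

lemma lampK_square: "x \<in> carrier lampK \<Longrightarrow> x \<otimes>\<^bsub>lampK\<^esub> x = \<one>\<^bsub>lampK\<^esub>"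
  by (auto simp: carrier_lampK mult_lampK one_lampK fun_eq_iff)

lemma inv_lampK: "x \<in> carrier lampK \<Longrightarrow> inv\<^bsub>lampK\<^esub> x = x"
  by (simp add: K.inv_equality lampK_square)

lemma shiftK_closed [simp]: "x \<in> carrier lampK \<Longrightarrow> shiftK n x \<in> carrier lampK"
proof -
  assume "x \<in> carrier lampK"
  moreover have "{i. x (i - n) \<noteq> 0} \<subseteq> (\<lambda>i. i + n) ` {i. x i \<noteq> 0}"
    by (auto intro!: image_eqI[of _ _ "_ - n"])
  ultimately show ?thesis by (auto simp: carrier_lampK shiftK_def intro: finite_subset)
qed

lemma shiftK_mult: "shiftK n (x \<otimes>\<^bsub>lampK\<^esub> y) = shiftK n x \<otimes>\<^bsub>lampK\<^esub> shiftK n y"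
  by (simp add: shiftK_def mult_lampK)

lemma shiftK_shiftK [simp]: "shiftK n (shiftK m x) = shiftK (n + m) x"
  by (simp add: shiftK_def algebra_simps)

lemma shiftK_0 [simp]: "shiftK 0 x = x"
  by (simp add: shiftK_def)

lemma shiftK_one [simp]: "shiftK n \<one>\<^bsub>lampK\<^esub> = \<one>\<^bsub>lampK\<^esub>"
  by (simp add: shiftK_def one_lampK)

lemma flipK_closed [simp]: "x \<in> carrier lampK \<Longrightarrow> flipK x \<in> carrier lampK"
proof -
  assume "x \<in> carrier lampK"
  moreover have "{i. x (- i) \<noteq> 0} \<subseteq> uminus ` {i. x i \<noteq> 0}"
    by (auto intro!: image_eqI[of _ _ "- _"])
  ultimately show ?thesis by (auto simp: carrier_lampK flipK_def intro: finite_subset)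
qed

lemma flipK_mult: "flipK (x \<otimes>\<^bsub>lampK\<^esub> y) = flipK x \<otimes>\<^bsub>lampK\<^esub> flipK y"
  by (simp add: flipK_def mult_lampK)

lemma flipK_flipK [simp]: "flipK (flipK x) = x"
  by (simp add: flipK_def)

lemma flipK_shiftK: "flipK (shiftK n x) = shiftK (- n) (flipK x)"
  by (simp add: flipK_def shiftK_def algebra_simps)

lemma carrier_lamplighter: "carrier lamplighter = carrier lampK \<times> UNIV"
  by (simp add: lamplighter_def semidirect_def)

lemma mult_lamplighter:
  "(x, n) \<otimes>\<^bsub>lamplighter\<^esub> (y, m) = (x \<otimes>\<^bsub>lampK\<^esub> shiftK n y, n + m)"
  by (simp add: lamplighter_def semidirect_def)

lemma one_lamplighter: "\<one>\<^bsub>lamplighter\<^esub> = (\<one>\<^bsub>lampK\<^esub>, 0)"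
  by (simp add: lamplighter_def semidirect_def)

lemma inv_lamplighter_aux:
  "x \<in> carrier lampK \<Longrightarrow> (shiftK (- n) x, - n) \<otimes>\<^bsub>lamplighter\<^esub> (x, n) = \<one>\<^bsub>lamplighter\<^esub>"
  by (simp add: mult_lamplighter one_lamplighter lampK_square)

interpretation L: group lamplighter
proof (rule groupI)
  show "\<exists>y\<in>carrier lamplighter. y \<otimes>\<^bsub>lamplighter\<^esub> x = \<one>\<^bsub>lamplighter\<^esub>"
    if "x \<in> carrier lamplighter" for x
    using that inv_lamplighter_aux[of "fst x" "snd x"]
    by (intro bexI[of _ "(shiftK (- snd x) (fst x), - snd x)"]) (auto simp: carrier_lamplighter)
qed (auto simp: carrier_lamplighter mult_lamplighter one_lamplighter shiftK_mult K.m_assoc)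

lemma inv_lamplighter:
  "x \<in> carrier lampK \<Longrightarrow> inv\<^bsub>lamplighter\<^esub> (x, n) = (shiftK (- n) x, - n)"
  by (intro L.inv_equality inv_lamplighter_aux) (auto simp: carrier_lamplighter)

section \<open>Finite-index subgroups of Z, equivariance, and finite-index subgroups of the
  lamplighter group\<close>

lemma mem_multiples: "n \<in> multiples m \<longleftrightarrow> int m dvd n"
  by (simp add: multiples_def)

lemma multiples_mono: "m dvd k \<Longrightarrow> multiples k \<subseteq> multiples m"
  by (meson int_dvd_int_iff dvd_trans mem_multiples subsetI)

text \<open>By the pigeonhole principle two different powers of \<open>g\<close> lie in one coset,
  and their quotient lies in \<open>H\<close>.\<close>

lemma (in group) fin_index_power:
  assumes H: "fin_index_subgroup H G" and g: "g \<in> carrier G"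
  obtains j :: nat where "j \<ge> 1" "g [^] j \<in> H"
proof -
  interpret H: subgroup H G using H by (rule fin_index_subgroupD)
  have "range (\<lambda>i::nat. H #> (g [^] i)) \<subseteq> rcosets H"
    using g by (auto simp: RCOSETS_def)
  then have "finite (range (\<lambda>i::nat. H #> (g [^] i)))"
    using H finite_subset unfolding fin_index_subgroup_def by blast
  then have "\<not> inj (\<lambda>i::nat. H #> (g [^] i))"
    using range_inj_infinite by blast
  then obtain i j :: nat where "i \<noteq> j" "H #> (g [^] i) = H #> (g [^] j)"
    unfolding inj_def by blast
  then obtain i j :: nat where ij: "i < j" "H #> (g [^] i) = H #> (g [^] j)"
    by (metis nat_neq_iff)
  have "g [^] j \<in> H #> (g [^] i)"
    using ij(2) rcos_self[OF nat_pow_closed[OF g] H.subgroup_axioms] by simp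
  then have "g [^] j \<otimes> inv (g [^] i) \<in> H"
    using H.rcos_module[OF group_axioms] g by simp
  moreover have "g [^] j = g [^] (j - i) \<otimes> g [^] i"
    using ij(1) g by (simp add: nat_pow_mult)
  ultimately have "g [^] (j - i) \<in> H" using g by (simp add: m_assoc)
  then show ?thesis using ij(1) that[of "j - i"] by simp
qed

lemma subgroup_integer_groupI:
  assumes "0 \<in> L" "\<And>a b. a \<in> L \<Longrightarrow> b \<in> L \<Longrightarrow> a + b \<in> L" "\<And>a. a \<in> L \<Longrightarrow> - a \<in> L"
  shows "subgroup L integer_group"
  using assms by (auto intro: subgroup.intro)

lemma fin_index_multiples:
  assumes "m \<ge> 1"
  shows "fin_index_subgroup (multiples m) integer_group"
proof -
  interpret Z: group integer_group by simp
  show ?thesis unfolding Z.fin_index_subgroup_iff_cover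
  proof (intro conjI exI[of _ "{0..<int m}"] ballI)
    show "subgroup (multiples m) integer_group"
      by (rule subgroup_integer_groupI) (auto simp: mem_multiples)
    show "\<exists>s\<in>{0..<int m}. g \<otimes>\<^bsub>integer_group\<^esub> inv\<^bsub>integer_group\<^esub> s \<in> multiples m" for g
      using assms by (intro bexI[of _ "g mod int m"]) (auto simp: mem_multiples)
  qed auto
qed

text \<open>Turns the phrase "on some finite-index subgroup of Z" into "at some level
  \<open>m\<close>", with inclusion of subgroups becoming divisibility of levels.\<close>

lemma fin_index_integer_group:
  assumes L: "fin_index_subgroup L integer_group"
  obtains m where "m \<ge> 1" "L = multiples m"
proof -
  interpret Z: group integer_group by simp
  interpret L: subgroup L integer_group using L by (rule fin_index_subgroupD)
  obtain j :: nat where j: "j \<ge> 1" "1 [^]\<^bsub>integer_group\<^esub> j \<in> L"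
    using Z.fin_index_power[OF L, of 1] by auto
  then have ex: "\<exists>j. j \<ge> 1 \<and> int j \<in> L" by auto
  define m where "m = (LEAST j. j \<ge> 1 \<and> int j \<in> L)"
  have m: "m \<ge> 1" "int m \<in> L" using LeastI_ex[OF ex] by (auto simp: m_def)
  have least: "m \<le> j" if "j \<ge> 1" "int j \<in> L" for j
    unfolding m_def using that by (simp add: Least_le)
  have add: "a + b \<in> L" if "a \<in> L" "b \<in> L" for a b using L.m_closed[OF that] by simp
  have neg: "- a \<in> L" if "a \<in> L" for a using L.m_inv_closed[OF that] by simp
  have natmult: "int m * int k \<in> L" for k
    by (induction k) (use add m L.one_closed in \<open>auto simp: algebra_simps\<close>)
  have mult: "int m * k \<in> L" for k
    using natmult[of "nat k"] neg[OF natmult[of "nat (- k)"]] by (cases "k \<ge> 0") auto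
  have "n \<in> multiples m" if "n \<in> L" for n
  proof -
    have "n + int m * (- (n div int m)) \<in> L" using add[OF that mult] .
    then have "n mod int m \<in> L" by (simp add: minus_mult_div_eq_mod)
    moreover have "0 \<le> n mod int m" "n mod int m < int m" using m by auto
    \<comment> \<open>A nonzero remainder would be a positive element of \<open>L\<close> smaller
      than the least one.\<close>
    ultimately have "n mod int m = 0"
      using least[of "nat (n mod int m)"]
      by (metis One_nat_def Suc_leI int_nat_eq linorder_not_less nat_less_iff zero_less_nat_eq order_le_less)
    then show ?thesis by (auto simp: mem_multiples)
  qed
  moreover have "multiples m \<subseteq> L" using mult by (auto simp: mem_multiples elim!: dvdE)
  ultimately show ?thesis using that m by blast
qed

text \<open>The definition asks for equalities of sets and also for invariance of the image. Both
  follow from the inclusions for the domain, because \<open>- n\<close> is a multiple of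
  \<open>m\<close> along with \<open>n\<close> and the image inherits invariance through
  \<open>f\<close>.\<close>

lemma equivariantI:
  assumes "\<And>n x. n \<in> multiples m \<Longrightarrow> x \<in> H \<Longrightarrow> shiftK n x \<in> H"
    and "\<And>n x. n \<in> multiples m \<Longrightarrow> x \<in> H \<Longrightarrow> f (shiftK n x) = shiftK n (f x)"
  shows "equivariant m (H, f)"
  unfolding equivariant_def
proof (clarify, intro conjI ballI)
  have surj: "A \<subseteq> shiftK n ` A" if n: "n \<in> multiples m"
    and A: "\<And>n x. n \<in> multiples m \<Longrightarrow> x \<in> A \<Longrightarrow> shiftK n x \<in> A" for n A
  proof
    fix x assume "x \<in> A"
    moreover have "- n \<in> multiples m" using n by (simp add: mem_multiples)
    ultimately have "shiftK (- n) x \<in> A" by (rule A[rotated])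
    then show "x \<in> shiftK n ` A" by (rule image_eqI[rotated]) simp
  qed
  fix n assume n: "n \<in> multiples m"
  show "shiftK n ` H = H" using surj[OF n, of H] assms(1) n by blast
  have "shiftK n y \<in> f ` H" if "n \<in> multiples m" "y \<in> f ` H" for n y
    using that assms by (metis (no_types, lifting) image_iff)
  then show "shiftK n ` f ` H = f ` H" using surj[OF n, of "f ` H"] n by blast
  show "f (shiftK n x) = shiftK n (f x)" if "x \<in> H" for x using assms n that by blast
qed

lemma equivariantD:
  assumes "equivariant m (H, f)" "n \<in> multiples m" "x \<in> H"
  shows "shiftK n x \<in> H" "f (shiftK n x) = shiftK n (f x)"
proof -
  have "shiftK n ` H = H \<and> (\<forall>x\<in>H. f (shiftK n x) = shiftK n (f x))"
    using assms(1,2) unfolding equivariant_def by blast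
  then show "shiftK n x \<in> H" "f (shiftK n x) = shiftK n (f x)" using assms(3) by blast+
qed

lemma equivariant_dvd: "equivariant m p \<Longrightarrow> m dvd k \<Longrightarrow> equivariant k p"
  using multiples_mono[of m k] unfolding equivariant_def by (cases p) blast

lemma fin_index_lamplighter:
  assumes A: "fin_index_subgroup A lampK" and m: "m \<ge> 1"
    and inv: "\<And>n x. n \<in> multiples m \<Longrightarrow> x \<in> A \<Longrightarrow> shiftK n x \<in> A"
  shows "fin_index_subgroup (A \<times> multiples m) lamplighter"
proof -
  interpret Z: group integer_group by simp
  interpret A: subgroup A lampK using A by (rule fin_index_subgroupD)
  have sub: "A \<subseteq> carrier lampK" by (rule A.subset)
  obtain S where S: "finite S" "S \<subseteq> carrier lampK"
    "\<And>g. g \<in> carrier lampK \<Longrightarrow> \<exists>s\<in>S. g \<otimes>\<^bsub>lampK\<^esub> inv\<^bsub>lampK\<^esub> s \<in> A"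
    using A unfolding K.fin_index_subgroup_iff_cover by blast
  show ?thesis unfolding L.fin_index_subgroup_iff_cover
  proof (intro conjI exI[of _ "S \<times> {0..<int m}"] ballI)
    show "subgroup (A \<times> multiples m) lamplighter"
    proof (rule subgroup.intro)
      show "A \<times> multiples m \<subseteq> carrier lamplighter" using sub by (auto simp: carrier_lamplighter)
      show "p \<otimes>\<^bsub>lamplighter\<^esub> q \<in> A \<times> multiples m"
        if "p \<in> A \<times> multiples m" "q \<in> A \<times> multiples m" for p q
        using that inv by (auto simp: mult_lamplighter mem_multiples)
      show "inv\<^bsub>lamplighter\<^esub> p \<in> A \<times> multiples m" if "p \<in> A \<times> multiples m" for p
      proof -
        obtain x n where p: "p = (x, n)" "x \<in> A" "n \<in> multiples m" using \<open>p \<in> _\<close> by auto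
        then have "- n \<in> multiples m" by (simp add: mem_multiples)
        then show ?thesis using inv[of "- n" x] p sub by (simp add: inv_lamplighter subset_iff)
      qed
    qed (auto simp: one_lamplighter mem_multiples)
    show "finite (S \<times> {0..<int m})" using S(1) by simp
    show "S \<times> {0..<int m} \<subseteq> carrier lamplighter" using S(2) by (auto simp: carrier_lamplighter)
    fix g assume "g \<in> carrier lamplighter"
    then obtain x n where g: "g = (x, n)" "x \<in> carrier lampK" by (auto simp: carrier_lamplighter)
    define r where "r = n mod int m"
    have r: "r \<in> {0..<int m}" "n - r \<in> multiples m"
      using m by (auto simp: r_def mem_multiples)
    \<comment> \<open>The representative is chosen for the shifted element: the K-part of
      \<open>(x, n)\<close> times the inverse of \<open>(s, r)\<close> is \<open>x\<close> plus
      \<open>shiftK (n - r) s\<close>, and this is the shift by \<open>n - r\<close> of the element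
      covered here. Invariance of \<open>A\<close> under that shift concludes.\<close>
    obtain s where s: "s \<in> S" "shiftK (r - n) x \<otimes>\<^bsub>lampK\<^esub> inv\<^bsub>lampK\<^esub> s \<in> A"
      using S(3)[OF shiftK_closed[OF g(2)]] by blast
    have sc: "s \<in> carrier lampK" using s(1) S(2) by blast
    have "shiftK (n - r) (shiftK (r - n) x \<otimes>\<^bsub>lampK\<^esub> s) \<in> A"
      using inv[OF r(2)] s(2) inv_lampK[OF sc] by simp
    then have "x \<otimes>\<^bsub>lampK\<^esub> shiftK (n - r) s \<in> A" by (simp add: shiftK_mult)
    then have "g \<otimes>\<^bsub>lamplighter\<^esub> inv\<^bsub>lamplighter\<^esub> (s, r) \<in> A \<times> multiples m"
      using r(2) sc by (simp add: g(1) inv_lamplighter mult_lamplighter)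
    then show "\<exists>s\<in>S \<times> {0..<int m}. g \<otimes>\<^bsub>lamplighter\<^esub> inv\<^bsub>lamplighter\<^esub> s \<in> A \<times> multiples m"
      by (rule bexI) (use s(1) r(1) in simp)
  qed
qed

lemma fin_index_lamplighter_base:
  assumes "fin_index_subgroup L lamplighter"
  shows "fin_index_subgroup {x \<in> carrier lampK. (x, 0) \<in> L} lampK"
proof -
  interpret h: group_hom lampK lamplighter "\<lambda>x. (x, 0)"
    by unfold_locales (auto simp: hom_def carrier_lamplighter mult_lamplighter)
  show ?thesis by (rule h.fin_index_vimage[OF assms])
qed

lemma fin_index_lamplighter_top:
  assumes "fin_index_subgroup L lamplighter"
  obtains m where "m \<ge> 1" "{n. (\<one>\<^bsub>lampK\<^esub>, n) \<in> L} = multiples m"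
proof -
  interpret h: group_hom integer_group lamplighter "\<lambda>n. (\<one>\<^bsub>lampK\<^esub>, n)"
    by (intro group_hom.intro group_hom_axioms.intro group_integer_group L.group_axioms)
      (auto simp: hom_def carrier_lamplighter mult_lamplighter)
  have "fin_index_subgroup {n. (\<one>\<^bsub>lampK\<^esub>, n) \<in> L} integer_group"
    using h.fin_index_vimage[OF assms] by simp
  then show ?thesis using that by (metis fin_index_integer_group)
qed

section \<open>Supports and the growth of equivariant embeddings\<close>

definition supported :: "int \<Rightarrow> int \<Rightarrow> lamp set"
  where "supported a b = {x \<in> carrier lampK. {i. x i \<noteq> 0} \<subseteq> {a..<b}}"

lemma card_supported: "finite (supported a b)" "card (supported a b) = 2 ^ nat (b - a)"
proof -
  have "bij_betw (\<lambda>x. {i. x i \<noteq> 0}) (supported a b) (Pow {a..<b})"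
  proof (rule bij_betw_byWitness[where f' = "\<lambda>X i. if i \<in> X then 1 else 0"])
    show "(\<lambda>X i. if i \<in> X then 1 else 0) ` Pow {a..<b} \<subseteq> supported a b"
      by (auto simp: supported_def carrier_lampK split: if_splits intro: finite_subset[of _ "{a..<b}"])
  qed (auto simp: supported_def carrier_lampK fun_eq_iff)
  then show "finite (supported a b)" "card (supported a b) = 2 ^ nat (b - a)"
    by (simp_all add: bij_betw_finite bij_betw_same_card[of _ _ "Pow {a..<b}"] card_Pow)
qed

lemma supported_mono: "c \<le> a \<Longrightarrow> b \<le> d \<Longrightarrow> supported a b \<subseteq> supported c d"
  by (auto simp: supported_def)

lemma supported_mult:
  assumes "x \<in> supported a b" "y \<in> supported a b"
  shows "x \<otimes>\<^bsub>lampK\<^esub> y \<in> supported a b"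
proof -
  have "{i. (x \<otimes>\<^bsub>lampK\<^esub> y) i \<noteq> 0} \<subseteq> {i. x i \<noteq> 0} \<union> {i. y i \<noteq> 0}"
    by (auto simp: mult_lampK)
  then show ?thesis using assms by (auto simp: supported_def)
qed

lemma supported_shiftK:
  assumes "x \<in> supported a b"
  shows "shiftK n x \<in> supported (a + n) (b + n)"
proof -
  have "a + n \<le> i \<and> i < b + n" if "x (i - n) \<noteq> 0" for i
  proof -
    have "i - n \<in> {a..<b}" using that assms by (auto simp: supported_def)
    then show ?thesis by auto
  qed
  moreover have "x \<in> carrier lampK" using assms by (simp add: supported_def)
  ultimately show ?thesis by (auto simp: supported_def) (auto simp: shiftK_def)
qed

text \<open>An element supported in \<open>[0, mN)\<close> consists of \<open>N\<close> blocks of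
  length \<open>m\<close>. Its image is a sum of images of elements of the first window, translated
  by 0, n, ..., (N - 1)n, so it stays in a window of length 2|C| + N|n|. Injectivity gives mN \<le>
  2|C| + N|n| for every \<open>N\<close>, hence m \<le> |n|.\<close>

lemma equivariant_embedding_growth:
  assumes g: "g \<in> hom lampK lampK" and inj: "inj_on g (carrier lampK)"
    and eq: "\<And>x. x \<in> carrier lampK \<Longrightarrow> g (shiftK (int m) x) = shiftK n (g x)"
  shows "int m \<le> \<bar>n\<bar>"
proof -
  have gc: "g x \<in> carrier lampK" if "x \<in> carrier lampK" for x using g that by (auto simp: hom_def)
  have gm: "g (x \<otimes>\<^bsub>lampK\<^esub> y) = g x \<otimes>\<^bsub>lampK\<^esub> g y" if "x \<in> carrier lampK" "y \<in> carrier lampK" for x y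
    using g that by (auto simp: hom_def)
  define U where "U = (\<Union>x\<in>supported 0 (int m). {i. g x i \<noteq> 0})"
  have "finite U"
    using gc card_supported by (auto simp: U_def supported_def carrier_lampK)
  then obtain C where C: "abs ` U \<subseteq> {..<C}" by (auto simp: finite_int_iff_bounded)
  \<comment> \<open>If \<open>U\<close> is empty the bound \<open>C\<close> may be negative, hence
    the absolute value.\<close>
  have base: "g x \<in> supported (- \<bar>C\<bar>) \<bar>C\<bar>" if "x \<in> supported 0 (int m)" for x
    using that C gc by (force simp: U_def supported_def)
  \<comment> \<open>With \<open>a\<close> and \<open>b\<close> the window grows to the left for
    negative \<open>n\<close> and to the right for positive \<open>n\<close>, so both signs are
    treated together.\<close>
  define a where "a = min n 0"
  define b where "b = max n 0"
  have step: "g x \<in> supported (- \<bar>C\<bar> + int N * a) (\<bar>C\<bar> + int N * b)"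
    if "x \<in> supported 0 (int m * int N)" for x N
    using that
  proof (induction N arbitrary: x)
    case 0
    then have "x = \<one>\<^bsub>lampK\<^esub>" by (auto simp: supported_def one_lampK)
    then show ?case using hom_one[OF g K.is_group K.is_group]
      by (simp add: supported_def) (simp add: one_lampK)
  next
    case (Suc N)
    \<comment> \<open>The lowest block \<open>y\<close> is split off and the rest is moved back to
      the origin: x = y + t^m z, where \<open>z\<close> has one block less.\<close>
    define y where "y = (\<lambda>i. if i < int m then x i else 0)"
    define z where "z = (\<lambda>i. if 0 \<le> i then x (i + int m) else 0)"
    have x: "\<forall>i. x i = 0 \<or> x i = 1" "finite {i. x i \<noteq> 0}" "\<And>i. x i \<noteq> 0 \<Longrightarrow> 0 \<le> i \<and> i < int m * int (Suc N)"
      using Suc.prems by (auto simp: supported_def carrier_lampK)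
    have y: "y \<in> supported 0 (int m)"
      using x by (auto simp: supported_def carrier_lampK y_def intro: finite_subset[OF _ x(2)])
    have "{i. z i \<noteq> 0} \<subseteq> (\<lambda>i. i - int m) ` {i. x i \<noteq> 0}"
      by (auto simp: z_def intro!: image_eqI[of _ _ "_ + int m"])
    then have "finite {i. z i \<noteq> 0}" using x(2) finite_surj by blast
    moreover have "i \<in> {0..<int m * int N}" if "z i \<noteq> 0" for i
      using x(3)[of "i + int m"] that by (auto simp: z_def algebra_simps split: if_splits)
    ultimately have z: "z \<in> supported 0 (int m * int N)"
    proof -
      assume fin: "finite {i. z i \<noteq> 0}" and sub: "\<And>i. z i \<noteq> 0 \<Longrightarrow> i \<in> {0..<int m * int N}"
      have "\<forall>i. z i = 0 \<or> z i = 1" using x(1) by (simp add: z_def)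
      then show ?thesis using fin sub unfolding supported_def carrier_lampK by blast
    qed
    have "x i = (y \<otimes>\<^bsub>lampK\<^esub> shiftK (int m) z) i" for i
      using x(1)[rule_format, of i] x(3)[of i] by (auto simp: mult_lampK shiftK_def y_def z_def)
    then have xyz: "x = y \<otimes>\<^bsub>lampK\<^esub> shiftK (int m) z" by blast
    have yz: "y \<in> carrier lampK" "z \<in> carrier lampK" using y z by (auto simp: supported_def)
    have ab: "a \<le> 0" "a \<le> n" "0 \<le> b" "n \<le> b" by (auto simp: a_def b_def)
    have "int N * a \<le> 0" "0 \<le> int N * b" using ab by (auto simp: mult_nonneg_nonpos)
    then have "g y \<in> supported (- \<bar>C\<bar> + int (Suc N) * a) (\<bar>C\<bar> + int (Suc N) * b)"
      using base[OF y] ab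
      by (intro subsetD[OF supported_mono base[OF y]]) (simp_all add: algebra_simps)
    moreover have "shiftK n (g z) \<in> supported (- \<bar>C\<bar> + int (Suc N) * a) (\<bar>C\<bar> + int (Suc N) * b)"
      using ab
      by (intro subsetD[OF supported_mono supported_shiftK[OF Suc.IH[OF z]]]) (simp_all add: algebra_simps)
    moreover have "g x = g y \<otimes>\<^bsub>lampK\<^esub> shiftK n (g z)"
      using yz by (simp add: xyz gm eq)
    ultimately show ?case by (simp only: supported_mult)
  qed
  have bound: "int m * int N \<le> 2 * \<bar>C\<bar> + int N * \<bar>n\<bar>" for N
  proof -
    have "card (supported 0 (int m * int N)) \<le> card (supported (- \<bar>C\<bar> + int N * a) (\<bar>C\<bar> + int N * b))"
      using step by (intro card_inj_on_le[of g] inj_on_subset[OF inj] card_supported)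
        (auto simp: supported_def)
    then have "nat (int m * int N) \<le> nat (2 * \<bar>C\<bar> + int N * (b - a))"
      by (simp add: card_supported algebra_simps)
    moreover have "b - a = \<bar>n\<bar>" by (auto simp: a_def b_def)
    ultimately show ?thesis by (simp add: nat_le_iff)
  qed
  show ?thesis
  proof (rule ccontr)
    assume "\<not> int m \<le> \<bar>n\<bar>"
    then have "1 \<le> int m - \<bar>n\<bar>" by simp
    \<comment> \<open>If m exceeded |n|, each block would gain at least one place, so 2|C| + 1
      blocks overrun the constant.\<close>
    define N where "N = nat (2 * \<bar>C\<bar> + 1)"
    have "int N * 1 \<le> int N * (int m - \<bar>n\<bar>)"
      using \<open>1 \<le> _\<close> by (intro mult_left_mono) auto
    then show False using bound[of N] by (simp add: N_def algebra_simps)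
  qed
qed

text \<open>A nonempty finite support has a rightmost point, which a positive period would push
  further right.\<close>

lemma shiftK_fixed:
  assumes x: "x \<in> carrier lampK" and d: "d > 0" and eq: "shiftK d x = x"
  shows "x = \<one>\<^bsub>lampK\<^esub>"
proof (rule ccontr)
  assume "x \<noteq> \<one>\<^bsub>lampK\<^esub>"
  then have ne: "{i. x i \<noteq> 0} \<noteq> {}" by (auto simp: one_lampK)
  have fin: "finite {i. x i \<noteq> 0}" using x by (simp add: carrier_lampK)
  define M where "M = Max {i. x i \<noteq> 0}"
  have "x M \<noteq> 0" using Max_in[OF fin ne] by (simp add: M_def)
  moreover have "x (M + d) = x M" using fun_cong[OF eq, of "M + d"] by (simp add: shiftK_def)
  ultimately have "M + d \<le> M" unfolding M_def using fin by (intro Max_ge) auto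
  then show False using d by simp
qed

text \<open>The powers of t^m permute the finitely many cosets of \<open>H\<close>, so two of them,
  with exponents i < j, induce the same permutation; \<open>d\<close> is m(j - i). In exponent two,
  "x and t^d x are congruent modulo \<open>H\<close>" reads x + t^d x \<in> H.\<close>

lemma shift_acts_trivially_on_quotient:
  assumes H: "fin_index_subgroup H lampK" and m: "m \<ge> 1"
    and inv: "\<And>n x. n \<in> multiples m \<Longrightarrow> x \<in> H \<Longrightarrow> shiftK n x \<in> H"
  obtains d where "d > 0" "\<And>x. x \<in> carrier lampK \<Longrightarrow> x \<otimes>\<^bsub>lampK\<^esub> shiftK d x \<in> H"
proof -
  interpret H: subgroup H lampK using H by (rule fin_index_subgroupD)
  let ?s = "\<lambda>k::nat. shiftK (int m * int k)"
  have mult: "int m * k \<in> multiples m" for k by (simp add: mem_multiples)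
  have coset: "?s k ` (H #>\<^bsub>lampK\<^esub> x) = H #>\<^bsub>lampK\<^esub> ?s k x" for k x
  proof
    show "?s k ` (H #>\<^bsub>lampK\<^esub> x) \<subseteq> H #>\<^bsub>lampK\<^esub> ?s k x"
      using inv[OF mult] by (fastforce simp: r_coset_def shiftK_mult)
    show "H #>\<^bsub>lampK\<^esub> ?s k x \<subseteq> ?s k ` (H #>\<^bsub>lampK\<^esub> x)"
    proof
      fix y assume "y \<in> H #>\<^bsub>lampK\<^esub> ?s k x"
      then obtain h where h: "h \<in> H" "y = h \<otimes>\<^bsub>lampK\<^esub> ?s k x" by (auto simp: r_coset_def)
      have "shiftK (int m * - int k) h \<in> H" using inv[OF mult h(1)] .
      moreover have "y = ?s k (shiftK (int m * - int k) h \<otimes>\<^bsub>lampK\<^esub> x)"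
        using h(2) by (simp add: shiftK_mult)
      ultimately show "y \<in> ?s k ` (H #>\<^bsub>lampK\<^esub> x)" by (auto simp: r_coset_def)
    qed
  qed
  let ?R = "rcosets\<^bsub>lampK\<^esub> H"
  let ?P = "\<lambda>k. \<lambda>C\<in>?R. ?s k ` C"
  \<comment> \<open>Restricting to the set of cosets places all these maps in one finite function
    space, as the pigeonhole argument requires.\<close>
  have "range ?P \<subseteq> ?R \<rightarrow>\<^sub>E ?R"
  proof (clarify, rule PiE_I)
    fix k C assume "C \<in> ?R"
    then obtain x where x: "x \<in> carrier lampK" "C = H #>\<^bsub>lampK\<^esub> x" by (auto simp: RCOSETS_def)
    then have "?s k ` C = H #>\<^bsub>lampK\<^esub> ?s k x" by (simp only: coset)
    then show "?P k C \<in> ?R" using \<open>C \<in> ?R\<close> shiftK_closed[OF x(1)] by (auto simp: RCOSETS_def)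
  qed auto
  moreover have "finite (?R \<rightarrow>\<^sub>E ?R)"
    using H by (intro finite_PiE) (auto simp: fin_index_subgroup_def)
  ultimately have "\<not> inj ?P" using finite_subset range_inj_infinite by blast
  then obtain i j where "i \<noteq> j" "?P i = ?P j" unfolding inj_def by blast
  then obtain i j where ij: "i < j" "?P i = ?P j" by (metis nat_neq_iff)
  let ?d = "int m * int (j - i)"
  show ?thesis
  proof (rule that[of ?d])
    show "?d > 0" using m ij(1) by simp
    fix x assume x: "x \<in> carrier lampK"
    have "H #>\<^bsub>lampK\<^esub> x \<in> ?R" using x by (auto simp: RCOSETS_def)
    then have "?s i ` (H #>\<^bsub>lampK\<^esub> x) = ?s j ` (H #>\<^bsub>lampK\<^esub> x)"
      using fun_cong[OF ij(2), of "H #>\<^bsub>lampK\<^esub> x"] by simp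
    then have "H #>\<^bsub>lampK\<^esub> ?s i x = H #>\<^bsub>lampK\<^esub> ?s j x" by (simp add: coset)
    then have "?s i x \<in> H #>\<^bsub>lampK\<^esub> ?s j x"
      using K.rcos_self[OF shiftK_closed[OF x] H.subgroup_axioms] by metis
    then have "?s i x \<otimes>\<^bsub>lampK\<^esub> ?s j x \<in> H"
      using H.rcos_module[OF K.is_group] x by (simp add: inv_lampK)
    \<comment> \<open>Shifting back by \<open>m * i\<close> turns the difference of two translates
      into \<open>x\<close> plus its translate by \<open>d\<close>.\<close>
    then have "shiftK (int m * - int i) (?s i x \<otimes>\<^bsub>lampK\<^esub> ?s j x) \<in> H"
      by (rule inv[OF mult])
    then show "x \<otimes>\<^bsub>lampK\<^esub> shiftK ?d x \<in> H"
      using ij(1) by (simp add: shiftK_mult of_nat_diff algebra_simps)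
  qed
qed

lemma virtual_embedding_growth:
  assumes H: "fin_index_subgroup H lampK" and m: "m \<ge> 1"
    and inv: "\<And>n x. n \<in> multiples m \<Longrightarrow> x \<in> H \<Longrightarrow> shiftK n x \<in> H"
    and f: "f \<in> hom (lampK\<lparr>carrier := H\<rparr>) lampK" "inj_on f H"
    and eq: "\<And>x. x \<in> H \<Longrightarrow> f (shiftK (int m) x) = shiftK n (f x)"
  shows "int m \<le> \<bar>n\<bar>"
proof -
  obtain d where d: "d > 0" and dH: "\<And>x. x \<in> carrier lampK \<Longrightarrow> x \<otimes>\<^bsub>lampK\<^esub> shiftK d x \<in> H"
    using shift_acts_trivially_on_quotient[OF H m inv] by metis
  \<comment> \<open>Precomposition with \<open>1 + t\<^sup>d\<close>, which is injective and maps \<open>K\<close> into \<open>H\<close>, turns the virtual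
    embedding \<open>f\<close> into an embedding of all of \<open>K\<close>.\<close>
  let ?u = "\<lambda>x. x \<otimes>\<^bsub>lampK\<^esub> shiftK d x"
  have u: "?u (x \<otimes>\<^bsub>lampK\<^esub> y) = ?u x \<otimes>\<^bsub>lampK\<^esub> ?u y" if "x \<in> carrier lampK" "y \<in> carrier lampK" for x y
    using that by (simp add: shiftK_mult K.m_ac)
  have fm: "f (x \<otimes>\<^bsub>lampK\<^esub> y) = f x \<otimes>\<^bsub>lampK\<^esub> f y" if "x \<in> H" "y \<in> H" for x y
    using f that by (auto simp: hom_def)
  have fc: "f x \<in> carrier lampK" if "x \<in> H" for x using f that by (auto simp: hom_def)
  have uhom: "?u \<in> hom lampK lampK" using u by (auto simp: hom_def)
  have "inj_on ?u (carrier lampK)"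
  proof -
    interpret u: group_hom lampK lampK ?u
      by (intro group_hom.intro group_hom_axioms.intro K.is_group uhom)
    have "x = \<one>\<^bsub>lampK\<^esub>" if "x \<in> carrier lampK" "?u x = \<one>\<^bsub>lampK\<^esub>" for x
    proof -
      \<comment> \<open>Elements are their own inverses, so the kernel of 1 + t^d consists of the
        elements fixed by t^d.\<close>
      have "shiftK d x = inv\<^bsub>lampK\<^esub> x"
        using that K.inv_equality[of "shiftK d x" x] by (simp add: K.m_comm)
      then show ?thesis using shiftK_fixed[OF that(1) d] that(1) by (simp add: inv_lampK)
    qed
    then show ?thesis unfolding u.inj_on_one_iff by blast
  qed
  then have inj: "inj_on (\<lambda>x. f (?u x)) (carrier lampK)"
    using f(2) dH by (auto simp: inj_on_def)
  show ?thesis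
  proof (rule equivariant_embedding_growth[OF _ inj])
    show "(\<lambda>x. f (?u x)) \<in> hom lampK lampK"
      using u fm fc dH by (auto simp: hom_def)
    fix x assume x: "x \<in> carrier lampK"
    have "?u (shiftK (int m) x) = shiftK (int m) (?u x)"
      by (simp add: shiftK_mult add.commute)
    then show "f (?u (shiftK (int m) x)) = shiftK n (f (?u x))"
      using eq[OF dH[OF x]] by simp
  qed
qed

section \<open>Virtual derivations of the integers\<close>

abbreviation derivs :: "int set \<Rightarrow> (int \<Rightarrow> lamp) set"
  where "derivs L \<equiv> carrier (Der (integer_group\<lparr>carrier := L\<rparr>) lampK shiftK)"

abbreviation vclass :: "nat \<Rightarrow> (int \<Rightarrow> lamp) \<Rightarrow> lamp_vder"
  where "vclass m \<tau> \<equiv> VDer_rel integer_group lampK shiftK `` {(multiples m, \<tau>)}"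

lemma derivs_iff:
  "\<tau> \<in> derivs L \<longleftrightarrow> \<tau> \<in> L \<rightarrow>\<^sub>E carrier lampK \<and>
    (\<forall>a\<in>L. \<forall>b\<in>L. \<tau> (a + b) = \<tau> a \<otimes>\<^bsub>lampK\<^esub> shiftK a (\<tau> b))"
  by (simp add: Der_def)

lemma derivs_closed: "\<tau> \<in> derivs L \<Longrightarrow> n \<in> L \<Longrightarrow> \<tau> n \<in> carrier lampK"
  by (auto simp: derivs_iff)

lemma subgroup_add_closed:
  "fin_index_subgroup L integer_group \<Longrightarrow> a \<in> L \<Longrightarrow> b \<in> L \<Longrightarrow> a + b \<in> L"
  using subgroup.m_closed[OF fin_index_subgroupD] by fastforce

lemma derivs_restrict:
  assumes "\<tau> \<in> derivs M" "fin_index_subgroup L integer_group" "L \<subseteq> M"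
  shows "restrict \<tau> L \<in> derivs L"
  using assms subgroup_add_closed[OF assms(2)] by (auto simp: derivs_iff subset_iff)

lemma derivs_mult:
  assumes \<tau>: "\<tau> \<in> derivs L" and \<tau>': "\<tau>' \<in> derivs L" and L: "fin_index_subgroup L integer_group"
  shows "(\<lambda>n\<in>L. \<tau> n \<otimes>\<^bsub>lampK\<^esub> \<tau>' n) \<in> derivs L"
  unfolding derivs_iff
proof (intro conjI ballI)
  show "(\<lambda>n\<in>L. \<tau> n \<otimes>\<^bsub>lampK\<^esub> \<tau>' n) \<in> L \<rightarrow>\<^sub>E carrier lampK"
    using derivs_closed[OF \<tau>] derivs_closed[OF \<tau>'] by auto
  fix a b assume ab: "a \<in> L" "b \<in> L"
  have "\<tau> (a + b) \<otimes>\<^bsub>lampK\<^esub> \<tau>' (a + b) =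
      (\<tau> a \<otimes>\<^bsub>lampK\<^esub> shiftK a (\<tau> b)) \<otimes>\<^bsub>lampK\<^esub> (\<tau>' a \<otimes>\<^bsub>lampK\<^esub> shiftK a (\<tau>' b))"
    using \<tau> \<tau>' ab by (simp add: derivs_iff)
  also have "\<dots> = (\<tau> a \<otimes>\<^bsub>lampK\<^esub> \<tau>' a) \<otimes>\<^bsub>lampK\<^esub> shiftK a (\<tau> b \<otimes>\<^bsub>lampK\<^esub> \<tau>' b)"
    using derivs_closed[OF \<tau>] derivs_closed[OF \<tau>'] ab by (simp add: shiftK_mult K.m_ac)
  finally show "(\<lambda>n\<in>L. \<tau> n \<otimes>\<^bsub>lampK\<^esub> \<tau>' n) (a + b) =
      (\<lambda>n\<in>L. \<tau> n \<otimes>\<^bsub>lampK\<^esub> \<tau>' n) a \<otimes>\<^bsub>lampK\<^esub> shiftK a ((\<lambda>n\<in>L. \<tau> n \<otimes>\<^bsub>lampK\<^esub> \<tau>' n) b)"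
    using ab subgroup_add_closed[OF L ab] by simp
qed

lemma VDer_rel_iff:
  "((M, \<tau>), (N, \<upsilon>)) \<in> VDer_rel integer_group lampK shiftK \<longleftrightarrow>
    fin_index_subgroup M integer_group \<and> fin_index_subgroup N integer_group \<and>
    \<tau> \<in> derivs M \<and> \<upsilon> \<in> derivs N \<and>
    (\<exists>L. fin_index_subgroup L integer_group \<and> L \<subseteq> M \<and> L \<subseteq> N \<and> (\<forall>n\<in>L. \<tau> n = \<upsilon> n))"
proof -
  have "restrict \<tau> L = restrict \<upsilon> L \<longleftrightarrow> (\<forall>n\<in>L. \<tau> n = \<upsilon> n)" for L
    by (metis restrict_apply' restrict_ext)
  then show ?thesis by (auto simp: VDer_rel_def dirlim_rel_def)
qed

lemma equiv_VDer_rel: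
  "equiv (SIGMA M:{M. fin_index_subgroup M integer_group}. derivs M)
    (VDer_rel integer_group lampK shiftK)" (is "equiv ?A ?R")
proof (rule equivI)
  interpret Z: group integer_group by simp
  show "refl_on ?A ?R" by (rule refl_onI) (auto simp: VDer_rel_iff)
  show "sym ?R"
  proof (rule symI)
    fix p q assume "(p, q) \<in> ?R"
    then show "(q, p) \<in> ?R" by (cases p; cases q) (simp only: VDer_rel_iff, metis)
  qed
  show "trans ?R"
  proof (rule transI)
    fix p q r assume pq: "(p, q) \<in> ?R" and qr: "(q, r) \<in> ?R"
    obtain M \<tau> N \<upsilon> M' \<tau>' where e: "p = (M, \<tau>)" "q = (N, \<upsilon>)" "r = (M', \<tau>')" by (metis surj_pair)
    obtain L L' where "fin_index_subgroup L integer_group" "L \<subseteq> M" "\<And>n. n \<in> L \<Longrightarrow> \<tau> n = \<upsilon> n"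
      "fin_index_subgroup L' integer_group" "L' \<subseteq> M'" "\<And>n. n \<in> L' \<Longrightarrow> \<upsilon> n = \<tau>' n"
      using pq qr unfolding e VDer_rel_iff by metis
    then have "\<exists>L. fin_index_subgroup L integer_group \<and> L \<subseteq> M \<and> L \<subseteq> M' \<and> (\<forall>n\<in>L. \<tau> n = \<tau>' n)"
      by (intro exI[of _ "L \<inter> L'"]) (auto intro: Z.fin_index_Int)
    then show "(p, r) \<in> ?R" using pq qr unfolding e VDer_rel_iff by blast
  qed
  show "?R \<subseteq> ?A \<times> ?A" by (auto simp: VDer_rel_iff)
qed

lemma VDer_rel_classI:
  assumes "((M, \<tau>), (N, \<upsilon>)) \<in> VDer_rel integer_group lampK shiftK"
  shows "VDer_rel integer_group lampK shiftK `` {(M, \<tau>)} = VDer_rel integer_group lampK shiftK `` {(N, \<upsilon>)}"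
  using equiv_class_eq[OF equiv_VDer_rel assms] .

lemma multiples_subset_iff: "multiples k \<subseteq> multiples m \<longleftrightarrow> m dvd k"
proof
  assume *: "multiples k \<subseteq> multiples m"
  have "int k \<in> multiples m" by (rule subsetD[OF *]) (simp add: mem_multiples)
  then show "m dvd k" by (simp add: mem_multiples)
qed (rule multiples_mono)

text \<open>The subgroups kZ are all the finite-index subgroups of Z, so equality in the limit is
  agreement at one common multiple of the two levels.\<close>

lemma vclass_eq_iff:
  assumes "m \<ge> 1" "n \<ge> 1" "\<tau> \<in> derivs (multiples m)" "\<upsilon> \<in> derivs (multiples n)"
  shows "vclass m \<tau> = vclass n \<upsilon> \<longleftrightarrow>
    (\<exists>k\<ge>1. m dvd k \<and> n dvd k \<and> (\<forall>i\<in>multiples k. \<tau> i = \<upsilon> i))"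
proof -
  have "vclass m \<tau> = vclass n \<upsilon> \<longleftrightarrow>
      ((multiples m, \<tau>), (multiples n, \<upsilon>)) \<in> VDer_rel integer_group lampK shiftK"
    using assms by (intro eq_equiv_class_iff[OF equiv_VDer_rel]) (auto simp: fin_index_multiples)
  also have "\<dots> \<longleftrightarrow> (\<exists>L. fin_index_subgroup L integer_group \<and> L \<subseteq> multiples m \<and> L \<subseteq> multiples n
      \<and> (\<forall>i\<in>L. \<tau> i = \<upsilon> i))"
    using assms by (simp add: VDer_rel_iff fin_index_multiples)
  also have "\<dots> \<longleftrightarrow> (\<exists>k\<ge>1. m dvd k \<and> n dvd k \<and> (\<forall>i\<in>multiples k. \<tau> i = \<upsilon> i))"
  proof
    assume "\<exists>L. fin_index_subgroup L integer_group \<and> L \<subseteq> multiples m \<and> L \<subseteq> multiples n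
      \<and> (\<forall>i\<in>L. \<tau> i = \<upsilon> i)"
    then obtain L where L: "fin_index_subgroup L integer_group" "L \<subseteq> multiples m" "L \<subseteq> multiples n"
      "\<forall>i\<in>L. \<tau> i = \<upsilon> i" by blast
    obtain k where "k \<ge> 1" "L = multiples k" using fin_index_integer_group[OF L(1)] .
    then show "\<exists>k\<ge>1. m dvd k \<and> n dvd k \<and> (\<forall>i\<in>multiples k. \<tau> i = \<upsilon> i)"
      using L(2-4) by (auto simp: multiples_subset_iff)
  next
    assume "\<exists>k\<ge>1. m dvd k \<and> n dvd k \<and> (\<forall>i\<in>multiples k. \<tau> i = \<upsilon> i)"
    then obtain k where "k \<ge> 1" "m dvd k" "n dvd k" "\<forall>i\<in>multiples k. \<tau> i = \<upsilon> i" by blast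
    then show "\<exists>L. fin_index_subgroup L integer_group \<and> L \<subseteq> multiples m \<and> L \<subseteq> multiples n
      \<and> (\<forall>i\<in>L. \<tau> i = \<upsilon> i)"
      using fin_index_multiples multiples_mono by (intro exI[of _ "multiples k"]) blast
  qed
  finally show ?thesis .
qed

lemma vclass_restrict:
  assumes "m \<ge> 1" "k \<ge> 1" "m dvd k" "\<tau> \<in> derivs (multiples m)"
  shows "vclass k (restrict \<tau> (multiples k)) = vclass m \<tau>"
    "restrict \<tau> (multiples k) \<in> derivs (multiples k)"
proof -
  show *: "restrict \<tau> (multiples k) \<in> derivs (multiples k)"
    using assms by (intro derivs_restrict[of _ "multiples m"] fin_index_multiples multiples_mono)
  show "vclass k (restrict \<tau> (multiples k)) = vclass m \<tau>"
    using assms by (subst vclass_eq_iff[OF _ _ *]) auto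
qed

lemma VDer_carrier_cases:
  assumes "T \<in> carrier (VDer integer_group lampK shiftK)"
  obtains m \<tau> where "m \<ge> 1" "\<tau> \<in> derivs (multiples m)" "T = vclass m \<tau>"
proof -
  have "T \<in> (SIGMA M:{M. fin_index_subgroup M integer_group}. derivs M) // VDer_rel integer_group lampK shiftK"
    using assms by (simp add: VDer_def dirlim_def VDer_rel_def)
  then obtain M \<tau> where "fin_index_subgroup M integer_group" "\<tau> \<in> derivs M"
    "T = VDer_rel integer_group lampK shiftK `` {(M, \<tau>)}"
    by (auto elim!: quotientE)
  then show ?thesis using that fin_index_integer_group by metis
qed

lemma vclass_in_VDer:
  assumes "m \<ge> 1" "\<tau> \<in> derivs (multiples m)"
  shows "vclass m \<tau> \<in> carrier (VDer integer_group lampK shiftK)"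
proof -
  have "(multiples m, \<tau>) \<in> (SIGMA M:{M. fin_index_subgroup M integer_group}. derivs M)"
    using assms fin_index_multiples[of m] by simp
  then show ?thesis
    unfolding VDer_def dirlim_def partial_object.simps VDer_rel_def by (rule quotientI)
qed

text \<open>Operations on classes are defined as unions over all choices of representatives. This
  evaluates such a union once one choice is exhibited and all choices are shown to give the same
  class.\<close>

lemma Union_singleton: "e \<in> S \<Longrightarrow> (\<And>x. x \<in> S \<Longrightarrow> x = e) \<Longrightarrow> \<Union>S = e"
  by (metis Union_upper Union_least order_refl subset_antisym)

text \<open>Stated for one common level, to which \<open>vclass_restrict\<close> brings any two
  virtual derivations.\<close>

lemma vclass_mult:
  assumes m: "m \<ge> 1" and \<tau>: "\<tau> \<in> derivs (multiples m)" and \<tau>': "\<tau>' \<in> derivs (multiples m)"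
  shows "vclass m \<tau> \<otimes>\<^bsub>VDer integer_group lampK shiftK\<^esub> vclass m \<tau>'
    = vclass m (\<lambda>n\<in>multiples m. \<tau> n \<otimes>\<^bsub>lampK\<^esub> \<tau>' n)"
proof -
  interpret Z: group integer_group by simp
  let ?R = "VDer_rel integer_group lampK shiftK"
  let ?S = "{?R `` {(k, restrict x k \<otimes>\<^bsub>Der (integer_group\<lparr>carrier := k\<rparr>) lampK shiftK\<^esub> restrict y k)} | i x j y k.
      (i, x) \<in> vclass m \<tau> \<and> (j, y) \<in> vclass m \<tau>' \<and> k \<in> {H. fin_index_subgroup H integer_group} \<and>
      k \<subseteq> i \<and> k \<subseteq> j}"
  have "vclass m \<tau> \<otimes>\<^bsub>VDer integer_group lampK shiftK\<^esub> vclass m \<tau>' = \<Union>?S"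
    by (simp add: VDer_def dirlim_def VDer_rel_def)
  also have "\<dots> = vclass m (\<lambda>n\<in>multiples m. \<tau> n \<otimes>\<^bsub>lampK\<^esub> \<tau>' n)" (is "_ = ?e")
  proof (rule Union_singleton)
    have M: "fin_index_subgroup (multiples m) integer_group" using m by (rule fin_index_multiples)
    have "(multiples m, \<tau>) \<in> vclass m \<tau>" "(multiples m, \<tau>') \<in> vclass m \<tau>'"
      using M \<tau> \<tau>' by (auto simp: VDer_rel_iff)
    moreover have "restrict \<tau> (multiples m) \<otimes>\<^bsub>Der (integer_group\<lparr>carrier := multiples m\<rparr>) lampK shiftK\<^esub>
        restrict \<tau>' (multiples m) = (\<lambda>n\<in>multiples m. \<tau> n \<otimes>\<^bsub>lampK\<^esub> \<tau>' n)"
      by (auto simp: Der_def)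
    ultimately show "?e \<in> ?S"
      using M by (intro CollectI exI[of _ "multiples m"] exI[of _ \<tau>] exI[of _ \<tau>']) auto
    fix X assume "X \<in> ?S"
    then obtain i x j y k where X: "X = ?R `` {(k, restrict x k
        \<otimes>\<^bsub>Der (integer_group\<lparr>carrier := k\<rparr>) lampK shiftK\<^esub> restrict y k)}"
      "((multiples m, \<tau>), (i, x)) \<in> ?R" "((multiples m, \<tau>'), (j, y)) \<in> ?R"
      and k: "fin_index_subgroup k integer_group" "k \<subseteq> i" "k \<subseteq> j" by auto
    have eq: "restrict x k \<otimes>\<^bsub>Der (integer_group\<lparr>carrier := k\<rparr>) lampK shiftK\<^esub> restrict y k
        = (\<lambda>n\<in>k. restrict x k n \<otimes>\<^bsub>lampK\<^esub> restrict y k n)"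
      by (simp add: Der_def)
    obtain L where L: "fin_index_subgroup L integer_group" "L \<subseteq> multiples m" "\<And>n. n \<in> L \<Longrightarrow> \<tau> n = x n"
      and x: "x \<in> derivs i" using X(2) unfolding VDer_rel_iff by blast
    obtain L' where L': "fin_index_subgroup L' integer_group" "\<And>n. n \<in> L' \<Longrightarrow> \<tau>' n = y n"
      and y: "y \<in> derivs j" using X(3) unfolding VDer_rel_iff by blast
    have "((k, \<lambda>n\<in>k. restrict x k n \<otimes>\<^bsub>lampK\<^esub> restrict y k n),
        (multiples m, \<lambda>n\<in>multiples m. \<tau> n \<otimes>\<^bsub>lampK\<^esub> \<tau>' n)) \<in> ?R"
      unfolding VDer_rel_iff
    proof (intro conjI exI[of _ "k \<inter> (L \<inter> L')"])
      show "fin_index_subgroup (k \<inter> (L \<inter> L')) integer_group"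
        using k(1) L(1) L'(1) by (intro Z.fin_index_Int)
      show "(\<lambda>n\<in>k. restrict x k n \<otimes>\<^bsub>lampK\<^esub> restrict y k n) \<in> derivs k"
        by (intro derivs_mult derivs_restrict[OF x k(1,2)] derivs_restrict[OF y k(1,3)] k(1))
    qed (use k M L L' derivs_mult[OF \<tau> \<tau>' M] in auto)
    then show "X = ?e" unfolding X(1) eq by (rule VDer_rel_classI)
  qed
  finally show ?thesis .
qed

lemma derivation_small:
  assumes H: "fin_index_subgroup H lampK"
    and inv: "\<And>n x. n \<in> multiples k \<Longrightarrow> x \<in> H \<Longrightarrow> shiftK n x \<in> H" and k: "k \<ge> 1"
    and M: "fin_index_subgroup M integer_group" and \<tau>: "\<tau> \<in> derivs M"
  shows "fin_index_subgroup {n \<in> M \<inter> multiples k. \<tau> n \<in> H} integer_group"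
proof -
  interpret Z: group integer_group by simp
  \<comment> \<open>A derivation is a section \<open>n \<mapsto> (\<tau> n, n)\<close> of \<open>\<Gamma> \<rightarrow> \<int>\<close>; the claim pulls back \<open>H \<rtimes> k\<int>\<close> along it.\<close>
  have "(\<lambda>n. (\<tau> n, n)) \<in> hom (integer_group\<lparr>carrier := M\<rparr>) lamplighter"
    using \<tau> by (auto simp: hom_def derivs_iff carrier_lamplighter mult_lamplighter)
  from Z.fin_index_hom_vimage[OF M fin_index_lamplighter[OF H k inv] L.group_axioms this]
  have "fin_index_subgroup {n \<in> M. (\<tau> n, n) \<in> H \<times> multiples k} integer_group" by simp
  moreover have "{n \<in> M. (\<tau> n, n) \<in> H \<times> multiples k} = {n \<in> M \<inter> multiples k. \<tau> n \<in> H}" by auto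
  ultimately show ?thesis by simp
qed

section \<open>Equivariant commensurations\<close>

text \<open>
  The transition maps are inclusions, so a class of the direct limit is the set of all pairs
  \<open>(m, c)\<close> with one fixed commensuration \<open>c\<close>.
\<close>

definition comm_inf_class :: "lamp comm_class \<Rightarrow> lamp_comm_inf"
  where "comm_inf_class c = {(m, c') \<in> {m. 1 \<le> m} \<times> {c}. c' \<in> carrier (CommK_equiv m)}"

abbreviation CommK_mult :: "lamp comm_class \<Rightarrow> lamp comm_class \<Rightarrow> lamp comm_class" (infixl "\<odot>" 70)
  where "c \<odot> d \<equiv> c \<otimes>\<^bsub>Comm lampK\<^esub> d"

interpretation CK: monoid "Comm lampK" by (rule K.Comm_monoid)

lemma mem_comm_inf_class:
  "(m, c') \<in> comm_inf_class c \<longleftrightarrow> 1 \<le> m \<and> c' = c \<and> c \<in> carrier (CommK_equiv m)"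
  by (auto simp: comm_inf_class_def)

lemma carrier_CommK_equiv:
  "c \<in> carrier (CommK_equiv m) \<longleftrightarrow>
    (\<exists>H f. (H, f) \<in> partial_auts lampK \<and> equivariant m (H, f) \<and> c = cclass lampK (H, f))"
proof
  assume "c \<in> carrier (CommK_equiv m)"
  then obtain p where c: "c \<in> partial_auts lampK // comm_rel lampK" "p \<in> c" "equivariant m p"
    by (auto simp: CommK_equiv_def carrier_Comm)
  obtain q where "c = cclass lampK q" using c(1) by (rule quotientE)
  then have "(q, p) \<in> comm_rel lampK" "c = cclass lampK q" using c(2) by blast+
  then have "c = cclass lampK p" "p \<in> partial_auts lampK"
    using equiv_class_eq[OF K.equiv_comm_rel] equiv_type[OF K.equiv_comm_rel] by blast+
  then show "\<exists>H f. (H, f) \<in> partial_auts lampK \<and> equivariant m (H, f) \<and> c = cclass lampK (H, f)"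
    using c(3) by (cases p) auto
next
  assume "\<exists>H f. (H, f) \<in> partial_auts lampK \<and> equivariant m (H, f) \<and> c = cclass lampK (H, f)"
  then show "c \<in> carrier (CommK_equiv m)"
    using equiv_class_self[OF K.equiv_comm_rel]
    by (auto simp: CommK_equiv_def cclass_in_Comm)
qed

lemma CommK_equiv_dvd: "c \<in> carrier (CommK_equiv m) \<Longrightarrow> m dvd k \<Longrightarrow> c \<in> carrier (CommK_equiv k)"
  by (auto simp: carrier_CommK_equiv dest: equivariant_dvd)

lemma equivariant_pcomp:
  assumes "equivariant m p" "equivariant m q"
  shows "equivariant m (pcomp p q)"
proof -
  obtain H f H' f' where e: "p = (H, f)" "q = (H', f')" by (metis surj_pair)
  show ?thesis
    using equivariantD[OF assms(1)[unfolded e]] equivariantD[OF assms(2)[unfolded e]]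
    unfolding e pcomp_Pair by (intro equivariantI) auto
qed

lemma CommK_equiv_mult:
  assumes "c \<in> carrier (CommK_equiv m)" "d \<in> carrier (CommK_equiv m)"
  shows "c \<odot> d \<in> carrier (CommK_equiv m)"
proof -
  obtain p q where "p \<in> partial_auts lampK" "equivariant m p" "c = cclass lampK p"
    "q \<in> partial_auts lampK" "equivariant m q" "d = cclass lampK q"
    using assms unfolding carrier_CommK_equiv by blast
  then show ?thesis
    unfolding carrier_CommK_equiv using K.pcomp_closed equivariant_pcomp K.Comm_mult_class
    by (metis surj_pair)
qed

lemma comm_inf_rel_class:
  assumes "m \<ge> 1" "c \<in> carrier (CommK_equiv m)"
  shows "dirlim_rel {m. 1 \<le> m} (dvd) CommK_equiv (\<lambda>m n c. c) `` {(m, c)} = comm_inf_class c"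
proof -
  have "\<exists>k\<ge>1. m dvd k \<and> n dvd k" if "n \<ge> 1" for n
    using that assms by (intro exI[of _ "m * n"]) auto
  then show ?thesis using assms by (auto simp: dirlim_rel_def comm_inf_class_def)
qed

lemma Comm_inf_cases:
  assumes "B \<in> carrier Comm_inf"
  obtains m c where "m \<ge> 1" "c \<in> carrier (CommK_equiv m)" "B = comm_inf_class c"
proof -
  obtain m c where "m \<ge> 1" "c \<in> carrier (CommK_equiv m)"
    "B = dirlim_rel {m. 1 \<le> m} (dvd) CommK_equiv (\<lambda>m n c. c) `` {(m, c)}"
    using assms by (auto simp: Comm_inf_def dirlim_def elim!: quotientE)
  then show ?thesis using that comm_inf_rel_class by metis
qed

lemma comm_inf_class_in:
  assumes "m \<ge> 1" "c \<in> carrier (CommK_equiv m)"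
  shows "comm_inf_class c \<in> carrier Comm_inf"
  using assms
  by (auto simp: Comm_inf_def dirlim_def simp flip: comm_inf_rel_class[OF assms] intro!: quotientI)

text \<open>The assumption on \<open>c\<close> makes its class nonempty; a commensuration
  equivariant at no level would give the empty set.\<close>

lemma comm_inf_class_inject:
  assumes "m \<ge> 1" "c \<in> carrier (CommK_equiv m)"
  shows "comm_inf_class c = comm_inf_class d \<longleftrightarrow> c = d"
  using assms by (auto simp: comm_inf_class_def)

lemma comm_inf_class_mult:
  assumes m: "m \<ge> 1" and c: "c \<in> carrier (CommK_equiv m)" and d: "d \<in> carrier (CommK_equiv m)"
  shows "comm_inf_class c \<otimes>\<^bsub>Comm_inf\<^esub> comm_inf_class d = comm_inf_class (c \<odot> d)"
proof -
  let ?R = "dirlim_rel {m. 1 \<le> m} (dvd) CommK_equiv (\<lambda>m n c. c)"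
  let ?S = "{?R `` {(k, x \<otimes>\<^bsub>CommK_equiv k\<^esub> y)} | i x j y k.
      (i, x) \<in> comm_inf_class c \<and> (j, y) \<in> comm_inf_class d \<and> k \<in> {m. 1 \<le> m} \<and> i dvd k \<and> j dvd k}"
  have mult: "x \<otimes>\<^bsub>CommK_equiv k\<^esub> y = x \<odot> y" for k x y by (simp add: CommK_equiv_def)
  have "comm_inf_class c \<otimes>\<^bsub>Comm_inf\<^esub> comm_inf_class d = \<Union>?S"
    by (simp add: Comm_inf_def dirlim_def)
  also have "\<dots> = comm_inf_class (c \<odot> d)"
  proof (rule Union_singleton)
    have "(m, c) \<in> comm_inf_class c" "(m, d) \<in> comm_inf_class d"
      using m c d by (auto simp: comm_inf_class_def)
    moreover have "comm_inf_class (c \<odot> d) = ?R `` {(m, c \<otimes>\<^bsub>CommK_equiv m\<^esub> d)}"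
      unfolding mult using comm_inf_rel_class[OF m CommK_equiv_mult[OF c d]] by simp
    ultimately show "comm_inf_class (c \<odot> d) \<in> ?S"
      using m by (intro CollectI exI[of _ m] exI[of _ c] exI[of _ m] exI[of _ d] exI[of _ m] conjI) simp_all
    fix X assume "X \<in> ?S"
    then obtain i x j y k where X: "X = ?R `` {(k, x \<otimes>\<^bsub>CommK_equiv k\<^esub> y)}"
      and ij: "(i, x) \<in> comm_inf_class c" "(j, y) \<in> comm_inf_class d"
      and k: "k \<in> {m. 1 \<le> m}" "i dvd k" "j dvd k"
      by - (drule CollectD, elim exE conjE, rule that; assumption)
    have x: "x = c" "y = d" and "c \<in> carrier (CommK_equiv i)" "d \<in> carrier (CommK_equiv j)"
      using ij by (simp_all add: mem_comm_inf_class)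
    then have "c \<odot> d \<in> carrier (CommK_equiv k)"
      using k by (intro CommK_equiv_mult) (auto dest: CommK_equiv_dvd)
    then show "X = comm_inf_class (c \<odot> d)"
      unfolding X x mult using k(1) by (intro comm_inf_rel_class) auto
  qed
  finally show ?thesis .
qed

section \<open>The actions on representatives\<close>

text \<open>The cocycle rule survives because \<open>f\<close> is additive on \<open>H\<close> and
  commutes with the shifts by elements of \<open>L\<close>, all of which are multiples of
  \<open>m\<close>.\<close>

lemma derivs_compose:
  assumes \<tau>: "\<tau> \<in> derivs M" and L: "fin_index_subgroup L integer_group" "L \<subseteq> M" "L \<subseteq> multiples m"
    and f: "(H, f) \<in> partial_auts lampK" "equivariant m (H, f)" and im: "\<tau> ` L \<subseteq> H"
  shows "(\<lambda>n\<in>L. f (\<tau> n)) \<in> derivs L"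
  unfolding derivs_iff
proof (intro conjI ballI)
  have fh: "f x \<in> carrier lampK" "f (x \<otimes>\<^bsub>lampK\<^esub> y) = f x \<otimes>\<^bsub>lampK\<^esub> f y" if "x \<in> H" "y \<in> H" for x y
    using f(1) that by (auto simp: K.partial_auts_iff hom_def)
  show "(\<lambda>n\<in>L. f (\<tau> n)) \<in> L \<rightarrow>\<^sub>E carrier lampK" using fh im by auto
  fix a b assume ab: "a \<in> L" "b \<in> L"
  have H: "\<tau> a \<in> H" "\<tau> b \<in> H" "a \<in> multiples m" using ab im L by auto
  have "f (\<tau> (a + b)) = f (\<tau> a \<otimes>\<^bsub>lampK\<^esub> shiftK a (\<tau> b))"
  proof -
    have "\<tau> (a + b) = \<tau> a \<otimes>\<^bsub>lampK\<^esub> shiftK a (\<tau> b)"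
      using \<tau> ab L(2) unfolding derivs_iff by blast
    then show ?thesis by simp
  qed
  also have "\<dots> = f (\<tau> a) \<otimes>\<^bsub>lampK\<^esub> shiftK a (f (\<tau> b))"
    using equivariantD[OF f(2) H(3,2)] H(1) by (simp add: fh)
  finally show "(\<lambda>n\<in>L. f (\<tau> n)) (a + b) = (\<lambda>n\<in>L. f (\<tau> n)) a \<otimes>\<^bsub>lampK\<^esub> shiftK a ((\<lambda>n\<in>L. f (\<tau> n)) b)"
    using ab subgroup_add_closed[OF L(1) ab] by simp
qed

text \<open>
  Two equivariant representatives of one class agree on a subgroup that is itself shift invariant,
  whereas the subgroup provided by \<open>comm_rel\<close> need not be.
\<close>

lemma equivariant_equalizer:
  assumes f: "(H, f) \<in> partial_auts lampK" "equivariant m (H, f)"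
    and f': "(H', f') \<in> partial_auts lampK" "equivariant n (H', f')"
    and rel: "((H, f), (H', f')) \<in> comm_rel lampK"
  shows "fin_index_subgroup {x \<in> H \<inter> H'. f x = f' x} lampK"
    and "i \<in> multiples (m * n) \<Longrightarrow> x \<in> {x \<in> H \<inter> H'. f x = f' x} \<Longrightarrow> shiftK i x \<in> {x \<in> H \<inter> H'. f x = f' x}"
proof -
  obtain L where L: "fin_index_subgroup L lampK" "L \<subseteq> H" "L \<subseteq> H'" "\<And>x. x \<in> L \<Longrightarrow> f x = f' x"
    using comm_relE[OF rel] by metis
  have "f \<in> hom (lampK\<lparr>carrier := H \<inter> H'\<rparr>) lampK" "f' \<in> hom (lampK\<lparr>carrier := H \<inter> H'\<rparr>) lampK"
    using f f' by (auto simp: K.partial_auts_iff hom_def)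
  moreover have "subgroup (H \<inter> H') lampK"
    using f f' by (auto simp: K.partial_auts_iff fin_index_subgroup_def intro: K.subgroups_Inter_pair)
  ultimately have "subgroup {x \<in> H \<inter> H'. f x = f' x} lampK"
    by (intro K.subgroup_equalizer[OF _ K.is_group])
  then show "fin_index_subgroup {x \<in> H \<inter> H'. f x = f' x} lampK"
    using L by (intro K.fin_index_superset[OF L(1)]) auto
  assume i: "i \<in> multiples (m * n)" and x: "x \<in> {x \<in> H \<inter> H'. f x = f' x}"
  have "i \<in> multiples m" "i \<in> multiples n"
    using i multiples_mono[of m "m * n"] multiples_mono[of n "m * n"] by auto
  then show "shiftK i x \<in> {x \<in> H \<inter> H'. f x = f' x}"
    using x equivariantD[OF f(2)] equivariantD[OF f'(2)] by auto
qed

text \<open>The level is taken deep enough for the composite to be defined on all of mZ;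
  \<open>common_level\<close> supplies such levels.\<close>

lemma Comm_inf_act_class:
  assumes m: "m \<ge> 1" and f: "(H, f) \<in> partial_auts lampK" "equivariant m (H, f)"
    and \<tau>: "\<tau> \<in> derivs (multiples m)" and im: "\<tau> ` multiples m \<subseteq> H"
  shows "Comm_inf_act (comm_inf_class (cclass lampK (H, f))) (vclass m \<tau>)
    = vclass m (\<lambda>n\<in>multiples m. f (\<tau> n))"
    and "(\<lambda>n\<in>multiples m. f (\<tau> n)) \<in> derivs (multiples m)"
proof -
  interpret Z: group integer_group by simp
  have M: "fin_index_subgroup (multiples m) integer_group" using m by (rule fin_index_multiples)
  let ?R = "VDer_rel integer_group lampK shiftK"
  let ?c = "cclass lampK (H, f)"
  show der: "(\<lambda>n\<in>multiples m. f (\<tau> n)) \<in> derivs (multiples m)"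
    by (rule derivs_compose[OF \<tau> M _ _ f im]) auto
  let ?S = "{?R `` {(L, \<lambda>n\<in>L. f' (\<tau>' n))} | k c H' f' M' \<tau>' L.
        (k, c) \<in> comm_inf_class ?c \<and> (H', f') \<in> c \<and> equivariant k (H', f') \<and> (M', \<tau>') \<in> vclass m \<tau> \<and>
        fin_index_subgroup L integer_group \<and> L \<subseteq> M' \<inter> multiples k \<and> \<tau>' ` L \<subseteq> H'}"
  have "Comm_inf_act (comm_inf_class ?c) (vclass m \<tau>) = \<Union>?S"
    by (simp only: Comm_inf_act_def)
  also have "\<dots> = vclass m (\<lambda>n\<in>multiples m. f (\<tau> n))" (is "_ = ?e")
  proof (rule Union_singleton)
    have "(m, ?c) \<in> comm_inf_class ?c" using m f by (auto simp: comm_inf_class_def carrier_CommK_equiv)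
    moreover have "(H, f) \<in> ?c" using f equiv_class_self[OF K.equiv_comm_rel] by blast
    moreover have "(multiples m, \<tau>) \<in> vclass m \<tau>" using M \<tau> by (auto simp: VDer_rel_iff)
    ultimately show "?e \<in> ?S" using f(2) M im by blast
    fix X assume "X \<in> ?S"
    then obtain k c H' f' M' \<tau>' L where X: "X = ?R `` {(L, \<lambda>n\<in>L. f' (\<tau>' n))}"
      and kc: "(k, c) \<in> comm_inf_class ?c" "(H', f') \<in> c" and k: "equivariant k (H', f')"
      and \<tau>': "(M', \<tau>') \<in> vclass m \<tau>"
      and L: "fin_index_subgroup L integer_group" "L \<subseteq> M' \<inter> multiples k" "\<tau>' ` L \<subseteq> H'"
      by - (drule CollectD, elim exE conjE, rule that; assumption)
    have k1: "k \<ge> 1" and rel: "((H, f), (H', f')) \<in> comm_rel lampK"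
      using kc by (simp_all add: mem_comm_inf_class)
    have f': "(H', f') \<in> partial_auts lampK" using rel by (auto simp: comm_rel_def)
    obtain N where N: "fin_index_subgroup N integer_group" "N \<subseteq> multiples m" "N \<subseteq> M'"
      "\<And>n. n \<in> N \<Longrightarrow> \<tau> n = \<tau>' n" and M': "\<tau>' \<in> derivs M'"
      using \<tau>' unfolding Image_singleton_iff VDer_rel_iff by blast
    \<comment> \<open>The representatives \<open>f\<close> and \<open>f'\<close> need to agree only
      on \<open>?E\<close>, so the composites are compared where \<open>\<tau>\<close> takes values
      in it. Invariance of \<open>?E\<close> under the multiples of \<open>m * k\<close> lets
      \<open>derivation_small\<close> show that \<open>?D\<close> has finite index.\<close>
    let ?E = "{x \<in> H \<inter> H'. f x = f' x}"
    let ?D = "{n \<in> multiples m \<inter> multiples (m * k). \<tau> n \<in> ?E}"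
    have D: "fin_index_subgroup ?D integer_group"
      using equivariant_equalizer[OF f f' k rel] m k1
      by (intro derivation_small[OF _ _ _ M \<tau>]) auto
    have "((L, \<lambda>n\<in>L. f' (\<tau>' n)), (multiples m, \<lambda>n\<in>multiples m. f (\<tau> n))) \<in> ?R"
      unfolding VDer_rel_iff
    proof (intro conjI exI[of _ "L \<inter> (N \<inter> ?D)"])
      show "fin_index_subgroup (L \<inter> (N \<inter> ?D)) integer_group"
        using L(1) N(1) D by (intro Z.fin_index_Int)
      show "(\<lambda>n\<in>L. f' (\<tau>' n)) \<in> derivs L" using L(2) by (intro derivs_compose[OF M' L(1) _ _ f' k L(3)]) auto
      show "\<forall>n\<in>L \<inter> (N \<inter> ?D). (\<lambda>n\<in>L. f' (\<tau>' n)) n = (\<lambda>n\<in>multiples m. f (\<tau> n)) n"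
        using N(4) by auto
    qed (use L(1) M der in auto)
    then show "X = ?e" unfolding X by (rule VDer_rel_classI)
  qed
  finally show "Comm_inf_act (comm_inf_class ?c) (vclass m \<tau>) = ?e" .
qed

section \<open>The flip acting on virtual derivations\<close>

definition flip_deriv :: "int set \<Rightarrow> (int \<Rightarrow> lamp) \<Rightarrow> int \<Rightarrow> lamp"
  where "flip_deriv M \<tau> = (\<lambda>n\<in>M. flipK (\<tau> (- n)))"

lemma fin_index_uminus: "fin_index_subgroup L integer_group \<Longrightarrow> n \<in> L \<Longrightarrow> - n \<in> L"
  using subgroup.m_inv_closed[OF fin_index_subgroupD] by fastforce

text \<open>The two reversals compensate each other: \<open>flipK\<close> turns the shift by
  \<open>- a\<close> into the shift by \<open>a\<close>.\<close>

lemma flip_deriv_derivs: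
  assumes \<tau>: "\<tau> \<in> derivs M" and M: "fin_index_subgroup M integer_group"
  shows "flip_deriv M \<tau> \<in> derivs M"
  unfolding derivs_iff
proof (intro conjI ballI)
  show "flip_deriv M \<tau> \<in> M \<rightarrow>\<^sub>E carrier lampK"
    using derivs_closed[OF \<tau>] fin_index_uminus[OF M] by (auto simp: flip_deriv_def)
  fix a b assume ab: "a \<in> M" "b \<in> M"
  have "\<tau> (- a + - b) = \<tau> (- a) \<otimes>\<^bsub>lampK\<^esub> shiftK (- a) (\<tau> (- b))"
    using \<tau> fin_index_uminus[OF M] ab by (simp only: derivs_iff)
  then have "\<tau> (- (a + b)) = \<tau> (- a) \<otimes>\<^bsub>lampK\<^esub> shiftK (- a) (\<tau> (- b))" by simp
  then show "flip_deriv M \<tau> (a + b) = flip_deriv M \<tau> a \<otimes>\<^bsub>lampK\<^esub> shiftK a (flip_deriv M \<tau> b)"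
    using ab subgroup_add_closed[OF M ab] by (simp add: flip_deriv_def flipK_mult flipK_shiftK)
qed

lemma flip_deriv_flip_deriv:
  assumes "\<tau> \<in> derivs M" "fin_index_subgroup M integer_group"
  shows "flip_deriv M (flip_deriv M \<tau>) = \<tau>"
  using assms fin_index_uminus[OF assms(2)]
  by (auto simp: flip_deriv_def derivs_iff PiE_iff extensional_def fun_eq_iff)

lemma VDer_rel_flip:
  assumes "((M, \<tau>), (N, \<upsilon>)) \<in> VDer_rel integer_group lampK shiftK"
  shows "((M, flip_deriv M \<tau>), (N, flip_deriv N \<upsilon>)) \<in> VDer_rel integer_group lampK shiftK"
proof -
  obtain L where L: "fin_index_subgroup L integer_group" "L \<subseteq> M" "L \<subseteq> N" "\<And>n. n \<in> L \<Longrightarrow> \<tau> n = \<upsilon> n"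
    and *: "fin_index_subgroup M integer_group" "fin_index_subgroup N integer_group"
      "\<tau> \<in> derivs M" "\<upsilon> \<in> derivs N"
    using assms unfolding VDer_rel_iff by blast
  have "\<forall>n\<in>L. flip_deriv M \<tau> n = flip_deriv N \<upsilon> n"
    using L(2-4) fin_index_uminus[OF L(1)] by (auto simp: flip_deriv_def subset_iff)
  then show ?thesis using * L flip_deriv_derivs unfolding VDer_rel_iff by blast
qed

text \<open>The image of the class fills the new class because flipping is an involution: each
  member is the flip of its own flip.\<close>

lemma flip_VDer_class:
  assumes m: "m \<ge> 1" and \<tau>: "\<tau> \<in> derivs (multiples m)"
  shows "flip_VDer (vclass m \<tau>) = vclass m (flip_deriv (multiples m) \<tau>)"
proof
  have M: "fin_index_subgroup (multiples m) integer_group" using m by (rule fin_index_multiples)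
  have fl: "flip_VDer T = (\<lambda>(M, \<tau>). (M, flip_deriv M \<tau>)) ` T" for T
    by (simp add: flip_VDer_def flip_deriv_def)
  show "flip_VDer (vclass m \<tau>) \<subseteq> vclass m (flip_deriv (multiples m) \<tau>)"
    unfolding fl using VDer_rel_flip by auto
  show "vclass m (flip_deriv (multiples m) \<tau>) \<subseteq> flip_VDer (vclass m \<tau>)"
  proof
    fix p assume "p \<in> vclass m (flip_deriv (multiples m) \<tau>)"
    then obtain N \<upsilon> where p: "p = (N, \<upsilon>)"
      "((multiples m, flip_deriv (multiples m) \<tau>), (N, \<upsilon>)) \<in> VDer_rel integer_group lampK shiftK"
      by (cases p) auto
    have "((multiples m, \<tau>), (N, flip_deriv N \<upsilon>)) \<in> VDer_rel integer_group lampK shiftK"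
      using VDer_rel_flip[OF p(2)] by (simp add: flip_deriv_flip_deriv[OF \<tau> M])
    moreover have "flip_deriv N (flip_deriv N \<upsilon>) = \<upsilon>"
      using p(2) flip_deriv_flip_deriv unfolding VDer_rel_iff by blast
    ultimately show "p \<in> flip_VDer (vclass m \<tau>)" unfolding fl p(1) by force
  qed
qed

section \<open>The flip acting on commensurations of K by conjugation\<close>

abbreviation flip_aut :: "lamp partial_aut"
  where "flip_aut \<equiv> (carrier lampK, restrict flipK (carrier lampK))"

definition flip_conj :: "lamp partial_aut \<Rightarrow> lamp partial_aut"
  where "flip_conj p = pcomp flip_aut (pcomp p flip_aut)"

lemma flip_aut_partial: "flip_aut \<in> partial_auts lampK"
proof -
  have "flipK ` carrier lampK = carrier lampK"
    using flipK_closed flipK_flipK by (metis image_eqI image_subsetI subsetI subset_antisym)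
  moreover have "inj_on flipK (carrier lampK)" by (metis flipK_flipK inj_on_inverseI)
  ultimately show ?thesis
    by (auto simp: K.partial_auts_iff K.fin_index_carrier hom_def flipK_mult)
qed

lemma flip_aut_square: "pcomp flip_aut flip_aut = (carrier lampK, \<lambda>x\<in>carrier lampK. x)"
  by (auto simp: pcomp_Pair fun_eq_iff)

lemma flip_comm_class: "flip_comm = cclass lampK flip_aut"
  by (simp add: flip_comm_def)

lemma flip_comm_in: "flip_comm \<in> carrier (Comm lampK)"
  unfolding flip_comm_class by (rule cclass_in_Comm[OF flip_aut_partial])

lemma flip_comm_square: "flip_comm \<odot> flip_comm = \<one>\<^bsub>Comm lampK\<^esub>"
  unfolding flip_comm_class K.Comm_mult_class[OF flip_aut_partial flip_aut_partial] flip_aut_square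
  by (simp add: Comm_def)

lemma inv_flip_comm: "inv\<^bsub>Comm lampK\<^esub> flip_comm = flip_comm"
  by (rule CK.inv_unique'[OF flip_comm_in flip_comm_in flip_comm_square flip_comm_square, symmetric])

lemma flip_conj_partial: "p \<in> partial_auts lampK \<Longrightarrow> flip_conj p \<in> partial_auts lampK"
  unfolding flip_conj_def by (intro K.pcomp_closed flip_aut_partial)

lemma flip_conj_class:
  assumes "p \<in> partial_auts lampK"
  shows "flip_comm \<odot> cclass lampK p \<odot> inv\<^bsub>Comm lampK\<^esub> flip_comm = cclass lampK (flip_conj p)"
  unfolding inv_flip_comm using assms
  by (simp only: flip_comm_class flip_conj_def K.Comm_mult_class K.pcomp_closed
      flip_aut_partial pcomp_assoc)

lemma flip_conj_Pair:
  assumes "(H, f) \<in> partial_auts lampK"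
  shows "flip_conj (H, f) = ({x \<in> carrier lampK. flipK x \<in> H},
    \<lambda>x\<in>{x \<in> carrier lampK. flipK x \<in> H}. flipK (f (flipK x)))"
proof -
  have *: "f x \<in> carrier lampK" if "x \<in> H" for x
    using that assms by (auto simp: K.partial_auts_iff hom_def)
  have dom: "{x \<in> {x \<in> carrier lampK. restrict flipK (carrier lampK) x \<in> H}.
      (\<lambda>x\<in>{x \<in> carrier lampK. restrict flipK (carrier lampK) x \<in> H}. f (restrict flipK (carrier lampK) x)) x
        \<in> carrier lampK} = {x \<in> carrier lampK. flipK x \<in> H}"
    using * by auto
  show ?thesis
    unfolding flip_conj_def pcomp_Pair dom using * by (auto simp: fun_eq_iff)
qed

lemma equivariant_flip_conj:
  assumes p: "p \<in> partial_auts lampK" and e: "equivariant m p"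
  shows "equivariant m (flip_conj p)"
proof -
  obtain H f where pf: "p = (H, f)" by force
  have *: "shiftK (- n) x \<in> H" "f (shiftK (- n) x) = shiftK (- n) (f x)"
    if "n \<in> multiples m" "x \<in> H" for n x
    using equivariantD[OF e[unfolded pf], of "- n" x] that by (auto simp: mem_multiples)
  have "flipK (shiftK n (flipK x)) = shiftK (- n) x" for n x by (simp add: flipK_shiftK)
  then show ?thesis
    unfolding pf flip_conj_Pair[OF p[unfolded pf]] using * 
    by (intro equivariantI) (auto simp: flipK_shiftK)
qed

lemma CommK_equiv_flip:
  assumes "c \<in> carrier (CommK_equiv m)"
  shows "flip_comm \<odot> c \<odot> inv\<^bsub>Comm lampK\<^esub> flip_comm \<in> carrier (CommK_equiv m)"
proof -
  obtain p where p: "p \<in> partial_auts lampK" "equivariant m p" "c = cclass lampK p"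
    using assms unfolding carrier_CommK_equiv by blast
  then show ?thesis
    unfolding carrier_CommK_equiv p(3) flip_conj_class[OF p(1)]
    using flip_conj_partial equivariant_flip_conj by (metis surj_pair)
qed

lemma flip_Comm_inf_class:
  assumes "p \<in> partial_auts lampK" 
  shows "flip_Comm_inf (comm_inf_class (cclass lampK p)) = comm_inf_class (cclass lampK (flip_conj p))"
proof -
  let ?c = "cclass lampK p"
  let ?g = "\<lambda>c. flip_comm \<odot> c \<odot> inv\<^bsub>Comm lampK\<^esub> flip_comm"
  have c: "?c \<in> carrier (Comm lampK)" by (rule cclass_in_Comm[OF assms])
  have "?g (?g ?c) = flip_comm \<odot> flip_comm \<odot> ?c \<odot> (flip_comm \<odot> flip_comm)"
    using c flip_comm_in by (simp add: inv_flip_comm CK.m_assoc)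
  then have gg: "?g (?g ?c) = ?c" using c by (simp add: flip_comm_square)
  \<comment> \<open>Conjugating twice is the identity, so preservation of a level in one direction
    gives it in both, and a class and its conjugate occur at exactly the same levels.\<close>
  have "?g ?c \<in> carrier (CommK_equiv m) \<longleftrightarrow> ?c \<in> carrier (CommK_equiv m)" for m
    using CommK_equiv_flip[of ?c m] CommK_equiv_flip[of "?g ?c" m] unfolding gg by blast
  then show ?thesis
    unfolding flip_conj_class[OF assms, symmetric]
    by (auto simp: flip_Comm_inf_def comm_inf_class_def)
qed

section \<open>Standard partial automorphisms of the lamplighter group\<close>

text \<open>A single level serves both components, so that the domain of \<open>p\<close> times
  \<open>multiples m\<close> is a subgroup; \<open>standard_datum_restrict\<close> passes to deeper
  levels.\<close>

definition standard_datum :: "nat \<Rightarrow> (int \<Rightarrow> lamp) \<Rightarrow> lamp partial_aut \<Rightarrow> bool"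
  where "standard_datum m \<tau> p \<longleftrightarrow>
    m \<ge> 1 \<and> \<tau> \<in> derivs (multiples m) \<and> p \<in> partial_auts lampK \<and> equivariant m p"

definition lamp_aut :: "nat \<Rightarrow> (int \<Rightarrow> lamp) \<Rightarrow> lamp partial_aut \<Rightarrow> (lamp \<times> int) partial_aut"
  where "lamp_aut m \<tau> p = (fst p \<times> multiples m,
    \<lambda>(x, n)\<in>fst p \<times> multiples m. (snd p x \<otimes>\<^bsub>lampK\<^esub> \<tau> n, n))"

text \<open>The exponent is an integer because it comes from the carrier of
  \<open>integer_mod_group 2\<close>, that is, from 0 and 1.\<close>

definition lamp_flip :: "int \<Rightarrow> (lamp \<times> int) partial_aut"
  where "lamp_flip s = (carrier lamplighter,
    \<lambda>(x, n)\<in>carrier lamplighter. if s = 0 then (x, n) else (flipK x, - n))"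

lemma partial_auts_closed:
  assumes "(H, f) \<in> partial_auts lampK" "x \<in> H"
  shows "x \<in> carrier lampK" "f x \<in> carrier lampK"
  using assms subgroup.subset[of H lampK] by (auto simp: K.partial_auts_iff fin_index_subgroup_def hom_def)

lemma partial_auts_mult:
  assumes "(H, f) \<in> partial_auts lampK" "x \<in> H" "y \<in> H"
  shows "f (x \<otimes>\<^bsub>lampK\<^esub> y) = f x \<otimes>\<^bsub>lampK\<^esub> f y" "x \<otimes>\<^bsub>lampK\<^esub> y \<in> H"
  using assms by (auto simp: K.partial_auts_iff hom_def fin_index_subgroup_def subgroup.m_closed)

lemma standard_datum_fin_index:
  assumes "standard_datum m \<tau> (H, f)"
  shows "fin_index_subgroup (H \<times> multiples m) lamplighter"
  using assms equivariantD[of m H f]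
  by (intro fin_index_lamplighter) (auto simp: standard_datum_def K.partial_auts_iff)

lemma lamp_aut_partial:
  assumes "standard_datum m \<tau> p"
  shows "lamp_aut m \<tau> p \<in> partial_auts lamplighter"
proof -
  obtain H f where p: "p = (H, f)" by force
  have m: "m \<ge> 1" and \<tau>: "\<tau> \<in> derivs (multiples m)" and f: "(H, f) \<in> partial_auts lampK"
    and e: "equivariant m (H, f)" using assms by (auto simp: standard_datum_def p)
  have M: "fin_index_subgroup (multiples m) integer_group" using m by (rule fin_index_multiples)
  note fc = partial_auts_closed[OF f] and fm = partial_auts_mult[OF f]
  note tc = derivs_closed[OF \<tau>]
  have dom: "fin_index_subgroup (H \<times> multiples m) lamplighter"
    using standard_datum_fin_index assms p by blast
  let ?F = "\<lambda>(x, n)\<in>H \<times> multiples m. (f x \<otimes>\<^bsub>lampK\<^esub> \<tau> n, n)"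
  have cl: "pq \<in> H \<times> multiples m \<Longrightarrow> qr \<in> H \<times> multiples m \<Longrightarrow>
    pq \<otimes>\<^bsub>lamplighter\<^esub> qr \<in> H \<times> multiples m" for pq qr
    using subgroup.m_closed[OF fin_index_subgroupD[OF dom]] .
  have hom: "?F \<in> hom (lamplighter\<lparr>carrier := H \<times> multiples m\<rparr>) lamplighter"
  proof (rule homI)
    fix P assume "P \<in> carrier (lamplighter\<lparr>carrier := H \<times> multiples m\<rparr>)"
    then show "?F P \<in> carrier lamplighter" using fc tc by (auto simp: carrier_lamplighter)
  next
    fix P Q
    assume "P \<in> carrier (lamplighter\<lparr>carrier := H \<times> multiples m\<rparr>)"
      "Q \<in> carrier (lamplighter\<lparr>carrier := H \<times> multiples m\<rparr>)"
    then obtain x n y k where PQ: "P = (x, n)" "Q = (y, k)" "x \<in> H" "y \<in> H" "n \<in> multiples m" "k \<in> multiples m"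
      by auto
    have c: "x \<otimes>\<^bsub>lampK\<^esub> shiftK n y \<in> H" "n + k \<in> multiples m"
      using cl[of P Q] PQ by (auto simp: mult_lamplighter)
    have s: "shiftK n y \<in> H" "f (shiftK n y) = shiftK n (f y)"
      using equivariantD[OF e] PQ by auto
    have "f (x \<otimes>\<^bsub>lampK\<^esub> shiftK n y) \<otimes>\<^bsub>lampK\<^esub> \<tau> (n + k)
        = (f x \<otimes>\<^bsub>lampK\<^esub> shiftK n (f y)) \<otimes>\<^bsub>lampK\<^esub> (\<tau> n \<otimes>\<^bsub>lampK\<^esub> shiftK n (\<tau> k))"
      using \<tau> PQ fm s unfolding derivs_iff by simp
    also have "\<dots> = (f x \<otimes>\<^bsub>lampK\<^esub> \<tau> n) \<otimes>\<^bsub>lampK\<^esub> shiftK n (f y \<otimes>\<^bsub>lampK\<^esub> \<tau> k)"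
      using PQ fc tc by (simp add: shiftK_mult K.m_ac)
    finally show "?F (P \<otimes>\<^bsub>lamplighter\<lparr>carrier := H \<times> multiples m\<rparr>\<^esub> Q) = ?F P \<otimes>\<^bsub>lamplighter\<^esub> ?F Q"
      using PQ c by (simp add: mult_lamplighter)
  qed
  have inj: "inj_on ?F (H \<times> multiples m)"
    using f fc tc by (auto simp: inj_on_def K.partial_auts_iff)
  interpret h: group_hom "lamplighter\<lparr>carrier := H \<times> multiples m\<rparr>" lamplighter ?F
    using subgroup.subgroup_is_group[OF fin_index_subgroupD[OF dom] L.group_axioms] hom
    by (intro group_hom.intro group_hom_axioms.intro L.group_axioms)
  have fH: "fin_index_subgroup (f ` H) lampK" using f by (simp add: K.partial_auts_iff)
  have finv: "shiftK n y \<in> f ` H" if "n \<in> multiples m" "y \<in> f ` H" for n y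
    using that equivariantD[OF e] by (metis (no_types, lifting) image_iff)
  \<comment> \<open>The image is not \<open>f ` H \<times> multiples m\<close>, but contains \<open>f ` H \<times> multiples k\<close> as soon as \<open>\<tau>\<close> maps
    \<open>multiples k\<close> into \<open>f ` H\<close>.\<close>
  obtain k where k: "k \<ge> 1" "{n \<in> multiples m \<inter> multiples m. \<tau> n \<in> f ` H} = multiples k"
    using fin_index_integer_group[OF derivation_small[OF fH finv m M \<tau>]] by metis
  have "fin_index_subgroup (f ` H \<times> multiples k) lamplighter"
  proof (intro fin_index_lamplighter fH k(1) finv)
    show "n \<in> multiples m" if "n \<in> multiples k" for n using that k(2) by blast
  qed
  moreover have "f ` H \<times> multiples k \<subseteq> ?F ` (H \<times> multiples m)"
  proof clarify
    fix x n assume x: "x \<in> H" and "n \<in> multiples k"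
    then have n: "n \<in> multiples m" "\<tau> n \<in> f ` H" using k by auto
    then obtain y where y: "y \<in> H" "\<tau> n = f y" by auto
    \<comment> \<open>Adding \<open>y\<close> in the first coordinate contributes
      \<open>\<tau> n\<close> once more, and in exponent two the two copies cancel.\<close>
    have "?F (x \<otimes>\<^bsub>lampK\<^esub> y, n) = (f x, n)"
      using x y n fm[OF x y(1)] fc by (simp add: K.m_assoc lampK_square)
    then show "(f x, n) \<in> ?F ` (H \<times> multiples m)"
      using fm(2)[OF x y(1)] n(1) by (metis (no_types, lifting) SigmaI image_eqI)
  qed
  moreover have "subgroup (?F ` (H \<times> multiples m)) lamplighter"
    using h.img_is_subgroup by simp
  ultimately have "fin_index_subgroup (?F ` (H \<times> multiples m)) lamplighter"
    by (rule L.fin_index_superset)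
  then show ?thesis
    unfolding lamp_aut_def p fst_conv snd_conv L.partial_auts_iff using dom hom inj by simp
qed

lemma lamp_flip_partial: "lamp_flip s \<in> partial_auts lamplighter"
proof -
  let ?F = "\<lambda>(x, n)\<in>carrier lamplighter. if s = 0 then (x, n) else (flipK x, - n)"
  have FF: "?F (?F P) = P" "?F P \<in> carrier lamplighter" if "P \<in> carrier lamplighter" for P
    using that by (auto simp: carrier_lamplighter split: if_splits)
  have "?F ` carrier lamplighter = carrier lamplighter"
    using FF by (metis (no_types, lifting) image_eqI image_subsetI subsetI subset_antisym)
  moreover have "inj_on ?F (carrier lamplighter)" using FF(1) by (rule inj_on_inverseI)
  moreover have "?F \<in> hom lamplighter lamplighter"
    by (auto simp: hom_def carrier_lamplighter mult_lamplighter flipK_mult flipK_shiftK)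
  ultimately show ?thesis
    unfolding lamp_flip_def by (simp add: L.partial_auts_iff L.fin_index_carrier)
qed

lemma lamp_flip_mult:
  assumes "s \<in> {0, 1}" "s' \<in> {0, 1}"
  shows "pcomp (lamp_flip s) (lamp_flip s') = lamp_flip ((s + s') mod 2)"
proof -
  have c: "(\<lambda>(x, n)\<in>carrier lamplighter. if s' = 0 then (x, n) else (flipK x, - n)) P \<in> carrier lamplighter"
    if "P \<in> carrier lamplighter" for P
    using that by (auto simp: carrier_lamplighter)
  then show ?thesis
    unfolding lamp_flip_def pcomp_Pair using assms
    by (auto simp: carrier_lamplighter fun_eq_iff)
qed

text \<open>By \<open>im\<close> the condition that f' x + \<upsilon> n lies in \<open>H\<close>
  does not involve \<open>n\<close>, so the composite again has a product as its domain. The new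
  derivation is \<open>\<tau>\<close> plus \<open>f\<close> applied to \<open>\<upsilon>\<close>,
  the twisted product; the nested restrictions have the shape in which \<open>vclass_mult\<close>
  and \<open>Comm_inf_act_class\<close> deliver it.\<close>

lemma pcomp_lamp_aut:
  assumes p: "standard_datum m \<tau> p" and q: "standard_datum m \<upsilon> q"
    and im: "\<upsilon> ` multiples m \<subseteq> fst p"
  shows "pcomp (lamp_aut m \<tau> p) (lamp_aut m \<upsilon> q)
    = lamp_aut m (\<lambda>n\<in>multiples m. \<tau> n \<otimes>\<^bsub>lampK\<^esub> (\<lambda>n\<in>multiples m. snd p (\<upsilon> n)) n) (pcomp p q)"
proof -
  obtain H f H' f' where e: "p = (H, f)" "q = (H', f')" by (metis surj_pair)
  have f: "(H, f) \<in> partial_auts lampK" and f': "(H', f') \<in> partial_auts lampK"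
    and \<tau>: "\<tau> \<in> derivs (multiples m)" and \<upsilon>: "\<upsilon> \<in> derivs (multiples m)"
    using p q by (auto simp: standard_datum_def e)
  note fc = partial_auts_closed[OF f] and fm = partial_auts_mult[OF f]
  note fc' = partial_auts_closed[OF f'] and tc = derivs_closed[OF \<tau>] and uc = derivs_closed[OF \<upsilon>]
  have uH: "\<upsilon> n \<in> H" if "n \<in> multiples m" for n using im that by (auto simp: e)
  have iff: "f' x \<otimes>\<^bsub>lampK\<^esub> \<upsilon> n \<in> H \<longleftrightarrow> f' x \<in> H" if "x \<in> H'" "n \<in> multiples m" for x n
  proof
    assume "f' x \<otimes>\<^bsub>lampK\<^esub> \<upsilon> n \<in> H"
    then have "f' x \<otimes>\<^bsub>lampK\<^esub> \<upsilon> n \<otimes>\<^bsub>lampK\<^esub> \<upsilon> n \<in> H" using fm(2) uH[OF that(2)] by blast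
    then show "f' x \<in> H" using that fc' uc by (simp add: K.m_assoc lampK_square)
  qed (use fm(2) uH[OF that(2)] in blast)
  have dom: "{P \<in> H' \<times> multiples m. (\<lambda>(x, n)\<in>H' \<times> multiples m. (f' x \<otimes>\<^bsub>lampK\<^esub> \<upsilon> n, n)) P \<in> H \<times> multiples m}
      = {x \<in> H'. f' x \<in> H} \<times> multiples m"
    using iff by auto
  have "f (f' x \<otimes>\<^bsub>lampK\<^esub> \<upsilon> n) \<otimes>\<^bsub>lampK\<^esub> \<tau> n = f (f' x) \<otimes>\<^bsub>lampK\<^esub> (\<tau> n \<otimes>\<^bsub>lampK\<^esub> f (\<upsilon> n))"
    if "x \<in> H'" "f' x \<in> H" "n \<in> multiples m" for x n
    using that fm uH fc tc by (simp add: K.m_ac)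
  then show ?thesis
    unfolding e lamp_aut_def fst_conv snd_conv pcomp_Pair dom using iff
    by (auto simp: fun_eq_iff)
qed

text \<open>Moving the flip to the right past a normal form conjugates both of its components, which
  is the source of \<open>flip_act\<close>. Both composites have the domain of \<open>p\<close>
  times mZ, so the equality holds for representatives.\<close>

lemma pcomp_flip_lamp_aut:
  assumes "standard_datum m \<tau> p"
  shows "pcomp (lamp_flip 1) (lamp_aut m \<tau> p)
    = pcomp (lamp_aut m (flip_deriv (multiples m) \<tau>) (flip_conj p)) (lamp_flip 1)"
proof -
  obtain H f where p: "p = (H, f)" by force
  have f: "(H, f) \<in> partial_auts lampK" and \<tau>: "\<tau> \<in> derivs (multiples m)"
    using assms by (auto simp: standard_datum_def p)
  note fc = partial_auts_closed[OF f] and tc = derivs_closed[OF \<tau>]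
  have minus: "- n \<in> multiples m \<longleftrightarrow> n \<in> multiples m" for n by (simp add: mem_multiples)
  have d1: "{P \<in> H \<times> multiples m. (\<lambda>(x, n)\<in>H \<times> multiples m. (f x \<otimes>\<^bsub>lampK\<^esub> \<tau> n, n)) P \<in> carrier lamplighter}
      = H \<times> multiples m"
    using fc tc by (auto simp: carrier_lamplighter)
  have d2: "{P \<in> carrier lamplighter.
       (\<lambda>(x, n)\<in>carrier lamplighter. if (1::int) = 0 then (x, n) else (flipK x, - n)) P
       \<in> {x \<in> carrier lampK. flipK x \<in> H} \<times> multiples m} = H \<times> multiples m"
    using fc by (auto simp: carrier_lamplighter minus)
  show ?thesis
    unfolding p lamp_aut_def lamp_flip_def flip_conj_Pair[OF f] fst_conv snd_conv pcomp_Pair d1 d2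
    using fc tc by (auto simp: fun_eq_iff carrier_lamplighter flip_deriv_def minus flipK_mult)
qed

lemma standard_datum_flip:
  assumes "standard_datum m \<tau> p"
  shows "standard_datum m (flip_deriv (multiples m) \<tau>) (flip_conj p)"
  using assms fin_index_multiples[of m]
  by (auto simp: standard_datum_def intro: flip_deriv_derivs flip_conj_partial equivariant_flip_conj)

lemma standard_datum_restrict:
  assumes "standard_datum m \<tau> p" "m dvd k" "k \<ge> 1"
  shows "standard_datum k (restrict \<tau> (multiples k)) p"
  using assms vclass_restrict(2)[of m k \<tau>] by (auto simp: standard_datum_def intro: equivariant_dvd)

lemma lamp_aut_rel_iff:
  assumes p: "standard_datum m \<tau> p" and q: "standard_datum n \<upsilon> q"
  shows "(lamp_aut m \<tau> p, lamp_aut n \<upsilon> q) \<in> comm_rel lamplighter \<longleftrightarrow>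
    vclass m \<tau> = vclass n \<upsilon> \<and> (p, q) \<in> comm_rel lampK" (is "?lhs \<longleftrightarrow> ?rhs")
proof -
  obtain H f H' f' where e: "p = (H, f)" "q = (H', f')" by (metis surj_pair)
  have m: "m \<ge> 1" and n: "n \<ge> 1" and f: "(H, f) \<in> partial_auts lampK" "equivariant m (H, f)"
    and f': "(H', f') \<in> partial_auts lampK" "equivariant n (H', f')"
    and \<tau>: "\<tau> \<in> derivs (multiples m)" and \<upsilon>: "\<upsilon> \<in> derivs (multiples n)"
    using p q by (auto simp: standard_datum_def e)
  note fc = partial_auts_closed[OF f(1)] and tc = derivs_closed[OF \<tau>]
  note fc' = partial_auts_closed[OF f'(1)] and uc = derivs_closed[OF \<upsilon>]
  let ?F = "\<lambda>(x, i)\<in>H \<times> multiples m. (f x \<otimes>\<^bsub>lampK\<^esub> \<tau> i, i)"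
  let ?G = "\<lambda>(x, i)\<in>H' \<times> multiples n. (f' x \<otimes>\<^bsub>lampK\<^esub> \<upsilon> i, i)"
  have aut: "lamp_aut m \<tau> p = (H \<times> multiples m, ?F)" "lamp_aut n \<upsilon> q = (H' \<times> multiples n, ?G)"
    by (simp_all add: lamp_aut_def e)
  show ?thesis
  proof
    assume ?lhs
    then have rel: "((H \<times> multiples m, ?F), (H' \<times> multiples n, ?G)) \<in> comm_rel lamplighter"
      unfolding aut .
    obtain L where L: "fin_index_subgroup L lamplighter" "L \<subseteq> H \<times> multiples m"
      "L \<subseteq> H' \<times> multiples n" "\<forall>P\<in>L. ?F P = ?G P"
      by (rule comm_relE[OF rel]) (rule that)
    interpret h: group_hom "lampK\<lparr>carrier := H\<rparr>" lampK f by (rule K.partial_auts_hom[OF f(1)])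
    interpret h': group_hom "lampK\<lparr>carrier := H'\<rparr>" lampK f' by (rule K.partial_auts_hom[OF f'(1)])
    have f1: "f \<one>\<^bsub>lampK\<^esub> = \<one>\<^bsub>lampK\<^esub>" "f' \<one>\<^bsub>lampK\<^esub> = \<one>\<^bsub>lampK\<^esub>"
      using h.hom_one h'.hom_one by simp_all
    have \<tau>0: "\<tau> 0 = \<one>\<^bsub>lampK\<^esub>" if "\<tau> \<in> derivs (multiples k)" for \<tau> k
    proof -
      have z: "0 \<in> multiples k" by (simp add: mem_multiples)
      then have "\<tau> 0 = \<tau> 0 \<otimes>\<^bsub>lampK\<^esub> \<tau> 0" using that unfolding derivs_iff by force
      then show ?thesis using derivs_closed[OF that z] lampK_square by metis
    qed
    have "f x = f' x" if "(x, 0) \<in> L" for x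
    proof -
      have "x \<in> H" "x \<in> H'" "0 \<in> multiples m" "0 \<in> multiples n" using that L by auto
      then show ?thesis using bspec[OF L(4) that] fc fc' by (simp add: \<tau>0[OF \<tau>] \<tau>0[OF \<upsilon>])
    qed
    then have "(p, q) \<in> comm_rel lampK"
      unfolding e using L(2,3) by (intro comm_relI[OF f(1) f'(1) fin_index_lamplighter_base[OF L(1)]]) auto
    moreover obtain k where k: "k \<ge> 1" "{i. (\<one>\<^bsub>lampK\<^esub>, i) \<in> L} = multiples k"
      using fin_index_lamplighter_top[OF L(1)] .
    have "m dvd k \<and> n dvd k \<and> (\<forall>i\<in>multiples k. \<tau> i = \<upsilon> i)"
    proof (intro conjI ballI)
      have "i \<in> multiples m" "i \<in> multiples n" "\<tau> i = \<upsilon> i" if "i \<in> multiples k" for i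
      proof -
        have i: "(\<one>\<^bsub>lampK\<^esub>, i) \<in> L" using that k(2) by blast
        then show "i \<in> multiples m" "i \<in> multiples n" using L(2,3) by auto
        then show "\<tau> i = \<upsilon> i"
          using bspec[OF L(4) i] i L(2,3) f1 tc uc by (auto simp: subset_iff)
      qed
      then show "m dvd k" "n dvd k" "\<And>i. i \<in> multiples k \<Longrightarrow> \<tau> i = \<upsilon> i"
        unfolding multiples_subset_iff[symmetric] by auto
    qed
    then have "vclass m \<tau> = vclass n \<upsilon>"
      using vclass_eq_iff[OF m n \<tau> \<upsilon>] k(1) by blast
    ultimately show ?rhs by blast
  next
    assume r: ?rhs
    then obtain k where k: "k \<ge> 1" "m dvd k" "n dvd k" "\<And>i. i \<in> multiples k \<Longrightarrow> \<tau> i = \<upsilon> i"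
      using vclass_eq_iff[OF m n \<tau> \<upsilon>] by blast
    have rel: "((H, f), (H', f')) \<in> comm_rel lampK" using r e by simp
    let ?E = "{x \<in> H \<inter> H'. f x = f' x}"
    have fe: "equivariant k (H, f)" "equivariant k (H', f')"
      using f(2) f'(2) k equivariant_dvd by blast+
    \<comment> \<open>The level is \<open>k * k\<close> because \<open>equivariant_equalizer\<close>
      multiplies the levels of its two maps, here both \<open>k\<close>.\<close>
    have "fin_index_subgroup (?E \<times> multiples (k * k)) lamplighter"
      using equivariant_equalizer[OF f(1) fe(1) f'(1) fe(2) rel] k(1)
      by (intro fin_index_lamplighter) auto
    moreover have "multiples (k * k) \<subseteq> multiples k" by (rule multiples_mono) simp
    moreover note multiples_mono[OF k(2)] multiples_mono[OF k(3)]
    ultimately show ?lhs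
      unfolding aut using lamp_aut_partial[OF p] lamp_aut_partial[OF q] k(4)
      unfolding aut by (intro comm_relI) auto
  qed
qed

section \<open>Every partial automorphism is standard up to the flip\<close>

locale lamp_partial_aut =
  fixes H F
  assumes F: "(H, F) \<in> partial_auts lamplighter"
begin

lemma H_fin_index: "fin_index_subgroup H lamplighter"
  using F by (simp add: L.partial_auts_iff)

sublocale H: subgroup H lamplighter
  using H_fin_index by (rule fin_index_subgroupD)

lemma F_inj: "inj_on F H"
  using F by (simp add: L.partial_auts_iff)

lemma F_mult: "P \<in> H \<Longrightarrow> Q \<in> H \<Longrightarrow> F (P \<otimes>\<^bsub>lamplighter\<^esub> Q) = F P \<otimes>\<^bsub>lamplighter\<^esub> F Q"
  using F by (auto simp: L.partial_auts_iff hom_def)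

lemma F_closed: "P \<in> H \<Longrightarrow> F P \<in> carrier lamplighter"
  using F by (auto simp: L.partial_auts_iff hom_def)

lemma F_one: "F \<one>\<^bsub>lamplighter\<^esub> = \<one>\<^bsub>lamplighter\<^esub>"
  using group_hom.hom_one[OF L.partial_auts_hom[OF F]] by simp

lemma fst_closed: "P \<in> H \<Longrightarrow> fst (F P) \<in> carrier lampK"
  using F_closed by (fastforce simp: carrier_lamplighter)

lemma H_carrier: "(x, n) \<in> H \<Longrightarrow> x \<in> carrier lampK"
  using H.subset by (auto simp: carrier_lamplighter)

text \<open>Squaring doubles the Z-part, so K is exactly the set of solutions of P^2 = 1, a
  description that homomorphisms respect.\<close>

lemma snd_base:
  assumes "(x, 0) \<in> H"
  shows "snd (F (x, 0)) = 0"
proof -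
  have "(x, 0) \<otimes>\<^bsub>lamplighter\<^esub> (x, 0) = \<one>\<^bsub>lamplighter\<^esub>"
    using H_carrier[OF assms] by (simp add: mult_lamplighter one_lamplighter lampK_square)
  then have "F (x, 0) \<otimes>\<^bsub>lamplighter\<^esub> F (x, 0) = \<one>\<^bsub>lamplighter\<^esub>"
    using F_mult[OF assms assms] F_one by simp
  then show ?thesis
    by (cases "F (x, 0)") (simp add: mult_lamplighter one_lamplighter)
qed

text \<open>If the image of P squares to 1, then so does P, by injectivity of
  \<open>F\<close>.\<close>

lemma snd_base_conv:
  assumes "(x, n) \<in> H" "snd (F (x, n)) = 0"
  shows "n = 0"
proof -
  let ?P = "(x, n)"
  have "F ?P \<otimes>\<^bsub>lamplighter\<^esub> F ?P = \<one>\<^bsub>lamplighter\<^esub>"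
    using assms(2) fst_closed[OF assms(1)]
    by (cases "F ?P") (simp add: mult_lamplighter one_lamplighter lampK_square)
  then have "F (?P \<otimes>\<^bsub>lamplighter\<^esub> ?P) = F \<one>\<^bsub>lamplighter\<^esub>"
    using F_mult[OF assms(1) assms(1)] F_one by simp
  then have "?P \<otimes>\<^bsub>lamplighter\<^esub> ?P = \<one>\<^bsub>lamplighter\<^esub>"
    using inj_onD[OF F_inj] H.m_closed[OF assms(1) assms(1)] H.one_closed by blast
  then show ?thesis by (simp add: mult_lamplighter one_lamplighter)
qed

definition base where "base = {x \<in> carrier lampK. (x, 0) \<in> H}"

definition base_map where "base_map = (\<lambda>x\<in>base. fst (F (x, 0)))"

definition top_map where "top_map n = F (\<one>\<^bsub>lampK\<^esub>, n)"

lemma F_base: "x \<in> base \<Longrightarrow> F (x, 0) = (base_map x, 0)"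
  using snd_base[of x] by (simp add: base_def base_map_def prod_eq_iff)

text \<open>Only elements of K are mapped into K, so the image of \<open>base_map\<close> is the
  base of the image of \<open>F\<close> and inherits finite index from it.\<close>

lemma base_map_partial: "(base, base_map) \<in> partial_auts lampK"
proof -
  have sub: "fin_index_subgroup base lampK"
    unfolding base_def by (rule fin_index_lamplighter_base[OF H_fin_index])
  have B: "x \<in> base \<longleftrightarrow> (x, 0) \<in> H" for x using H_carrier by (auto simp: base_def)
  have "base_map ` base = {y \<in> carrier lampK. (y, 0) \<in> F ` H}"
  proof
    show "base_map ` base \<subseteq> {y \<in> carrier lampK. (y, 0) \<in> F ` H}"
      using F_base B fst_closed by (force simp: base_map_def)
    show "{y \<in> carrier lampK. (y, 0) \<in> F ` H} \<subseteq> base_map ` base"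
    proof
      fix y assume "y \<in> {y \<in> carrier lampK. (y, 0) \<in> F ` H}"
      then obtain x n where xn: "(x, n) \<in> H" "F (x, n) = (y, 0)" by force
      then have "n = 0" using snd_base_conv[OF xn(1)] by simp
      then show "y \<in> base_map ` base" using xn F_base[of x] B by (intro image_eqI[of _ _ x]) auto
    qed
  qed
  moreover have "fin_index_subgroup {y \<in> carrier lampK. (y, 0) \<in> F ` H} lampK"
    using F by (intro fin_index_lamplighter_base) (simp add: L.partial_auts_iff)
  moreover have "inj_on base_map base"
  proof (rule inj_onI)
    fix x y assume xy: "x \<in> base" "y \<in> base" "base_map x = base_map y"
    then have "F (x, 0) = F (y, 0)" by (simp add: F_base)
    then show "x = y" using xy B inj_onD[OF F_inj] by blast
  qed
  moreover have "base_map \<in> hom (lampK\<lparr>carrier := base\<rparr>) lampK"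
  proof (rule homI)
    show "base_map x \<in> carrier lampK" if "x \<in> carrier (lampK\<lparr>carrier := base\<rparr>)" for x
      using that fst_closed B by (simp add: base_map_def)
    fix x y assume "x \<in> carrier (lampK\<lparr>carrier := base\<rparr>)" "y \<in> carrier (lampK\<lparr>carrier := base\<rparr>)"
    then have xy: "x \<in> base" "y \<in> base" by auto
    then have xym: "x \<otimes>\<^bsub>lampK\<^esub> y \<in> base" using subgroup.m_closed[OF fin_index_subgroupD[OF sub]] by blast
    have "F (x \<otimes>\<^bsub>lampK\<^esub> y, 0) = F (x, 0) \<otimes>\<^bsub>lamplighter\<^esub> F (y, 0)"
      using F_mult[of "(x, 0)" "(y, 0)"] xy B by (simp add: mult_lamplighter)
    then show "base_map (x \<otimes>\<^bsub>lampK\<lparr>carrier := base\<rparr>\<^esub> y) = base_map x \<otimes>\<^bsub>lampK\<^esub> base_map y"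
      using xy xym by (simp add: F_base mult_lamplighter)
  qed
  ultimately show ?thesis using sub by (simp add: K.partial_auts_iff base_map_def)
qed

text \<open>Apply \<open>F\<close> to the relation t^n x = (t^n x t^-n) t^n. The K-part of the image
  of t^n cancels because K is abelian, and only its Z-part still acts.\<close>

lemma base_map_shift:
  assumes n: "(\<one>\<^bsub>lampK\<^esub>, n) \<in> H" and x: "x \<in> base"
  shows "shiftK n x \<in> base" "base_map (shiftK n x) = shiftK (snd (top_map n)) (base_map x)"
proof -
  have xc: "x \<in> carrier lampK" "(x, 0) \<in> H" using x by (auto simp: base_def)
  have eq: "(shiftK n x, 0) \<otimes>\<^bsub>lamplighter\<^esub> (\<one>\<^bsub>lampK\<^esub>, n) = (\<one>\<^bsub>lampK\<^esub>, n) \<otimes>\<^bsub>lamplighter\<^esub> (x, 0)"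
    using xc by (simp add: mult_lamplighter)
  have "(shiftK n x, 0) = (\<one>\<^bsub>lampK\<^esub>, n) \<otimes>\<^bsub>lamplighter\<^esub> (x, 0) \<otimes>\<^bsub>lamplighter\<^esub> inv\<^bsub>lamplighter\<^esub> (\<one>\<^bsub>lampK\<^esub>, n)"
    using xc by (simp add: mult_lamplighter inv_lamplighter)
  then have s: "(shiftK n x, 0) \<in> H" using n xc by (metis H.m_closed H.m_inv_closed)
  then show b: "shiftK n x \<in> base" using xc by (simp add: base_def)
  obtain u k where u: "F (\<one>\<^bsub>lampK\<^esub>, n) = (u, k)" by force
  have uc: "u \<in> carrier lampK" using fst_closed[OF n] by (simp add: u)
  have "F (shiftK n x, 0) \<otimes>\<^bsub>lamplighter\<^esub> F (\<one>\<^bsub>lampK\<^esub>, n) = F (\<one>\<^bsub>lampK\<^esub>, n) \<otimes>\<^bsub>lamplighter\<^esub> F (x, 0)"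
    using F_mult[OF s n] F_mult[OF n xc(2)] eq by simp
  then have "base_map (shiftK n x) \<otimes>\<^bsub>lampK\<^esub> u = u \<otimes>\<^bsub>lampK\<^esub> shiftK k (base_map x)"
    by (simp add: F_base x b u mult_lamplighter)
  also have "\<dots> = shiftK k (base_map x) \<otimes>\<^bsub>lampK\<^esub> u"
    using uc partial_auts_closed[OF base_map_partial] x by (simp add: K.m_comm)
  finally show "base_map (shiftK n x) = shiftK (snd (top_map n)) (base_map x)"
    using uc partial_auts_closed[OF base_map_partial] x b
    by (simp add: top_map_def u)
qed

lemma top_map_add:
  assumes "(\<one>\<^bsub>lampK\<^esub>, a) \<in> H" "(\<one>\<^bsub>lampK\<^esub>, b) \<in> H"
  shows "top_map (a + b) = top_map a \<otimes>\<^bsub>lamplighter\<^esub> top_map b"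
  using F_mult[OF assms] by (simp add: top_map_def mult_lamplighter)

end

lemma int_additive_linear:
  fixes \<phi> :: "int \<Rightarrow> int"
  assumes "\<And>a b. \<phi> (a + b) = \<phi> a + \<phi> b"
  shows "\<phi> k = k * \<phi> 1"
proof (induction k rule: int_induct[where k = 0])
  case base
  then show ?case using assms[of 0 0] by simp
next
  case (step1 i)
  then show ?case using assms[of i 1] by (simp add: algebra_simps)
next
  case (step2 i)
  then show ?case using assms[of "i - 1" 1] by (simp add: algebra_simps)
qed

text \<open>The sign \<epsilon> describes the map induced on the quotient by K: on the multiples of
  some level it is multiplication by \<epsilon>.\<close>

definition oriented :: "int \<Rightarrow> (lamp \<times> int) partial_aut \<Rightarrow> bool"
  where "oriented \<epsilon> P \<longleftrightarrow> (\<exists>m\<ge>1. \<forall>n\<in>multiples m.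
    (\<one>\<^bsub>lampK\<^esub>, n) \<in> fst P \<and> snd (snd P (\<one>\<^bsub>lampK\<^esub>, n)) = \<epsilon> * n)"

lemma (in lamp_partial_aut) oriented_cases: "oriented 1 (H, F) \<or> oriented (- 1) (H, F)"
proof -
  obtain m where m: "m \<ge> 1" and top: "{n. (\<one>\<^bsub>lampK\<^esub>, n) \<in> H} = multiples m"
    using fin_index_lamplighter_top[OF H_fin_index] .
  have topH: "(\<one>\<^bsub>lampK\<^esub>, n) \<in> H \<longleftrightarrow> n \<in> multiples m" for n using top by blast
  define q where "q = snd (top_map (int m))"
  have mult: "k * int m \<in> multiples m" for k by (simp add: mem_multiples)
  have lin: "snd (top_map (k * int m)) = k * q" for k
  proof -
    have "snd (top_map ((a + b) * int m)) = snd (top_map (a * int m)) + snd (top_map (b * int m))" for a b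
      using top_map_add[of "a * int m" "b * int m"] mult topH
      by (cases "top_map (a * int m)"; cases "top_map (b * int m)")
        (simp add: distrib_right mult_lamplighter)
    from int_additive_linear[of "\<lambda>k. snd (top_map (k * int m))", OF this, of k]
    show ?thesis by (simp add: q_def)
  qed
  have q0: "q \<noteq> 0"
    using snd_base_conv[of "\<one>\<^bsub>lampK\<^esub>" "int m"] topH[of "int m"] m
    by (auto simp: q_def top_map_def mem_multiples)
  have shift: "shiftK (k * int m) x \<in> base" "base_map (shiftK (k * int m) x) = shiftK (k * q) (base_map x)"
    if "x \<in> base" for k x
    using base_map_shift[of "k * int m" x] that topH mult lin by auto
  have bm: "fin_index_subgroup base lampK" "base_map \<in> hom (lampK\<lparr>carrier := base\<rparr>) lampK"
    "inj_on base_map base" "fin_index_subgroup (base_map ` base) lampK"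
    using base_map_partial by (auto simp: K.partial_auts_iff)
  have "int m \<le> \<bar>q\<bar>"
  proof (rule virtual_embedding_growth[OF bm(1) m _ bm(2,3)])
    show "shiftK n x \<in> base" if "n \<in> multiples m" "x \<in> base" for n x
      using that shift(1)[of x "n div int m"] by (simp add: mem_multiples)
    show "base_map (shiftK (int m) x) = shiftK q (base_map x)" if "x \<in> base" for x
      using shift(2)[OF that, of 1] by simp
  qed
  moreover have "\<bar>q\<bar> \<le> int m"
  proof -
    let ?g = "inv_into base base_map"
    have g: "?g (base_map x) = x" if "x \<in> base" for x using bm(3) that by simp
    \<comment> \<open>The growth bound for the inverse: it intertwines t^q with t^m. Its level has
      to be a natural number, so both exponents are multiplied by the sign of
      \<open>q\<close>.\<close>
    have "int (nat \<bar>q\<bar>) \<le> \<bar>sgn q * int m\<bar>"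
    proof (rule virtual_embedding_growth[OF bm(4)])
      show "nat \<bar>q\<bar> \<ge> 1" using q0 by simp
      show "shiftK n y \<in> base_map ` base" if n: "n \<in> multiples (nat \<bar>q\<bar>)" and y: "y \<in> base_map ` base" for n y
      proof -
        have "q dvd n" using n by (simp add: mem_multiples)
        then obtain k where k: "n = k * q" by (metis dvdE mult.commute)
        obtain x where x: "x \<in> base" "y = base_map x" using y by auto
        show ?thesis using shift[OF x(1), of k] unfolding k x(2) by (metis image_eqI)
      qed
      have "x \<in> carrier lampK" if "x \<in> base" for x using that by (simp add: base_def)
      then show "?g \<in> hom (lampK\<lparr>carrier := base_map ` base\<rparr>) lampK"
        using partial_auts_mult[OF base_map_partial] g
        by (auto simp: hom_def simp flip: partial_auts_mult(1)[OF base_map_partial])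
      show "inj_on ?g (base_map ` base)" by (rule inj_on_inv_into) simp
      show "?g (shiftK (int (nat \<bar>q\<bar>)) y) = shiftK (sgn q * int m) (?g y)" if y: "y \<in> base_map ` base" for y
      proof -
        obtain x where x: "x \<in> base" "y = base_map x" using y by auto
        have q: "int (nat \<bar>q\<bar>) = sgn q * q" by (simp add: sgn_if)
        have "shiftK (int (nat \<bar>q\<bar>)) y = base_map (shiftK (sgn q * int m) x)"
          unfolding q x(2) by (rule shift(2)[OF x(1), symmetric])
        then show ?thesis using g[OF shift(1)[OF x(1)]] g[OF x(1)] x(2) by simp
      qed
    qed
    then show ?thesis using q0 by (simp add: abs_mult)
  qed
  ultimately have "q = int m \<or> q = - int m" by auto
  then obtain \<epsilon> where \<epsilon>: "q = \<epsilon> * int m" "\<epsilon> = 1 \<or> \<epsilon> = -1" by (metis mult_1 mult_minus1)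
  have "oriented \<epsilon> (H, F)"
    unfolding oriented_def fst_conv snd_conv
  proof (intro exI[of _ m] conjI ballI m)
    fix n assume n: "n \<in> multiples m"
    then show "(\<one>\<^bsub>lampK\<^esub>, n) \<in> H" using topH by blast
    obtain k where "n = k * int m" using n unfolding mem_multiples by (metis dvdE mult.commute)
    then show "snd (F (\<one>\<^bsub>lampK\<^esub>, n)) = \<epsilon> * n"
      using lin[of k] \<epsilon>(1) by (simp add: top_map_def)
  qed
  then show ?thesis using \<epsilon>(2) by auto
qed

text \<open>Since (x, n) = (x, 0)(1, n), \<open>F\<close> is determined on \<open>base\<close> times
  mZ by \<open>base_map\<close> and \<open>top_map\<close>. The orientation makes the Z-part of
  \<open>top_map n\<close> equal to \<open>n\<close>; this turns its K-part into a derivation and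
  \<open>base_map_shift\<close> into equivariance.\<close>

lemma (in lamp_partial_aut) oriented_standard:
  assumes "oriented 1 (H, F)"
  obtains m \<tau> p where "standard_datum m \<tau> p" "((H, F), lamp_aut m \<tau> p) \<in> comm_rel lamplighter"
proof -
  obtain m where m: "m \<ge> 1" and top: "\<And>n. n \<in> multiples m \<Longrightarrow> (\<one>\<^bsub>lampK\<^esub>, n) \<in> H"
    "\<And>n. n \<in> multiples m \<Longrightarrow> snd (top_map n) = n"
    using assms by (auto simp: oriented_def top_map_def)
  define \<tau> where "\<tau> = (\<lambda>n\<in>multiples m. fst (top_map n))"
  have tm: "top_map n = (\<tau> n, n)" if "n \<in> multiples m" for n
    using that top(2)[OF that] by (simp add: \<tau>_def prod_eq_iff)
  have "\<tau> \<in> derivs (multiples m)"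
    unfolding derivs_iff
  proof (intro conjI ballI)
    show "\<tau> \<in> multiples m \<rightarrow>\<^sub>E carrier lampK"
      using top(1) fst_closed by (auto simp: \<tau>_def top_map_def)
    fix a b assume ab: "a \<in> multiples m" "b \<in> multiples m"
    then have "a + b \<in> multiples m" by (simp add: mem_multiples)
    then show "\<tau> (a + b) = \<tau> a \<otimes>\<^bsub>lampK\<^esub> shiftK a (\<tau> b)"
      using top_map_add[of a b] ab top(1) by (simp add: tm mult_lamplighter)
  qed
  moreover have "equivariant m (base, base_map)"
    using base_map_shift top by (intro equivariantI) auto
  ultimately have d: "standard_datum m \<tau> (base, base_map)"
    using m base_map_partial by (simp add: standard_datum_def)
  have F_eq: "(x, n) \<in> H" "F (x, n) = (base_map x \<otimes>\<^bsub>lampK\<^esub> \<tau> n, n)"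
    if "x \<in> base" "n \<in> multiples m" for x n
  proof -
    have x: "(x, 0) \<in> H" "x \<in> carrier lampK" using that by (auto simp: base_def)
    have eq: "(x, 0) \<otimes>\<^bsub>lamplighter\<^esub> (\<one>\<^bsub>lampK\<^esub>, n) = (x, n)" using x by (simp add: mult_lamplighter)
    show "(x, n) \<in> H" using H.m_closed[OF x(1) top(1)[OF that(2)]] unfolding eq .
    show "F (x, n) = (base_map x \<otimes>\<^bsub>lampK\<^esub> \<tau> n, n)"
      using F_mult[OF x(1) top(1)[OF that(2)]] tm[OF that(2)] F_base[OF that(1)]
      unfolding eq by (simp add: top_map_def mult_lamplighter)
  qed
  have "((H, F), lamp_aut m \<tau> (base, base_map)) \<in> comm_rel lamplighter"
    using F lamp_aut_partial[OF d] standard_datum_fin_index[OF d] F_eq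
    unfolding lamp_aut_def fst_conv snd_conv
    by (intro comm_relI[of _ _ _ _ _ "base \<times> multiples m"]) auto
  then show ?thesis using that d by blast
qed

text \<open>Precomposition replaces the test points (1, n) by (1, -n). Undoing it later leaves the
  flip on the right, where \<open>comm_elem\<close> has it.\<close>

lemma oriented_flip:
  assumes "oriented (- 1) P" "P \<in> partial_auts lamplighter"
  shows "oriented 1 (pcomp P (lamp_flip 1))"
proof -
  obtain H F where P: "P = (H, F)" by force
  obtain m where m: "m \<ge> 1" "\<And>n. n \<in> multiples m \<Longrightarrow> (\<one>\<^bsub>lampK\<^esub>, n) \<in> H"
    "\<And>n. n \<in> multiples m \<Longrightarrow> snd (F (\<one>\<^bsub>lampK\<^esub>, n)) = - n"
    using assms by (auto simp: oriented_def P)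
  have minus: "- n \<in> multiples m \<longleftrightarrow> n \<in> multiples m" for n by (simp add: mem_multiples)
  have "flipK \<one>\<^bsub>lampK\<^esub> = \<one>\<^bsub>lampK\<^esub>" by (simp add: flipK_def one_lampK)
  then have "\<forall>n\<in>multiples m. (\<one>\<^bsub>lampK\<^esub>, n) \<in> fst (pcomp P (lamp_flip 1)) \<and>
      snd (snd (pcomp P (lamp_flip 1)) (\<one>\<^bsub>lampK\<^esub>, n)) = 1 * n"
    using m(2,3)[of "- _"] by (simp add: P lamp_flip_def pcomp_Pair carrier_lamplighter minus)
  then show ?thesis using m(1) unfolding oriented_def by blast
qed

section \<open>The isomorphism\<close>

interpretation CL: monoid "Comm lamplighter" by (rule L.Comm_monoid)

definition comm_elem :: "nat \<Rightarrow> (int \<Rightarrow> lamp) \<Rightarrow> lamp partial_aut \<Rightarrow> int \<Rightarrow> (lamp \<times> int) comm_class"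
  where "comm_elem m \<tau> p s = cclass lamplighter (lamp_aut m \<tau> p)
    \<otimes>\<^bsub>Comm lamplighter\<^esub> cclass lamplighter (lamp_flip s)"

definition semi_elem :: "nat \<Rightarrow> (int \<Rightarrow> lamp) \<Rightarrow> lamp partial_aut \<Rightarrow> int \<Rightarrow> (lamp_vder \<times> lamp_comm_inf) \<times> int"
  where "semi_elem m \<tau> p s = ((vclass m \<tau>, comm_inf_class (cclass lampK p)), s)"

definition lamplighter_semidirect :: "((lamp_vder \<times> lamp_comm_inf) \<times> int) monoid"
  where "lamplighter_semidirect = semidirect
      (semidirect (VDer integer_group lampK shiftK) Comm_inf Comm_inf_act)
      (integer_mod_group 2)
      flip_act"

section \<open>Every element of either group in normal form, and equality of normal forms\<close>

lemma lamp_flip_class_in: "cclass lamplighter (lamp_flip s) \<in> carrier (Comm lamplighter)"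
  by (rule cclass_in_Comm[OF lamp_flip_partial])

lemma lamp_aut_class_in:
  "standard_datum m \<tau> p \<Longrightarrow> cclass lamplighter (lamp_aut m \<tau> p) \<in> carrier (Comm lamplighter)"
  by (rule cclass_in_Comm[OF lamp_aut_partial])

lemma lamp_flip_class_mult:
  assumes "s \<in> {0, 1}" "s' \<in> {0, 1}"
  shows "cclass lamplighter (lamp_flip s) \<otimes>\<^bsub>Comm lamplighter\<^esub> cclass lamplighter (lamp_flip s')
    = cclass lamplighter (lamp_flip ((s + s') mod 2))"
  by (simp only: L.Comm_mult_class lamp_flip_partial lamp_flip_mult[OF assms])

lemma lamp_flip_class_0: "cclass lamplighter (lamp_flip 0) = \<one>\<^bsub>Comm lamplighter\<^esub>"
proof -
  have "lamp_flip 0 = (carrier lamplighter, \<lambda>x\<in>carrier lamplighter. x)"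
    by (simp add: lamp_flip_def case_prod_unfold)
  then show ?thesis by (simp add: Comm_def)
qed

lemma comm_elem_in: "standard_datum m \<tau> p \<Longrightarrow> comm_elem m \<tau> p s \<in> carrier (Comm lamplighter)"
  unfolding comm_elem_def by (intro CL.m_closed lamp_aut_class_in lamp_flip_class_in)

lemma carrier_lamplighter_semidirect:
  "carrier lamplighter_semidirect
    = (carrier (VDer integer_group lampK shiftK) \<times> carrier Comm_inf) \<times> {0, 1}"
proof -
  have "{0..<2::int} = {0, 1}" by auto
  then show ?thesis
    by (simp add: lamplighter_semidirect_def semidirect_def carrier_integer_mod_group)
qed

lemma standard_datum_class:
  assumes "standard_datum m \<tau> p"
  shows "cclass lampK p \<in> carrier (CommK_equiv m)"
  using assms unfolding standard_datum_def carrier_CommK_equiv by (metis surj_pair)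

lemma semi_elem_in:
  assumes "standard_datum m \<tau> p" "s \<in> {0, 1}"
  shows "semi_elem m \<tau> p s \<in> carrier lamplighter_semidirect"
  using assms vclass_in_VDer[of m \<tau>] comm_inf_class_in[OF _ standard_datum_class[OF assms(1)]]
  by (simp add: semi_elem_def carrier_lamplighter_semidirect standard_datum_def)

lemma semi_elem_cases:
  assumes "r \<in> carrier lamplighter_semidirect"
  obtains m \<tau> p s where "standard_datum m \<tau> p" "s \<in> {0, 1}" "r = semi_elem m \<tau> p s"
proof -
  obtain T B s where r: "r = ((T, B), s)" by (metis surj_pair)
  then have *: "T \<in> carrier (VDer integer_group lampK shiftK)" "B \<in> carrier Comm_inf" "s \<in> {0, 1}"
    using assms by (simp_all add: carrier_lamplighter_semidirect)
  obtain m \<tau> where T: "m \<ge> 1" "\<tau> \<in> derivs (multiples m)" "T = vclass m \<tau>"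
    using VDer_carrier_cases[OF *(1)] .
  obtain n c where B: "n \<ge> 1" "c \<in> carrier (CommK_equiv n)" "B = comm_inf_class c"
    using Comm_inf_cases[OF *(2)] .
  obtain p where p: "p \<in> partial_auts lampK" "equivariant n p" "c = cclass lampK p"
    using B(2) unfolding carrier_CommK_equiv by blast
  \<comment> \<open>The derivation and the commensuration come with unrelated levels; the product is
    a common one.\<close>
  let ?k = "m * n"
  have k: "?k \<ge> 1" "m dvd ?k" "n dvd ?k" using T(1) B(1) by auto
  have "standard_datum ?k (restrict \<tau> (multiples ?k)) p"
    using vclass_restrict(2)[OF T(1) k(1,2) T(2)] p k(1) equivariant_dvd[OF p(2) k(3)]
    by (simp add: standard_datum_def)
  moreover have "r = semi_elem ?k (restrict \<tau> (multiples ?k)) p s"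
    using vclass_restrict(1)[OF T(1) k(1,2) T(2)] by (simp add: semi_elem_def r T(3) B(3) p(3))
  ultimately show ?thesis using that *(3) by blast
qed

lemma comm_elem_cases:
  assumes "c \<in> carrier (Comm lamplighter)"
  obtains m \<tau> p s where "standard_datum m \<tau> p" "s \<in> {0, 1}" "c = comm_elem m \<tau> p s"
proof -
  obtain P where P: "P \<in> partial_auts lamplighter" "c = cclass lamplighter P"
    using assms by (auto simp: carrier_Comm elim!: quotientE)
  have std: "\<exists>m \<tau> p. standard_datum m \<tau> p \<and> cclass lamplighter Q = cclass lamplighter (lamp_aut m \<tau> p)"
    if part: "Q \<in> partial_auts lamplighter" and ori: "oriented 1 Q" for Q
  proof -
    obtain H F where Q: "Q = (H, F)" by force
    interpret lamp_partial_aut H F using part Q by unfold_locales simp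
    obtain m \<tau> p where "standard_datum m \<tau> p" "((H, F), lamp_aut m \<tau> p) \<in> comm_rel lamplighter"
      using oriented_standard ori Q by metis
    then show ?thesis using equiv_class_eq[OF L.equiv_comm_rel] Q by blast
  qed
  have "oriented 1 P \<or> oriented (- 1) P"
    using lamp_partial_aut.oriented_cases P(1) by (metis lamp_partial_aut.intro surj_pair)
  then show ?thesis
  proof
    assume "oriented 1 P"
    then obtain m \<tau> p where d: "standard_datum m \<tau> p" "c = cclass lamplighter (lamp_aut m \<tau> p)"
      using std P by blast
    have "c = comm_elem m \<tau> p 0"
      unfolding comm_elem_def lamp_flip_class_0 d(2) using lamp_aut_class_in[OF d(1)] by simp
    then show ?thesis using that d(1) by blast
  next
    let ?Q = "pcomp P (lamp_flip 1)"
    assume "oriented (- 1) P"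
    then obtain m \<tau> p where d: "standard_datum m \<tau> p"
      "cclass lamplighter ?Q = cclass lamplighter (lamp_aut m \<tau> p)"
      using std[of ?Q] P(1) oriented_flip L.pcomp_closed lamp_flip_partial by blast
    have "pcomp ?Q (lamp_flip 1) = P"
    proof -
      have "pcomp ?Q (lamp_flip 1) = pcomp P (lamp_flip 0)"
        using lamp_flip_mult[of 1 1] by (simp add: pcomp_assoc)
      also have "\<dots> = P"
        using L.pcomp_id(2)[OF P(1)] by (simp add: lamp_flip_def case_prod_unfold)
      finally show ?thesis .
    qed
    then have "c = cclass lamplighter ?Q \<otimes>\<^bsub>Comm lamplighter\<^esub> cclass lamplighter (lamp_flip 1)"
      using L.Comm_mult_class[OF L.pcomp_closed[OF P(1) lamp_flip_partial] lamp_flip_partial] P(2)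
      by metis
    then have "c = comm_elem m \<tau> p 1" by (simp only: comm_elem_def d(2))
    then show ?thesis using that d(1) by blast
  qed
qed

text \<open>On a common subgroup of agreement the Z-part of the images of (1, k) is \<open>k\<close>
  or \<open>- k\<close> according to the sign, and these differ for k \<ge> 1.\<close>

lemma comm_elem_orientation:
  assumes p: "standard_datum m \<tau> p" and q: "standard_datum n \<upsilon> q"
    and s: "s \<in> {0, 1}" "s' \<in> {0, 1}" and eq: "comm_elem m \<tau> p s = comm_elem n \<upsilon> q s'"
  shows "s = s'"
proof -
  note part = L.pcomp_closed[OF lamp_aut_partial lamp_flip_partial]
  have rel: "(pcomp (lamp_aut m \<tau> p) (lamp_flip s), pcomp (lamp_aut n \<upsilon> q) (lamp_flip s'))
      \<in> comm_rel lamplighter"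
    using eq L.cclass_eq_iff[OF part[OF p] part[OF q]]
    by (simp add: comm_elem_def L.Comm_mult_class lamp_aut_partial[OF p] lamp_aut_partial[OF q]
        lamp_flip_partial)
  obtain A F B G where AB: "pcomp (lamp_aut m \<tau> p) (lamp_flip s) = (A, F)"
    "pcomp (lamp_aut n \<upsilon> q) (lamp_flip s') = (B, G)" by (metis surj_pair)
  obtain L where L: "fin_index_subgroup L lamplighter" "L \<subseteq> A" "L \<subseteq> B" "\<forall>x\<in>L. F x = G x"
    by (rule comm_relE[OF rel[unfolded AB]]) (rule that)
  have snd: "snd (F (x, i)) = (if s = 0 then i else - i)"
    if "pcomp (lamp_aut m \<tau> p) (lamp_flip s) = (A, F)" "(x, i) \<in> A" for m \<tau> p s A F x i
    using that unfolding lamp_aut_def lamp_flip_def pcomp_Pair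
    by (auto split: if_splits)
  obtain k where k: "k \<ge> 1" "{n. (\<one>\<^bsub>lampK\<^esub>, n) \<in> L} = multiples k"
    using fin_index_lamplighter_top[OF L(1)] .
  then have kL: "(\<one>\<^bsub>lampK\<^esub>, int k) \<in> L" by (auto simp: mem_multiples)
  then have "(if s = 0 then int k else - int k) = (if s' = 0 then int k else - int k)"
    using snd[OF AB(1)] snd[OF AB(2)] L(2-4) by (metis subsetD)
  then show "s = s'" using k(1) s by (auto split: if_splits)
qed

text \<open>One direction makes the isomorphism well defined, the other makes it injective. Once the
  signs are known to agree, the flip is cancelled by multiplying with it again, and
  \<open>lamp_aut_rel_iff\<close> compares the remaining parts.\<close>

lemma comm_elem_eq_iff:
  assumes p: "standard_datum m \<tau> p" and q: "standard_datum n \<upsilon> q" and s: "s \<in> {0, 1}" "s' \<in> {0, 1}"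
  shows "comm_elem m \<tau> p s = comm_elem n \<upsilon> q s' \<longleftrightarrow> semi_elem m \<tau> p s = semi_elem n \<upsilon> q s'"
proof -
  have pp: "p \<in> partial_auts lampK" "q \<in> partial_auts lampK" "m \<ge> 1"
    using p q by (auto simp: standard_datum_def)
  have R: "semi_elem m \<tau> p s = semi_elem n \<upsilon> q s' \<longleftrightarrow>
      cclass lamplighter (lamp_aut m \<tau> p) = cclass lamplighter (lamp_aut n \<upsilon> q) \<and> s = s'"
    using lamp_aut_rel_iff[OF p q] L.cclass_eq_iff[OF lamp_aut_partial[OF p] lamp_aut_partial[OF q]]
      K.cclass_eq_iff[OF pp(1,2)] comm_inf_class_inject[OF pp(3) standard_datum_class[OF p]]
    unfolding semi_elem_def by auto
  have cancel: "comm_elem m \<tau> p s \<otimes>\<^bsub>Comm lamplighter\<^esub> cclass lamplighter (lamp_flip s)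
      = cclass lamplighter (lamp_aut m \<tau> p)" if "standard_datum m \<tau> p" "s \<in> {0, 1}" for m \<tau> p s
  proof -
    have "(s + s) mod 2 = 0" by simp
    then show ?thesis
      unfolding comm_elem_def
      using that lamp_aut_class_in[OF that(1)]
      by (simp only: CL.m_assoc lamp_flip_class_in lamp_flip_class_mult lamp_flip_class_0 CL.r_one)
  qed
  show ?thesis
  proof
    assume eq: "comm_elem m \<tau> p s = comm_elem n \<upsilon> q s'"
    then have "s = s'" by (rule comm_elem_orientation[OF p q s])
    then show "semi_elem m \<tau> p s = semi_elem n \<upsilon> q s'"
      unfolding R using cancel[OF p s(1)] cancel[OF q s(2)] eq by metis
  qed (simp add: R comm_elem_def)
qed

section \<open>Products of normal forms and the choice of a common level\<close>

definition flip_power :: "int \<Rightarrow> nat \<Rightarrow> (int \<Rightarrow> lamp) \<times> lamp partial_aut \<Rightarrow> (int \<Rightarrow> lamp) \<times> lamp partial_aut"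
  where "flip_power s m = (\<lambda>(\<tau>, p). if s = 0 then (\<tau>, p) else (flip_deriv (multiples m) \<tau>, flip_conj p))"

lemma flip_power_standard:
  assumes "standard_datum m \<tau> p" "flip_power s m (\<tau>, p) = (\<tau>', p')"
  shows "standard_datum m \<tau>' p'"
  using assms standard_datum_flip[OF assms(1)] by (auto simp: flip_power_def split: if_splits)

lemma flip_act_classes:
  assumes d: "standard_datum m \<tau> p" and fp: "flip_power s m (\<tau>, p) = (\<tau>', p')"
  shows "flip_act s (vclass m \<tau>, comm_inf_class (cclass lampK p))
    = (vclass m \<tau>', comm_inf_class (cclass lampK p'))"
  using assms flip_VDer_class[of m \<tau>] flip_Comm_inf_class[of p]
  by (auto simp: flip_power_def flip_act_def standard_datum_def split: if_splits)

lemma lamp_flip_lamp_aut_class: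
  assumes d: "standard_datum m \<tau> p" and s: "s \<in> {0, 1}" and fp: "flip_power s m (\<tau>, p) = (\<tau>', p')"
  shows "cclass lamplighter (lamp_flip s) \<otimes>\<^bsub>Comm lamplighter\<^esub> cclass lamplighter (lamp_aut m \<tau> p)
    = cclass lamplighter (lamp_aut m \<tau>' p') \<otimes>\<^bsub>Comm lamplighter\<^esub> cclass lamplighter (lamp_flip s)"
proof (cases "s = 0")
  case True
  then show ?thesis
    using fp lamp_aut_class_in[OF d] by (simp add: flip_power_def lamp_flip_class_0)
next
  case False
  then have "s = 1" "\<tau>' = flip_deriv (multiples m) \<tau>" "p' = flip_conj p"
    using s fp by (auto simp: flip_power_def)
  then show ?thesis
    using pcomp_flip_lamp_aut[OF d] d standard_datum_flip[OF d]
    by (simp add: L.Comm_mult_class lamp_flip_partial lamp_aut_partial)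
qed

text \<open>With A, B the two normal forms and c the flips, A c(s) B c(s') = A B' c(s) c(s'), where
  B' is B conjugated by c(s). The assumption \<open>im\<close> concerns the conjugated derivation,
  since it is the one to which the commensuration of the first factor is applied.\<close>

lemma elem_mult:
  assumes d: "standard_datum m \<tau> p" and e: "standard_datum m \<upsilon> q" and s: "s \<in> {0, 1}" "s' \<in> {0, 1}"
    and fp: "flip_power s m (\<upsilon>, q) = (\<upsilon>', q')" and im: "\<upsilon>' ` multiples m \<subseteq> fst p"
  shows "\<exists>\<tau>'' p''. standard_datum m \<tau>'' p'' \<and>
    comm_elem m \<tau> p s \<otimes>\<^bsub>Comm lamplighter\<^esub> comm_elem m \<upsilon> q s' = comm_elem m \<tau>'' p'' ((s + s') mod 2) \<and>
    semi_elem m \<tau> p s \<otimes>\<^bsub>lamplighter_semidirect\<^esub> semi_elem m \<upsilon> q s' = semi_elem m \<tau>'' p'' ((s + s') mod 2)"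
proof -
  have e': "standard_datum m \<upsilon>' q'" by (rule flip_power_standard[OF e fp])
  let ?\<phi> = "\<lambda>n\<in>multiples m. snd p (\<upsilon>' n)"
  let ?\<tau> = "\<lambda>n\<in>multiples m. \<tau> n \<otimes>\<^bsub>lampK\<^esub> ?\<phi> n"
  let ?p = "pcomp p q'"
  obtain H f where p: "p = (H, f)" by force
  have m: "m \<ge> 1" and f: "(H, f) \<in> partial_auts lampK" "equivariant m (H, f)"
    and \<tau>: "\<tau> \<in> derivs (multiples m)" and \<upsilon>': "\<upsilon>' \<in> derivs (multiples m)"
    using d e' by (auto simp: standard_datum_def p)
  have im': "\<upsilon>' ` multiples m \<subseteq> H" using im p by simp
  have act: "Comm_inf_act (comm_inf_class (cclass lampK p)) (vclass m \<upsilon>') = vclass m ?\<phi>"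
    and \<phi>: "?\<phi> \<in> derivs (multiples m)"
    using Comm_inf_act_class[OF m f \<upsilon>' im'] by (simp_all add: p)
  have std: "standard_datum m ?\<tau> ?p"
    unfolding standard_datum_def
  proof (intro conjI m)
    show "?\<tau> \<in> derivs (multiples m)" by (rule derivs_mult[OF \<tau> \<phi> fin_index_multiples[OF m]])
    show "?p \<in> partial_auts lampK" "equivariant m ?p"
      using d e' by (auto simp: standard_datum_def intro: K.pcomp_closed equivariant_pcomp)
  qed
  let ?A = "cclass lamplighter (lamp_aut m \<tau> p)"
  let ?B = "cclass lamplighter (lamp_aut m \<upsilon> q)"
  let ?B' = "cclass lamplighter (lamp_aut m \<upsilon>' q')"
  let ?c = "\<lambda>s. cclass lamplighter (lamp_flip s)"
  note carr = lamp_aut_class_in[OF d] lamp_aut_class_in[OF e] lamp_aut_class_in[OF e'] lamp_flip_class_in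
  have "comm_elem m \<tau> p s \<otimes>\<^bsub>Comm lamplighter\<^esub> comm_elem m \<upsilon> q s'
      = ?A \<otimes>\<^bsub>Comm lamplighter\<^esub> (?c s \<otimes>\<^bsub>Comm lamplighter\<^esub> ?B) \<otimes>\<^bsub>Comm lamplighter\<^esub> ?c s'"
    unfolding comm_elem_def using carr by (simp only: CL.m_assoc CL.m_closed)
  also have "\<dots> = (?A \<otimes>\<^bsub>Comm lamplighter\<^esub> ?B') \<otimes>\<^bsub>Comm lamplighter\<^esub> (?c s \<otimes>\<^bsub>Comm lamplighter\<^esub> ?c s')"
    unfolding lamp_flip_lamp_aut_class[OF e s(1) fp] using carr by (simp only: CL.m_assoc CL.m_closed)
  also have "?A \<otimes>\<^bsub>Comm lamplighter\<^esub> ?B' = cclass lamplighter (lamp_aut m ?\<tau> ?p)"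
    using L.Comm_mult_class[OF lamp_aut_partial[OF d] lamp_aut_partial[OF e']]
      pcomp_lamp_aut[OF d e' im] by simp
  also have "?c s \<otimes>\<^bsub>Comm lamplighter\<^esub> ?c s' = ?c ((s + s') mod 2)" by (rule lamp_flip_class_mult[OF s])
  finally have lhs: "comm_elem m \<tau> p s \<otimes>\<^bsub>Comm lamplighter\<^esub> comm_elem m \<upsilon> q s'
      = comm_elem m ?\<tau> ?p ((s + s') mod 2)"
    unfolding comm_elem_def .
  have "semi_elem m \<tau> p s \<otimes>\<^bsub>lamplighter_semidirect\<^esub> semi_elem m \<upsilon> q s'
      = ((vclass m \<tau> \<otimes>\<^bsub>VDer integer_group lampK shiftK\<^esub> vclass m ?\<phi>,
          comm_inf_class (cclass lampK p) \<otimes>\<^bsub>Comm_inf\<^esub> comm_inf_class (cclass lampK q')), (s + s') mod 2)"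
    by (simp add: semi_elem_def lamplighter_semidirect_def semidirect_def flip_act_classes[OF e fp] act)
  also have "\<dots> = semi_elem m ?\<tau> ?p ((s + s') mod 2)"
    using vclass_mult[OF m \<tau> \<phi>]
      comm_inf_class_mult[OF m standard_datum_class[OF d] standard_datum_class[OF e']]
      K.Comm_mult_class[of p q'] d e'
    by (simp add: semi_elem_def standard_datum_def)
  finally show ?thesis using std lhs by blast
qed

lemma elem_restrict:
  assumes d: "standard_datum m \<tau> p" and k: "m dvd k" "k \<ge> 1" and s: "s \<in> {0, 1}"
  shows "comm_elem k (restrict \<tau> (multiples k)) p s = comm_elem m \<tau> p s"
    "semi_elem k (restrict \<tau> (multiples k)) p s = semi_elem m \<tau> p s"
proof -
  \<comment> \<open>Restriction visibly preserves the class of the derivation; the equality of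
    commensurations follows from it through \<open>comm_elem_eq_iff\<close>.\<close>
  show *: "semi_elem k (restrict \<tau> (multiples k)) p s = semi_elem m \<tau> p s"
    using d k vclass_restrict(1)[of m k \<tau>] by (simp add: semi_elem_def standard_datum_def)
  show "comm_elem k (restrict \<tau> (multiples k)) p s = comm_elem m \<tau> p s"
    using comm_elem_eq_iff[OF standard_datum_restrict[OF d k] d s s] * by blast
qed

lemma common_level:
  assumes d: "standard_datum m \<tau> p" and e: "standard_datum n \<upsilon> q"
  obtains k where "k \<ge> 1" "m dvd k" "n dvd k"
    "fst (flip_power s k (restrict \<upsilon> (multiples k), q)) ` multiples k \<subseteq> fst p"
proof -
  interpret Z: group integer_group by simp
  obtain H f where p: "p = (H, f)" by force
  obtain \<upsilon>' q' where fp: "flip_power s n (\<upsilon>, q) = (\<upsilon>', q')" by (metis surj_pair)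
  have \<upsilon>': "\<upsilon>' \<in> derivs (multiples n)" and n: "n \<ge> 1"
    using flip_power_standard[OF e fp] by (auto simp: standard_datum_def)
  have m: "m \<ge> 1" and f: "fin_index_subgroup H lampK" "equivariant m (H, f)"
    using d by (auto simp: standard_datum_def p K.partial_auts_iff)
  have "fin_index_subgroup {i \<in> multiples n \<inter> multiples m. \<upsilon>' i \<in> H} integer_group"
    using equivariantD(1)[OF f(2)] by (intro derivation_small f(1) m fin_index_multiples n \<upsilon>')
  then obtain k where k: "k \<ge> 1" "{i \<in> multiples n \<inter> multiples m. \<upsilon>' i \<in> H} = multiples k"
    using fin_index_integer_group by metis
  have sub: "multiples k \<subseteq> multiples n" "multiples k \<subseteq> multiples m"
    and im: "\<And>i. i \<in> multiples k \<Longrightarrow> \<upsilon>' i \<in> H" using k(2) by blast+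
  have minus: "- i \<in> multiples k" if "i \<in> multiples k" for i using that by (simp add: mem_multiples)
  \<comment> \<open>The level was found for the conjugated derivation at level \<open>n\<close>. As
    kZ is stable under negation, restricting first and flipping afterwards gives the same values on
    it.\<close>
  have "fst (flip_power s k (restrict \<upsilon> (multiples k), q)) i = \<upsilon>' i" if "i \<in> multiples k" for i
    using fp that minus[OF that] sub(1) by (auto simp: flip_power_def flip_deriv_def split: if_splits)
  then show ?thesis using that[of k] k(1) sub im unfolding multiples_subset_iff p by auto
qed

lemma elem_mult_general:
  assumes d: "standard_datum m \<tau> p" and e: "standard_datum n \<upsilon> q" and s: "s \<in> {0, 1}" "s' \<in> {0, 1}"
  shows "\<exists>k \<tau>'' p'' s''. standard_datum k \<tau>'' p'' \<and> s'' \<in> {0, 1} \<and>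
    comm_elem m \<tau> p s \<otimes>\<^bsub>Comm lamplighter\<^esub> comm_elem n \<upsilon> q s' = comm_elem k \<tau>'' p'' s'' \<and>
    semi_elem m \<tau> p s \<otimes>\<^bsub>lamplighter_semidirect\<^esub> semi_elem n \<upsilon> q s' = semi_elem k \<tau>'' p'' s''"
proof -
  obtain k where k: "k \<ge> 1" "m dvd k" "n dvd k"
    "fst (flip_power s k (restrict \<upsilon> (multiples k), q)) ` multiples k \<subseteq> fst p"
    using common_level[OF d e] .
  obtain \<upsilon>' q' where fp: "flip_power s k (restrict \<upsilon> (multiples k), q) = (\<upsilon>', q')" by (metis surj_pair)
  have im: "\<upsilon>' ` multiples k \<subseteq> fst p" using k(4) fp by simp
  have "(s + s') mod 2 \<in> {0, 1}" by auto
  moreover obtain \<tau>'' p'' where "standard_datum k \<tau>'' p''"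
    "comm_elem m \<tau> p s \<otimes>\<^bsub>Comm lamplighter\<^esub> comm_elem n \<upsilon> q s' = comm_elem k \<tau>'' p'' ((s + s') mod 2)"
    "semi_elem m \<tau> p s \<otimes>\<^bsub>lamplighter_semidirect\<^esub> semi_elem n \<upsilon> q s' = semi_elem k \<tau>'' p'' ((s + s') mod 2)"
    using elem_mult[OF standard_datum_restrict[OF d k(2,1)] standard_datum_restrict[OF e k(3,1)] s fp im]
    unfolding elem_restrict[OF d k(2,1) s(1)] elem_restrict[OF e k(3,1) s(2)] by metis
  ultimately show ?thesis by (intro exI conjI)
qed

theorem theorem1p4:
  shows "Comm lamplighter \<cong>
    semidirect
      (semidirect (VDer integer_group lampK shiftK) Comm_inf Comm_inf_act)
      (integer_mod_group 2)
      flip_act"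
proof -
  \<comment> \<open>Data for a given commensuration are far from unique, so the value is chosen as
    any element they can produce; \<open>comm_elem_eq_iff\<close> leaves a single candidate.\<close>
  define h where "h c = (SOME r. \<exists>m \<tau> p s. standard_datum m \<tau> p \<and> s \<in> {0, 1} \<and>
      c = comm_elem m \<tau> p s \<and> r = semi_elem m \<tau> p s)" for c
  have h: "h (comm_elem m \<tau> p s) = semi_elem m \<tau> p s"
    if "standard_datum m \<tau> p" "s \<in> {0, 1}" for m \<tau> p s
    unfolding h_def
  proof (rule some_equality)
    show "\<exists>n \<upsilon> q s'. standard_datum n \<upsilon> q \<and> s' \<in> {0, 1} \<and>
        comm_elem m \<tau> p s = comm_elem n \<upsilon> q s' \<and> semi_elem m \<tau> p s = semi_elem n \<upsilon> q s'"
      using that by blast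
  qed (use comm_elem_eq_iff that in metis)
  have "h \<in> iso (Comm lamplighter) lamplighter_semidirect"
    unfolding iso_iff
  proof (intro conjI)
    show "h \<in> hom (Comm lamplighter) lamplighter_semidirect"
    proof (rule homI)
      fix c assume "c \<in> carrier (Comm lamplighter)"
      then obtain m \<tau> p s where c: "standard_datum m \<tau> p" "s \<in> {0, 1}" "c = comm_elem m \<tau> p s"
        by (rule comm_elem_cases)
      then show "h c \<in> carrier lamplighter_semidirect" using h semi_elem_in by simp
      fix c' assume "c' \<in> carrier (Comm lamplighter)"
      then obtain n \<upsilon> q s' where c': "standard_datum n \<upsilon> q" "s' \<in> {0, 1}" "c' = comm_elem n \<upsilon> q s'"
        by (rule comm_elem_cases)
      show "h (c \<otimes>\<^bsub>Comm lamplighter\<^esub> c') = h c \<otimes>\<^bsub>lamplighter_semidirect\<^esub> h c'"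
        using elem_mult_general[OF c(1) c'(1) c(2) c'(2)] h c c' by metis
    qed
    show "h ` carrier (Comm lamplighter) = carrier lamplighter_semidirect"
    proof
      show "h ` carrier (Comm lamplighter) \<subseteq> carrier lamplighter_semidirect"
        using comm_elem_cases h semi_elem_in by (metis image_subsetI)
      show "carrier lamplighter_semidirect \<subseteq> h ` carrier (Comm lamplighter)"
        using semi_elem_cases h comm_elem_in by (metis image_eqI subsetI)
    qed
    show "inj_on h (carrier (Comm lamplighter))"
      by (rule inj_onI) (metis comm_elem_cases comm_elem_eq_iff h)
  qed
  then show ?thesis unfolding lamplighter_semidirect_def by (rule is_isoI)
qed

end
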